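(* Let $k\ge3$ be a fixed integer. As $|n|\to\infty$ (with $n$ a nonzero integer), the following holds uniformly over bipartite Diophantine tuples $(A,B)$ with property $BD_k(n)$ and over integers $m\ge r_k-s_k$ with $m=o(\log\log|n|)$: $$|A|\ge m+s_k\implies|B|\le|n|^{\frac{t_k\phi(k)}{\theta_{k,m}}+o(1)}.$$ That is: for every function $h$ with $h(y)=o(\log\log y)$ as $y\to\infty$ and every $\varepsilon>0$ there is $n_0=n_0(k,h,\varepsilon)$ such that for every integer $n$ with $|n|\ge n_0$, every integer $m$ with $r_k-s_k\le m\le h(|n|)$, and every bipartite Diophantine tuple $(A,B)$ with property $BD_k(n)$ and $|A|\ge m+s_k$, one has $|B|\le|n|^{t_k\phi(k)/\theta_{k,m}+\varepsilon}$.
   Context: $\mathbb{N}$ denotes the set of positive integers, and a (perfect) $k$-th power means an integer $x^k$ with $x\in\mathbb{N}$. For an integer $k\ge2$ and a nonzero integer $n$, a pair $(A,B)$ is a bipartite Diophantine tuple with property $BD_k(n)$ if $A,B\subseteq\mathbb{N}$ each have size at least $2$ and $ab+n$ is a $k$-th power for every $a\in A$, $b\in B$. $\phi$ is Euler's totient function. Constants: $r_3=9$, $r_4=6$, $r_5=5$, $r_k=4$ for $k\ge6$; $s_3=6$, $s_4=4$, $s_5=3$, $s_k=2$ for $k\ge6$; $t_3=\frac{15399}{938}$, $t_4=\frac{34}{3}$, $t_5=\frac{97}{23}$, $t_6=\frac{29}{4}$, $t_k=\frac{k^2+k-4}{k^2-6k+6}$ for $k\ge7$. For positive integers $k,m$,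 $$\theta_{k,m}=\sum_{\substack{1\le i\le k\\ \gcd(i,k)=1}}\gcd(i-1,k)^m,$$ with $\gcd(0,k)=k$. *)

theory Defs
  imports Complex_Main "HOL-Library.Landau_Symbols" "HOL-Number_Theory.Totient"
begin

text \<open>The sets in a bipartite Diophantine tuple are not assumed to be finite, whereas
  \<^const>\<open>card\<close> of an infinite set is 0; hence cardinality lower bounds go through the
  following predicate.\<close>

definition has_at_least :: "nat \<Rightarrow> 'a set \<Rightarrow> bool" where
  "has_at_least c A \<longleftrightarrow> infinite A \<or> c \<le> card A"

text \<open>Perfect powers are powers of positive integers here, so 0 is not one.\<close>

definition perfect_power :: "nat \<Rightarrow> int \<Rightarrow> bool" where
  "perfect_power k z \<longleftrightarrow> (\<exists>x::nat. 0 < x \<and> z = int x ^ k)"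

definition bipartite_diophantine :: "nat \<Rightarrow> int \<Rightarrow> nat set \<Rightarrow> nat set \<Rightarrow> bool" where
  "bipartite_diophantine k n A B \<longleftrightarrow>
     (\<forall>a\<in>A. 0 < a) \<and> (\<forall>b\<in>B. 0 < b) \<and>
     has_at_least 2 A \<and> has_at_least 2 B \<and>
     (\<forall>a\<in>A. \<forall>b\<in>B. perfect_power k (int a * int b + n))"

text \<open>The constants below are meaningful only for \<open>k \<ge> 3\<close>; their values at smaller
  \<open>k\<close> are irrelevant.\<close>

definition r_const :: "nat \<Rightarrow> nat" where
  "r_const k = (if k = 3 then 9 else if k = 4 then 6 else if k = 5 then 5 else 4)"

definition s_const :: "nat \<Rightarrow> nat" where
  "s_const k = (if k = 3 then 6 else if k = 4 then 4 else if k = 5 then 3 else 2)"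

definition t_const :: "nat \<Rightarrow> real" where
  "t_const k =
     (if k = 3 then 15399 / 938 else if k = 4 then 34 / 3
      else if k = 5 then 97 / 23 else if k = 6 then 29 / 4
      else (real k ^ 2 + real k - 4) / (real k ^ 2 - 6 * real k + 6))"

definition theta :: "nat \<Rightarrow> nat \<Rightarrow> nat" where
  "theta k m = (\<Sum>i | 1 \<le> i \<and> i \<le> k \<and> coprime i k. gcd (i - 1) k ^ m)"

end

theory Submission
  imports Defs "HOL-Analysis.Analysis"
begin

text \<open>Fix \<open>b < b'\<close> in \<open>B\<close>. Every \<open>a\<close> in \<open>A\<close> gives a solution of the Thue equation
  \<open>b' x\<^sup>k - b y\<^sup>k = n (b' - b)\<close>, and Pade approximation to the \<open>k\<close>-th root shows that one large
  solution excludes all much larger ones. Combined with the gap principle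
  \<open>(a b)\<^bsup>k-1\<^esup> \<le> \<bar>n\<bar>\<^sup>k a' b'\<close> for \<open>a < a'\<close>, \<open>b < b'\<close>, this shows that only boundedly many elements
  of \<open>B\<close> exceed \<open>\<bar>n\<bar>\<^sup>T\<close>, for a constant \<open>T\<close>, and that all but \<open>c\<^sub>k < s\<^sub>k\<close> elements of \<open>A\<close> are bounded
  by a fixed power of \<open>\<bar>n\<bar>\<close> as soon as \<open>B\<close> has two elements below \<open>\<bar>n\<bar>\<^sup>T\<close>.

  The elements \<open>b \<le> \<bar>n\<bar>\<^sup>T\<close> are counted by the method of Bombieri and Pila, applied to the curve
  \<open>x\<^sub>i\<^sup>k = a\<^sub>i b + n\<close>, \<open>i \<le> l\<close>, which has degree \<open>k\<^sup>l\<close> over the \<open>b\<close>-line. With \<open>l = m + s\<^sub>k - c\<^sub>k\<close> this gives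
  the exponent \<open>T / k\<^sup>l\<close>, and \<open>T\<close> can be chosen at most \<open>t\<^sub>k\<close> times the \<open>(s\<^sub>k - c\<^sub>k)\<close>-th power of \<open>k\<close>. So the
  exponent is at most \<open>t\<^sub>k / k\<^sup>m\<close>, which suffices because \<open>\<theta> \<le> \<phi>(k) k\<^sup>m\<close>. As it tends to \<open>0\<close> for
  \<open>m \<rightarrow> \<infinity>\<close>, only boundedly many \<open>m\<close> have to be considered for a given \<open>\<epsilon>\<close>.\<close>

section \<open>Pade approximation to \<open>(1 + w)\<^sup>\<nu>\<close>\<close>

text \<open>The coefficients of the approximant of order \<open>s\<close> become integral after
  multiplication by powers of \<open>k\<close>, so in logarithms all estimates are linear in
  \<open>s\<close>. Excluding a second solution then means covering the possible ratios log a / log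
  a0 by intervals, one for each pair of consecutive orders; these overlap only from some ratio on.
  Hence the numerical thresholds, and \<open>r_const k\<close> elements of \<open>A\<close> are
  enough for the gap principle to pass them. The counting step needs coefficients a_i bounded by a
  power of |n|. The largest c_k of the chosen elements of \<open>A\<close> may escape such a bound
  and are given up, each at the cost of a factor \<open>k\<close> in the degree. The auxiliary
  function comes from the pigeonhole principle, and irreducibility of the curve is replaced by a
  fact about exponents: those of the radicals are distinct modulo the integers, so the function is a
  nontrivial sum of polynomials times different radicals, and Rolle's theorem bounds its zeros. As
  Taylor expansions degenerate near the zeros of a_i t + n, the intervals are geometric in the
  distance from the largest singularity.\<close>

text \<open>\<open>pade \<nu> r\<close> and \<open>pade (-\<nu>) r\<close> are numerator and denominator of the diagonal approximant. The
  case distinction in \<open>pade_coeff\<close> is not redundant: truncated subtraction makes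
  \<open>(2 * r - m) choose r = 1\<close> for \<open>r = 0 < m\<close>.\<close>

definition pade_coeff :: "real \<Rightarrow> nat \<Rightarrow> nat \<Rightarrow> real" where
  "pade_coeff \<nu> r m = (if m \<le> r then ((real r + \<nu>) gchoose m) * real ((2 * r - m) choose r) else 0)"

definition pade :: "real \<Rightarrow> nat \<Rightarrow> real poly" where
  "pade \<nu> r = (\<Sum>m\<le>r. monom (pade_coeff \<nu> r m) m)"

lemma coeff_pade: "coeff (pade \<nu> r) m = pade_coeff \<nu> r m"
proof -
  have "coeff (pade \<nu> r) m = (\<Sum>i\<le>r. if i = m then pade_coeff \<nu> r m else 0)"
    unfolding pade_def coeff_sum by (intro sum.cong) auto
  thus ?thesis by (simp add: pade_coeff_def)
qed

lemma poly_pade: "poly (pade \<nu> r) w = (\<Sum>m\<le>r. pade_coeff \<nu> r m * w ^ m)"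
  by (simp add: pade_def poly_sum poly_monom)

text \<open>Both sides are the trinomial coefficient that splits \<open>2 r - j\<close> objects into
  classes of sizes \<open>j - t\<close>, \<open>r - j\<close> and \<open>r - j + t\<close>.\<close>

lemma binomial_exchange:
  fixes t j r :: nat
  assumes "t \<le> j" "j \<le> r"
  shows "((2*r-j) choose (r-t)) * ((r-t) choose (j-t)) = ((2*r-j) choose r) * (r choose (j-t))"
proof -
  have "((2*r-j) choose (r-t)) * ((r-t) choose (j-t))
      = ((2*r-j) choose (j-t)) * ((2*r-j-(j-t)) choose (r-t-(j-t)))"
    using assms by (intro choose_mult) auto
  also have "2*r-j-(j-t) = 2*r-2*j+t" using assms by auto
  also have "r-t-(j-t) = r - j" using assms by auto
  also have "(2*r-2*j+t) choose (r-j) = (2*r-2*j+t) choose (r-(j-t))"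
  proof -
    have "(2*r-2*j+t) - (r - j) = r-(j-t)" using assms by auto
    thus ?thesis using binomial_symmetric[of "r-j" "2*r-2*j+t"] assms by auto
  qed
  also have "((2*r-j) choose (j-t)) * \<dots> = ((2*r-j) choose r) * (r choose (j-t))"
  proof -
    have "2*r-j-(j-t) = 2*r-2*j+t" using assms by auto
    thus ?thesis using choose_mult[of "j-t" r "2*r-j"] assms by auto
  qed
  finally show ?thesis .
qed

text \<open>Compare coefficients of X^j: X^t times the t-th derivative of (1 + X)^b, divided by t!,
  is (b gchoose t) X^t (1 + X)^(b - t), and multiplication by (1 + X)^a adds the exponents.\<close>

lemma gbinomial_choose_convolution:
  fixes a b :: real
  shows "(\<Sum>i=0..j. (a gchoose i) * (b gchoose (j - i)) * real ((j - i) choose t))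
       = (if t \<le> j then (b gchoose t) * ((a + b - real t) gchoose (j - t)) else 0)"
proof (cases "t \<le> j")
  case True
  have "(\<Sum>i=0..j. (a gchoose i) * (b gchoose (j - i)) * real ((j - i) choose t))
      = (\<Sum>i=0..j-t. (a gchoose i) * (b gchoose (j - i)) * real ((j - i) choose t))"
    by (rule sum.mono_neutral_right) (use True in \<open>auto simp: binomial_eq_0\<close>)
  also have "\<dots> = (\<Sum>i=0..j-t. (b gchoose t) * ((a gchoose i) * ((b - real t) gchoose (j - t - i))))"
  proof (intro sum.cong refl)
    fix i assume i: "i \<in> {0..j-t}"
    have "(b gchoose (j - i)) * real ((j - i) choose t)
        = (b gchoose t) * ((b - real t) gchoose (j - i - t))"
      using gbinomial_trinomial_revision[of t "j - i" b] i True
      by (simp add: binomial_gbinomial)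
    moreover have "j - i - t = j - t - i" by simp
    ultimately show "(a gchoose i) * (b gchoose (j - i)) * real ((j - i) choose t)
        = (b gchoose t) * ((a gchoose i) * ((b - real t) gchoose (j - t - i)))"
      by (simp add: mult_ac)
  qed
  also have "\<dots> = (b gchoose t) * ((a + (b - real t)) gchoose (j - t))"
    by (simp only: sum_distrib_left[symmetric] gbinomial_Vandermonde)
  finally show ?thesis using True by (simp add: algebra_simps)
next
  case False
  thus ?thesis by (auto simp: binomial_eq_0 intro!: sum.neutral)
qed

text \<open>The coefficients of \<open>pade (-\<nu>) r\<close> times the binomial series of exponent \<open>\<nu>\<close> are obtained by
  three applications of Vandermonde's identity.\<close>

lemma pade_identity:
  assumes j: "j \<le> 2 * r"
  shows "(\<Sum>i=0..j. pade_coeff (-\<nu>) r i * (\<nu> gchoose (j - i))) = pade_coeff \<nu> r j"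
proof -
  \<comment> \<open>Writing 2r - i = (j - i) + (2r - j) leaves \<open>i\<close> only in the factor
    \<open>(j - i) choose t\<close>, so that the sum over \<open>i\<close> becomes the convolution
    of \<open>gbinomial_choose_convolution\<close>.\<close>
  have split: "real ((2*r-i) choose r) = (\<Sum>t\<le>r. real ((j-i) choose t) * real ((2*r-j) choose (r-t)))"
    if "i \<le> j" for i
  proof -
    have "(j-i) + (2*r-j) = 2*r-i" using that j by auto
    thus ?thesis using vandermonde[of "j-i" "2*r-j" r, symmetric] by (simp flip: of_nat_mult of_nat_sum)
  qed
  have "(\<Sum>i=0..j. pade_coeff (-\<nu>) r i * (\<nu> gchoose (j - i)))
     = (\<Sum>i=0..j. \<Sum>t\<le>r. ((real r - \<nu>) gchoose i) * (\<nu> gchoose (j - i))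
          * real ((j-i) choose t) * real ((2*r-j) choose (r-t)))"
  proof (intro sum.cong refl)
    fix i assume i: "i \<in> {0..j}"
    have "pade_coeff (-\<nu>) r i = ((real r - \<nu>) gchoose i) * real ((2*r-i) choose r)"
      using i j by (auto simp: pade_coeff_def binomial_eq_0)
    thus "pade_coeff (-\<nu>) r i * (\<nu> gchoose (j - i)) = (\<Sum>t\<le>r. ((real r - \<nu>) gchoose i) * (\<nu> gchoose (j - i))
          * real ((j-i) choose t) * real ((2*r-j) choose (r-t)))"
      using split[of i] i by (simp add: sum_distrib_left sum_distrib_right mult_ac)
  qed
  also have "\<dots> = (\<Sum>t\<le>r. (\<Sum>i=0..j. ((real r - \<nu>) gchoose i) * (\<nu> gchoose (j - i))
          * real ((j-i) choose t)) * real ((2*r-j) choose (r-t)))"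
    by (subst sum.swap) (simp add: sum_distrib_right)
  \<comment> \<open>The exponents add up to (r - \<nu>) + \<nu> - t = r - t: here \<nu> cancels and
    an ordinary binomial coefficient remains.\<close>
  also have "\<dots> = (\<Sum>t\<le>r. if t \<le> j then (\<nu> gchoose t) * real ((r - t) choose (j - t)) * real ((2*r-j) choose (r-t)) else 0)"
    unfolding gbinomial_choose_convolution
    by (intro sum.cong refl) (auto simp: binomial_gbinomial of_nat_diff)
  also have "\<dots> = pade_coeff \<nu> r j"
  proof (cases "j \<le> r")
    case False
    thus ?thesis by (auto simp: pade_coeff_def binomial_eq_0 intro!: sum.neutral)
  next
    case True
    have "(\<Sum>t\<le>r. if t \<le> j then (\<nu> gchoose t) * real ((r - t) choose (j - t)) * real ((2*r-j) choose (r-t)) else 0)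
        = (\<Sum>t=0..j. (\<nu> gchoose t) * (real ((2*r-j) choose (r-t)) * real ((r - t) choose (j - t))))"
      using True by (intro sum.mono_neutral_cong_right) (auto simp: mult_ac)
    also have "\<dots> = (\<Sum>t=0..j. real ((2*r-j) choose r) * ((\<nu> gchoose t) * (real r gchoose (j-t))))"
    proof (intro sum.cong refl)
      fix t assume "t \<in> {0..j}"
      hence "real ((2*r-j) choose (r-t)) * real ((r - t) choose (j - t)) = real ((2*r-j) choose r) * real (r choose (j-t))"
        using binomial_exchange[of t j r] True by (simp flip: of_nat_mult)
      thus "(\<nu> gchoose t) * (real ((2*r-j) choose (r-t)) * real ((r - t) choose (j - t)))
          = real ((2*r-j) choose r) * ((\<nu> gchoose t) * (real r gchoose (j-t)))"
        by (simp add: binomial_gbinomial)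
    qed
    also have "\<dots> = real ((2*r-j) choose r) * ((\<nu> + real r) gchoose j)"
      by (simp only: sum_distrib_left[symmetric] gbinomial_Vandermonde)
    finally show ?thesis using True by (simp add: pade_coeff_def algebra_simps)
  qed
  finally show ?thesis .
qed

lemma gbinomial_abs_le_choose:
  fixes a :: real
  assumes "real m \<le> a + 1" "a \<le> real s"
  shows "\<bar>a gchoose m\<bar> \<le> real (s choose m)"
proof -
  have "(\<Prod>i=0..<m. \<bar>a - real i\<bar>) \<le> (\<Prod>i=0..<m. real s - real i)"
  proof (rule prod_mono)
    fix i assume "i \<in> {0..<m}"
    hence "real i + 1 \<le> real m" by (simp add: Suc_leI)
    thus "0 \<le> \<bar>a - real i\<bar> \<and> \<bar>a - real i\<bar> \<le> real s - real i" using assms by auto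
  qed
  thus ?thesis
    by (simp add: gbinomial_prod_rev abs_prod binomial_gbinomial divide_right_mono)
qed

lemma gbinomial_abs_le_1:
  fixes \<nu> :: real
  assumes "0 < \<nu>" "\<nu> < 1"
  shows "\<bar>\<nu> gchoose m\<bar> \<le> 1"
proof (induction m)
  case (Suc m)
  have "\<nu> gchoose Suc m = (\<nu> gchoose m) * ((\<nu> - real m) / real (Suc m))"
    using gbinomial_mult_1[of \<nu> m] by (simp add: field_simps)
  moreover have "\<bar>(\<nu> - real m) / real (Suc m)\<bar> \<le> 1" using assms by (simp add: divide_simps)
  ultimately show ?case using Suc abs_mult[of "\<nu> gchoose m" "(\<nu> - real m) / real (Suc m)"]
      mult_le_one[of "\<bar>\<nu> gchoose m\<bar>" "\<bar>(\<nu> - real m) / real (Suc m)\<bar>"] by simp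
qed simp

lemma pade_coeff_bound:
  assumes "0 < \<nu>" "\<nu> < 1"
  shows "\<bar>pade_coeff \<nu> r m\<bar> \<le> 2 * 8 ^ r" "\<bar>pade_coeff (-\<nu>) r m\<bar> \<le> 8 ^ r"
proof -
  have c: "real ((2*r-m) choose r) \<le> 4 ^ r"
  proof -
    have "(2*r-m) choose r \<le> 2 ^ (2*r-m)" by (rule binomial_le_pow2)
    also have "\<dots> \<le> 2 ^ (2*r)" by (rule power_increasing) auto
    finally have "real ((2*r-m) choose r) \<le> real (2 ^ (2*r))" using of_nat_le_iff by blast
    thus ?thesis by (simp add: power_mult)
  qed
  have "\<bar>(real r + \<nu>) gchoose m\<bar> \<le> 2 * 2 ^ r" if "m \<le> r"
  proof -
    have "\<bar>(real r + \<nu>) gchoose m\<bar> \<le> real (Suc r choose m)"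
      by (rule gbinomial_abs_le_choose) (use that assms in auto)
    also have "\<dots> \<le> real (2 ^ Suc r)" using binomial_le_pow2 of_nat_le_iff by blast
    finally show ?thesis by simp
  qed
  hence "\<bar>pade_coeff \<nu> r m\<bar> \<le> (2 * 2 ^ r) * 4 ^ r" 
    unfolding pade_coeff_def using c by (auto simp: abs_mult intro!: mult_mono)
  also have "(2 * 2 ^ r) * 4 ^ r = 2 * (8::real) ^ r" by (simp add: power_mult_distrib[symmetric])
  finally show "\<bar>pade_coeff \<nu> r m\<bar> \<le> 2 * 8 ^ r" .
  have "\<bar>(real r - \<nu>) gchoose m\<bar> \<le> 2 ^ r" if "m \<le> r"
  proof -
    have "\<bar>(real r - \<nu>) gchoose m\<bar> \<le> real (r choose m)"
      by (rule gbinomial_abs_le_choose) (use that assms in auto)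
    also have "\<dots> \<le> real (2 ^ r)" using binomial_le_pow2 of_nat_le_iff by blast
    finally show ?thesis by simp
  qed
  hence "\<bar>pade_coeff (-\<nu>) r m\<bar> \<le> 2 ^ r * 4 ^ r" 
    unfolding pade_coeff_def using c by (auto simp: abs_mult intro!: mult_mono)
  thus "\<bar>pade_coeff (-\<nu>) r m\<bar> \<le> 8 ^ r" by (simp flip: power_mult_distrib)
qed

lemma Suc_le_two_power: "real r + 1 \<le> 2 ^ r"
  using of_nat_mono[OF Suc_leI[OF less_exp[of r]], where ?'a = real] by (simp add: add.commute)

lemma pade_bound:
  assumes "0 < \<nu>" "\<nu> < 1" "\<bar>w\<bar> \<le> 1"
  shows "\<bar>poly (pade (-\<nu>) r) w\<bar> \<le> 16 ^ r"
proof -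
  have "\<bar>poly (pade (-\<nu>) r) w\<bar> \<le> (\<Sum>m\<le>r. \<bar>pade_coeff (-\<nu>) r m * w ^ m\<bar>)"
    unfolding poly_pade by (rule sum_abs)
  also have "\<dots> \<le> (\<Sum>m\<le>r. 8 ^ r * 1)"
    unfolding abs_mult power_abs using pade_coeff_bound[OF assms(1,2)] assms(3)
    by (intro sum_mono mult_mono) (auto intro: power_le_one)
  also have "\<dots> = (real r + 1) * 8 ^ r" by (simp add: add.commute)
  also have "\<dots> \<le> 2 ^ r * 8 ^ r" using Suc_le_two_power by (intro mult_right_mono) auto
  finally show ?thesis by (simp flip: power_mult_distrib)
qed

text \<open>By \<open>pade_identity\<close> the power series of the difference starts at w^(2r+1).
  Each later coefficient is a sum of r + 1 terms of size at most 8^r, hence at most 16^r, and |w| <=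
  1/2 makes the tail geometric, which costs the factor 2.\<close>

lemma pade_approximation:
  assumes nu: "0 < \<nu>" "\<nu> < 1" and w: "\<bar>w\<bar> \<le> 1/2"
  shows "\<bar>poly (pade \<nu> r) w - (1 + w) powr \<nu> * poly (pade (-\<nu>) r) w\<bar> \<le> 2 * 16 ^ r * \<bar>w\<bar> ^ (2*r+1)"
proof -
  define a where "a i = pade_coeff (-\<nu>) r i * w ^ i" for i
  define b where "b i = (\<nu> gchoose i) * w ^ i" for i
  define d where "d j = (\<Sum>i\<le>j. a i * b (j - i))" for j
  define e where "e j = pade_coeff \<nu> r j * w ^ j" for j
  have a0: "a i = 0" if "i \<notin> {..r}" for i using that by (simp add: a_def pade_coeff_def)
  have sa: "summable (\<lambda>i. norm (a i))" by (rule summable_finite[of "{..r}"]) (use a0 in auto)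
  have sb: "summable (\<lambda>i. norm (b i))"
  proof (rule summable_comparison_test'[of "\<lambda>i. \<bar>w\<bar> ^ i" 0])
    show "summable (\<lambda>i. \<bar>w\<bar> ^ i)" using w by (intro summable_geometric) auto
    show "norm (norm (b i)) \<le> \<bar>w\<bar> ^ i" for i
      using gbinomial_abs_le_1[OF nu, of i]
      by (simp add: b_def abs_mult power_abs mult_left_le_one_le)
  qed
  have "d sums ((\<Sum>i. a i) * (\<Sum>i. b i))" unfolding d_def by (rule Cauchy_product_sums[OF sa sb])
  moreover have "(\<Sum>i. a i) = poly (pade (-\<nu>) r) w"
  proof -
    have "(\<Sum>i. a i) = sum a {..r}" by (rule suminf_finite) (use a0 in auto)
    thus ?thesis by (simp add: poly_pade a_def)
  qed
  moreover have "(\<Sum>i. b i) = (1 + w) powr \<nu>"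
    using gen_binomial_real[of w \<nu>] w by (simp add: b_def sums_iff)
  ultimately have d: "d sums ((1 + w) powr \<nu> * poly (pade (-\<nu>) r) w)" by (simp add: mult.commute)
  have e: "e sums poly (pade \<nu> r) w"
    using sums_finite[of "{..r}" e] by (auto simp: e_def pade_coeff_def poly_pade)
  have diff: "(\<lambda>j. e j - d j) sums (poly (pade \<nu> r) w - (1 + w) powr \<nu> * poly (pade (-\<nu>) r) w)"
    by (rule sums_diff[OF e d])
  have dj: "d j = (\<Sum>i=0..j. pade_coeff (-\<nu>) r i * (\<nu> gchoose (j - i))) * w ^ j" for j
    unfolding d_def a_def b_def sum_distrib_right atMost_atLeast0
    by (intro sum.cong refl) (simp add: mult_ac flip: power_add)
  have small: "e j - d j = 0" if "j < 2*r+1" for j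
    using that pade_identity[of j r \<nu>] by (simp add: dj e_def)
  have tail: "(\<lambda>j. e (j + (2*r+1)) - d (j + (2*r+1))) sums
     (poly (pade \<nu> r) w - (1 + w) powr \<nu> * poly (pade (-\<nu>) r) w)"
    using sums_split_initial_segment[OF diff, of "2*r+1"] small by simp
  have bd: "norm (e (j + (2*r+1)) - d (j + (2*r+1))) \<le> 16 ^ r * \<bar>w\<bar> ^ (2*r+1) * (1/2) ^ j" for j
  proof -
    let ?j = "j + (2*r+1)"
    have "norm (e ?j - d ?j) = \<bar>\<Sum>i=0..?j. pade_coeff (-\<nu>) r i * (\<nu> gchoose (?j - i))\<bar> * \<bar>w\<bar> ^ ?j"
      unfolding dj e_def by (simp add: pade_coeff_def abs_mult power_abs)
    also have "(\<Sum>i=0..?j. pade_coeff (-\<nu>) r i * (\<nu> gchoose (?j - i))) = (\<Sum>i\<le>r. pade_coeff (-\<nu>) r i * (\<nu> gchoose (?j - i)))"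
      by (rule sum.mono_neutral_right) (auto simp: pade_coeff_def)
    also have "\<bar>\<dots>\<bar> \<le> (\<Sum>i\<le>r. 8 ^ r * 1)"
      unfolding abs_mult
      by (rule order.trans[OF sum_abs], unfold abs_mult)
         (intro sum_mono mult_mono pade_coeff_bound[OF nu] gbinomial_abs_le_1[OF nu]; simp)
    also have "\<dots> = (real r + 1) * 8 ^ r" by (simp add: add.commute)
    also have "\<dots> \<le> 2 ^ r * 8 ^ r" using Suc_le_two_power by (intro mult_right_mono) auto
    also have "\<dots> = 16 ^ r" by (simp flip: power_mult_distrib)
    also have "\<bar>w\<bar> ^ ?j = \<bar>w\<bar> ^ (2*r+1) * \<bar>w\<bar> ^ j" by (simp add: power_add)
    also have "16 ^ r * (\<bar>w\<bar> ^ (2*r+1) * \<bar>w\<bar> ^ j) \<le> 16 ^ r * (\<bar>w\<bar> ^ (2*r+1) * (1/2) ^ j)"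
      using w by (intro mult_left_mono power_mono) auto
    finally show ?thesis by (simp add: mult_right_mono)
  qed
  have g: "(\<lambda>j. 16 ^ r * \<bar>w\<bar> ^ (2*r+1) * (1/2::real) ^ j) sums (16 ^ r * \<bar>w\<bar> ^ (2*r+1) * 2)"
    using geometric_sums[of "1/2::real"] by (intro sums_mult) auto
  have "norm (\<Sum>j. e (j + (2*r+1)) - d (j + (2*r+1))) \<le> (\<Sum>j. 16 ^ r * \<bar>w\<bar> ^ (2*r+1) * (1/2::real) ^ j)"
    by (rule norm_suminf_le) (use bd g in \<open>auto simp: sums_iff\<close>)
  thus ?thesis using tail g by (simp add: sums_iff mult_ac)
qed

text \<open>The determinant of two consecutive approximants has degree at most 2r+1 and vanishes at
  0 to order at least 2r+1, so it is a monomial, and its coefficient is nonzero. This is what makes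
  the integer in \<open>thue_pair_inequality\<close> nonzero for one of two consecutive
  orders.\<close>

lemma pade_nonvanishing:
  assumes nu: "0 < \<nu>" "\<nu> < 1" and w: "w \<noteq> 0"
  shows "poly (pade \<nu> r) w * poly (pade (-\<nu>) (Suc r)) w \<noteq> poly (pade \<nu> (Suc r)) w * poly (pade (-\<nu>) r) w"
proof -
  define S where "S = fps_binomial \<nu>"
  have van: "fps_nth (fps_of_poly (pade \<nu> s) - S * fps_of_poly (pade (-\<nu>) s)) j = 0" if "j \<le> 2 * s" for s j
    using pade_identity[OF that, of \<nu>]
    by (simp add: coeff_pade S_def mult.commute[of "fps_binomial \<nu>"] fps_mult_nth)
  define Q where "Q = pade \<nu> r * pade (-\<nu>) (Suc r) - pade \<nu> (Suc r) * pade (-\<nu>) r"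
  \<comment> \<open>The terms with \<open>S\<close> times both denominators cancel, so
    \<open>Q\<close> is a combination of the two remainders, each of order at least 2r+1.\<close>
  have Qeq: "fps_of_poly Q = (fps_of_poly (pade \<nu> r) - S * fps_of_poly (pade (-\<nu>) r)) * fps_of_poly (pade (-\<nu>) (Suc r))
      - (fps_of_poly (pade \<nu> (Suc r)) - S * fps_of_poly (pade (-\<nu>) (Suc r))) * fps_of_poly (pade (-\<nu>) r)"
    by (simp add: Q_def fps_of_poly_diff fps_of_poly_mult algebra_simps)
  have low: "coeff Q j = 0" if "j < 2*r+1" for j
  proof -
    have "coeff Q j = fps_nth (fps_of_poly Q) j" by simp
    also have "\<dots> = 0"
    proof -
      have "fps_nth ((fps_of_poly (pade \<nu> s) - S * fps_of_poly (pade (-\<nu>) s)) * g) j = 0"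
        if "j \<le> 2 * s" for s g
      proof (unfold fps_mult_nth[of _ g], intro sum.neutral ballI)
        fix i assume "i \<in> {0..j}"
        hence "i \<le> 2 * s" using that by simp
        from van[OF this] show "fps_nth (fps_of_poly (pade \<nu> s) - S * fps_of_poly (pade (-\<nu>) s)) i * fps_nth g (j - i) = 0"
          by (simp only: mult_zero_left)
      qed
      thus ?thesis unfolding Qeq fps_sub_nth[of "_ * _" "_ * _"] using that by simp
    qed
    finally show ?thesis .
  qed
  have deg: "degree (pade c s) \<le> s" for c s by (rule degree_le) (simp add: coeff_pade pade_coeff_def)
  have top: "coeff (p * q) (i + j) = coeff p i * coeff q j" if "degree p \<le> i" "degree q \<le> j" for p q :: "real poly" and i j
  proof (cases "degree p = i \<and> degree q = j")
    case True thus ?thesis using coeff_mult_degree_sum by blast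
  next
    case False
    hence "degree (p * q) < i + j" using that degree_mult_le[of p q] by linarith
    moreover have "coeff p i * coeff q j = 0" using False that by (auto simp: coeff_eq_0)
    ultimately show ?thesis by (simp add: coeff_eq_0)
  qed
  have "coeff Q (2*r+1) = coeff (pade \<nu> r) r * coeff (pade (-\<nu>) (Suc r)) (Suc r)
       - coeff (pade \<nu> (Suc r)) (Suc r) * coeff (pade (-\<nu>) r) r"
    using top[OF deg[of \<nu> r] deg[of "-\<nu>" "Suc r"]] top[OF deg[of \<nu> "Suc r"] deg[of "-\<nu>" r]]
    by (simp add: Q_def mult_2)
  also have "\<dots> = (((real r + \<nu>) gchoose r) * ((real r + 1 - \<nu>) gchoose (Suc r)) - ((real r + 1 + \<nu>) gchoose (Suc r)) * ((real r - \<nu>) gchoose r))"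
    by (simp add: coeff_pade pade_coeff_def algebra_simps)
  also have "((real r + 1 - \<nu>) gchoose (Suc r)) = (real r + 1 - \<nu>) / (real r + 1) * ((real r - \<nu>) gchoose r)"
    using gbinomial_absorption'[of "Suc r" "real r + 1 - \<nu>"] by (simp add: add_ac)
  also have "((real r + 1 + \<nu>) gchoose (Suc r)) = (real r + 1 + \<nu>) / (real r + 1) * ((real r + \<nu>) gchoose r)"
    using gbinomial_absorption'[of "Suc r" "real r + 1 + \<nu>"] by (simp add: add_ac)
  finally have c0: "coeff Q (2*r+1) = ((real r + \<nu>) gchoose r) * ((real r + 1 - \<nu>) / (real r + 1) * ((real r - \<nu>) gchoose r))
       - (real r + 1 + \<nu>) / (real r + 1) * ((real r + \<nu>) gchoose r) * ((real r - \<nu>) gchoose r)" .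
  have c: "coeff Q (2*r+1) = - (2 * \<nu> / (real r + 1)) * ((real r + \<nu>) gchoose r) * ((real r - \<nu>) gchoose r)"
  proof -
    have "(real r + 1 - \<nu>) / (real r + 1) - (real r + 1 + \<nu>) / (real r + 1) = - (2 * \<nu> / (real r + 1))"
      by (simp add: diff_divide_distrib[symmetric])
    moreover have "coeff Q (2*r+1) = ((real r + 1 - \<nu>) / (real r + 1) - (real r + 1 + \<nu>) / (real r + 1))
        * ((real r + \<nu>) gchoose r) * ((real r - \<nu>) gchoose r)"
      unfolding c0 by (simp add: algebra_simps)
    ultimately show ?thesis by simp
  qed
  have nz: "(real r + x) gchoose r \<noteq> 0" if "\<bar>x\<bar> < 1" for x
  proof -
    have "real r + x - real i \<noteq> 0" if "i < r" for i
    proof -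
      have "real i + 1 \<le> real r" using that by (simp add: Suc_leI)
      thus ?thesis using \<open>\<bar>x\<bar> < 1\<close> by linarith
    qed
    thus ?thesis by (auto simp: gbinomial_prod_rev)
  qed
  have cn: "coeff Q (2*r+1) \<noteq> 0" unfolding c using nu nz[of \<nu>] nz[of "-\<nu>"] by (simp add: )
  have "coeff Q j = 0" if "j > 2*r+1" for j
  proof (rule coeff_eq_0)
    have "degree (pade \<nu> r * pade (-\<nu>) (Suc r)) \<le> 2*r+1" "degree (pade \<nu> (Suc r) * pade (-\<nu>) r) \<le> 2*r+1"
      using degree_mult_le[of "pade \<nu> r" "pade (-\<nu>) (Suc r)"] degree_mult_le[of "pade \<nu> (Suc r)" "pade (-\<nu>) r"]
        deg[of \<nu> r] deg[of "-\<nu>" "Suc r"] deg[of \<nu> "Suc r"] deg[of "-\<nu>" r] by linarith+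
    thus "degree Q < j" using that unfolding Q_def by (meson degree_diff_le le_less_trans)
  qed
  hence "Q = monom (coeff Q (2*r+1)) (2*r+1)"
    using low by (intro poly_eqI) (metis coeff_monom linorder_neqE_nat)
  hence "poly Q w = coeff Q (2*r+1) * w ^ (2*r+1)" by (metis poly_monom)
  thus ?thesis using cn w by (auto simp: Q_def)
qed

section \<open>Pairs of solutions of a Thue equation\<close>

lemma fps_power_nth_Ints_below:
  fixes Y :: "real fps"
  assumes "\<And>i. i < m \<Longrightarrow> fps_nth Y i \<in> \<int>" "i < m"
  shows "fps_nth (Y ^ j) i \<in> \<int>"
  using assms(2)
proof (induction j arbitrary: i)
  case 0
  thus ?case by (cases i) auto
next
  case (Suc j)
  show ?case unfolding power_Suc fps_mult_nth
    by (intro Ints_sum Ints_mult Suc.IH assms(1)) (use Suc.prems in auto)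
qed

text \<open>As \<open>Y\<close> has no constant term, the two extreme terms of the convolution
  vanish, and the coefficient of X^m in Y^j involves only coefficients of \<open>Y\<close> of index
  below \<open>m\<close>. This makes the recursion in \<open>root_gbinomial_Ints\<close>
  well-founded.\<close>

lemma fps_power_nth_Ints:
  fixes Y :: "real fps"
  assumes "\<And>i. i < m \<Longrightarrow> fps_nth Y i \<in> \<int>" "fps_nth Y 0 = 0" "2 \<le> j"
  shows "fps_nth (Y ^ j) m \<in> \<int>"
proof -
  obtain j' where j': "j = Suc (Suc j')" using assms(3) by (metis add_2_eq_Suc le_Suc_ex)
  have "fps_nth (Y * Y ^ Suc j') m \<in> \<int>"
    unfolding fps_mult_nth
  proof (intro Ints_sum)
    fix i assume i: "i \<in> {0..m}"
    show "fps_nth Y i * fps_nth (Y ^ Suc j') (m - i) \<in> \<int>"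
    proof (cases "i = 0 \<or> i = m")
      case True
      thus ?thesis using assms(2) by (auto simp: fps_power_zeroth)
    next
      case False
      thus ?thesis using i by (intro Ints_mult fps_power_nth_Ints_below[of m] assms(1)) auto
    qed
  qed
  thus ?thesis by (simp add: j')
qed

text \<open>The series \<open>Y\<close> below satisfies \<open>(1 + k Y)\<^sup>k = 1 + k\<^sup>2 X\<close>; dividing by \<open>k\<^sup>2\<close> gives a
  recursion for its coefficients over the integers.\<close>

lemma root_gbinomial_Ints:
  fixes k :: nat
  assumes k: "k \<ge> 1"
  shows "real k ^ (2 * m) * ((1 / real k) gchoose m) \<in> \<int>"
proof -
  define Y :: "real fps" where "Y = Abs_fps (\<lambda>m. if m = 0 then 0 else real k ^ (2*m-1) * ((1 / real k) gchoose m))"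
  define f where "f = fps_binomial (1 / real k) oo (fps_const (real k ^ 2) * fps_X)"
  have f1: "fps_nth f m = real k ^ (2 * m) * ((1 / real k) gchoose m)" for m
    by (simp add: f_def fps_compose_linear power_mult)
  have fY: "f = 1 + fps_const (real k) * Y"
  proof (rule fps_ext)
    fix m show "fps_nth f m = fps_nth (1 + fps_const (real k) * Y) m"
      using k by (cases m) (auto simp: f1 Y_def)
  qed
  have "f ^ k = (fps_binomial (1 / real k)) ^ k oo (fps_const (real k ^ 2) * fps_X)"
    unfolding f_def by (rule fps_compose_power) simp
  also have "(fps_binomial (1 / real k)) ^ k = 1 + fps_X"
    using k by (simp add: fps_binomial_power fps_binomial_1)
  finally have fk: "f ^ k = 1 + fps_const (real k ^ 2) * fps_X"
    by (simp add: fps_compose_add_distrib)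
  have Yint: "fps_nth Y m \<in> \<int>" for m
  proof (induction m rule: less_induct)
    case (less m)
    show ?case
    proof (cases "m = 0")
      case True thus ?thesis by (simp add: Y_def)
    next
      case False
      have "f ^ k = (\<Sum>j\<le>k. of_nat (k choose j) * (fps_const (real k) * Y) ^ j)"
        using binomial_ring[of "fps_const (real k) * Y" 1 k] by (simp add: fY add.commute)
      hence "fps_nth (f ^ k) m = (\<Sum>j\<le>k. real (k choose j) * real k ^ j * fps_nth (Y ^ j) m)"
        by (simp add: fps_sum_nth power_mult_distrib fps_of_nat[symmetric] mult.assoc del: fps_of_nat)
      also have "\<dots> = (\<Sum>j\<in>{0,1}. real (k choose j) * real k ^ j * fps_nth (Y ^ j) m)
          + (\<Sum>j=2..k. real (k choose j) * real k ^ j * fps_nth (Y ^ j) m)"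
      proof -
        have "{..k} = {0,1} \<union> {2..k}" using k by auto
        thus ?thesis by (simp only:) (rule sum.union_disjoint, auto)
      qed
      also have "(\<Sum>j\<in>{0,1}. real (k choose j) * real k ^ j * fps_nth (Y ^ j) m) = real k ^ 2 * fps_nth Y m"
        using False by (simp add: power2_eq_square)
      also have "(\<Sum>j=2..k. real (k choose j) * real k ^ j * fps_nth (Y ^ j) m)
          = real k ^ 2 * (\<Sum>j=2..k. real (k choose j) * real k ^ (j - 2) * fps_nth (Y ^ j) m)"
        unfolding sum_distrib_left
      proof (intro sum.cong refl)
        fix j assume "j \<in> {2..k}"
        hence "2 + (j - 2) = j" by auto
        hence "real k ^ j = real k ^ 2 * real k ^ (j - 2)" by (metis power_add)
        thus "real (k choose j) * real k ^ j * fps_nth (Y ^ j) m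
            = real k ^ 2 * (real (k choose j) * real k ^ (j - 2) * fps_nth (Y ^ j) m)" by simp
      qed
      finally have "real k ^ 2 * (fps_nth Y m + (\<Sum>j=2..k. real (k choose j) * real k ^ (j - 2) * fps_nth (Y ^ j) m))
          = real k ^ 2 * (if m = 1 then 1 else 0)"
        using False by (simp add: fk algebra_simps fps_X_def)
      hence "fps_nth Y m + (\<Sum>j=2..k. real (k choose j) * real k ^ (j - 2) * fps_nth (Y ^ j) m) = (if m = 1 then 1 else 0)"
        using k by (subst (asm) mult_cancel_left) auto
      hence eq: "fps_nth Y m = (if m = 1 then 1 else 0) - (\<Sum>j=2..k. real (k choose j) * real k ^ (j - 2) * fps_nth (Y ^ j) m)"
        by linarith
      have "(\<Sum>j=2..k. real (k choose j) * real k ^ (j - 2) * fps_nth (Y ^ j) m) \<in> \<int>"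
        by (intro Ints_sum Ints_mult Ints_power Ints_of_nat fps_power_nth_Ints less.IH) (auto simp: Y_def)
      thus ?thesis unfolding eq by (intro Ints_diff) auto
    qed
  qed
  have "fps_nth f m \<in> \<int>"
    unfolding fY using Yint[of m] by (cases m) (auto intro: Ints_mult)
  thus ?thesis by (simp add: f1)
qed

text \<open>Vandermonde's identity carries the case 1/k to c/k. The upper arguments r + 1/k and r -
  1/k of the Pade coefficients are fractions of this kind, apart from -1/k for r = 0.\<close>

lemma fraction_gbinomial_Ints:
  fixes k c :: nat
  assumes k: "k \<ge> 1"
  shows "real k ^ (2 * m) * ((real c / real k) gchoose m) \<in> \<int>"
proof (induction c arbitrary: m)
  case 0
  thus ?case by (cases m) auto
next
  case (Suc c)
  have "((real (Suc c) / real k) gchoose m) = (\<Sum>i=0..m. ((real c / real k) gchoose i) * ((1 / real k) gchoose (m - i)))"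
    using gbinomial_Vandermonde[of "real c / real k" "1 / real k" m] by (simp add: add_divide_distrib add.commute)
  hence "real k ^ (2 * m) * ((real (Suc c) / real k) gchoose m)
      = (\<Sum>i=0..m. (real k ^ (2 * i) * ((real c / real k) gchoose i)) * (real k ^ (2 * (m - i)) * ((1 / real k) gchoose (m - i))))"
    unfolding sum_distrib_left
  proof (simp only: sum_distrib_left, intro sum.cong refl)
    fix i assume "i \<in> {0..m}"
    hence "real k ^ (2 * m) = real k ^ (2 * i) * real k ^ (2 * (m - i))" by (simp flip: power_add distrib_left)
    thus "real k ^ (2 * m) * (((real c / real k) gchoose i) * ((1 / real k) gchoose (m - i)))
      = (real k ^ (2 * i) * ((real c / real k) gchoose i)) * (real k ^ (2 * (m - i)) * ((1 / real k) gchoose (m - i)))"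
      by simp
  qed
  also have "\<dots> \<in> \<int>" by (intro Ints_sum Ints_mult Suc.IH root_gbinomial_Ints[OF k])
  finally show ?case .
qed

lemma pade_coeff_Ints:
  fixes k :: nat
  assumes k: "k \<ge> 1"
  shows "real k ^ (2 * m) * pade_coeff (1 / real k) r m \<in> \<int>" "real k ^ (2 * m) * pade_coeff (- (1 / real k)) r m \<in> \<int>"
proof -
  have "real r + 1 / real k = real (r * k + 1) / real k" using k by (simp add: field_simps)
  hence "real k ^ (2 * m) * ((real r + 1 / real k) gchoose m) * real ((2 * r - m) choose r) \<in> \<int>"
    using Ints_mult[OF fraction_gbinomial_Ints[OF k, of m "r * k + 1"] Ints_of_nat] by metis
  thus "real k ^ (2 * m) * pade_coeff (1 / real k) r m \<in> \<int>" by (simp add: pade_coeff_def mult.assoc)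
  show "real k ^ (2 * m) * pade_coeff (- (1 / real k)) r m \<in> \<int>"
  \<comment> \<open>For r = 0 the number -1/k is not c/k with natural \<open>c\<close>, but then
    only the coefficient m = 0 is nonzero.\<close>
  proof (cases "m = 0 \<or> m > r")
    case True
    thus ?thesis by (auto simp: pade_coeff_def)
  next
    case False
    hence "r * k \<ge> 1" using k by simp
    hence "real r + - (1 / real k) = real (r * k - 1) / real k" using k by (simp add: field_simps of_nat_diff)
    hence "real k ^ (2 * m) * ((real r + - (1 / real k)) gchoose m) * real ((2 * r - m) choose r) \<in> \<int>"
      using Ints_mult[OF fraction_gbinomial_Ints[OF k, of m "r * k - 1"] Ints_of_nat] by metis
    thus ?thesis by (simp add: pade_coeff_def mult.assoc)
  qed
qed

section \<open>Comparing two solutions by Pade approximation\<close>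

lemma abs_powr_minus_one_le:
  fixes w \<nu> :: real
  assumes "0 < \<nu>" "\<nu> < 1" "w > -1"
  shows "\<bar>(1 + w) powr \<nu> - 1\<bar> \<le> \<bar>w\<bar>"
proof (cases "w \<ge> 0")
  case True
  have "(1 + w) powr \<nu> \<le> (1 + w) powr 1" using True assms by (intro powr_mono) auto
  moreover have "(1 + w) powr \<nu> \<ge> 1" using True assms by (intro ge_one_powr_ge_zero) auto
  ultimately show ?thesis using True by simp
next
  case False
  have "(1 + w) powr 1 \<le> (1 + w) powr \<nu>" using False assms by (intro powr_mono') auto
  moreover have "(1 + w) powr \<nu> \<le> 1" using False assms by (intro powr_le1) auto
  ultimately show ?thesis using False assms by simp
qed

text \<open>A solution \<open>(x\<^sub>0, y\<^sub>0)\<close> of \<open>b' X\<^sup>k - b Y\<^sup>k = n (b' - b)\<close> turns the Pade approximants into rational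
  approximations of the \<open>k\<close>-th root of \<open>b / b'\<close>, which are then compared with a second
  solution \<open>(x, y)\<close>.\<close>

lemma thue_pair_inequality:
  fixes k b b' a0 a x0 y0 x y :: nat and n :: int and r :: nat
  assumes k: "k \<ge> 2" and b: "0 < b" "b < b'" and n: "n \<noteq> 0"
    and pos: "0 < x0" "0 < y0" "0 < x" "0 < y"
    and eq: "int b * int a0 + n = int x0 ^ k" "int b' * int a0 + n = int y0 ^ k"
            "int b * int a + n = int x ^ k" "int b' * int a + n = int y ^ k"
    and sm: "2 * \<bar>real_of_int n\<bar> \<le> real x0 ^ k" "2 * \<bar>real_of_int n\<bar> \<le> real x ^ k"
  shows "\<exists>s\<in>{r, Suc r}. 1 \<le> (real k ^ 2 * real b' * real x0 ^ k) ^ s *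
     (2 * 16 ^ s * real y * real x0 * (\<bar>real_of_int n\<bar> / real x0 ^ k) ^ (2 * s + 1)
      + 16 ^ s * real y0 * real x * (\<bar>real_of_int n\<bar> / real x ^ k))"
proof -
  define \<nu> where "\<nu> = 1 / real k"
  have nu: "0 < \<nu>" "\<nu> < 1" using k by (auto simp: \<nu>_def)
  define N where "N = real_of_int n"
  \<comment> \<open>Eliminating \<open>a0\<close> from its two equations gives 1 + w = (b / b') (y0
    / x0)^k, hence (1 + w)^\<nu> = \<beta> y0 / x0. The number \<open>w'\<close> plays the same role
    for the second solution.\<close>
  define w where "w = - (N * (real b' - real b) / (real b' * real x0 ^ k))"
  define w' where "w' = - (N * (real b' - real b) / (real b' * real x ^ k))"
  define \<beta> where "\<beta> = (real b / real b') powr \<nu>"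
  have N0: "N \<noteq> 0" using n by (simp add: N_def)
  have w0: "w \<noteq> 0" using N0 b pos by (simp add: w_def)
  have frac: "\<bar>N * (real b' - real b) / (real b' * z)\<bar> \<le> \<bar>N\<bar> / z" if "z > 0" for z
  proof -
    have "\<bar>N * (real b' - real b) / (real b' * z)\<bar> = \<bar>N\<bar> / z * ((real b' - real b) / real b')"
      using that b by (simp add: abs_mult)
    also have "\<dots> \<le> \<bar>N\<bar> / z * 1" using that b by (intro mult_left_mono) auto
    finally show ?thesis by simp
  qed
  have wb: "\<bar>w\<bar> \<le> \<bar>N\<bar> / real x0 ^ k" "\<bar>w'\<bar> \<le> \<bar>N\<bar> / real x ^ k"
    using frac[of "real x0 ^ k"] frac[of "real x ^ k"] pos by (auto simp: w_def w'_def)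
  have half: "\<bar>N\<bar> / real x0 ^ k \<le> 1/2" "\<bar>N\<bar> / real x ^ k \<le> 1/2"
    using sm pos by (auto simp: N_def divide_simps)
  have w_half: "\<bar>w\<bar> \<le> 1/2" "\<bar>w'\<bar> \<le> 1/2"
    using order.trans[OF wb(1) half(1)] order.trans[OF wb(2) half(2)] .
  have req: "real b * real a0 + N = real x0 ^ k" "real b' * real a0 + N = real y0 ^ k"
            "real b * real a + N = real x ^ k" "real b' * real a + N = real y ^ k"
    using eq[THEN arg_cong[where f=real_of_int]] by (simp_all add: N_def)
  have one_plus: "1 - N * (real b' - real b) / (real b' * u ^ k) = (real b / real b') * (v / u) ^ k"
    if "real b * t + N = u ^ k" "real b' * t + N = v ^ k" "u > 0" for t u v
  proof -
    have "real b' * u ^ k - N * (real b' - real b) = real b * v ^ k"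
      unfolding that(1,2)[symmetric] by (simp add: algebra_simps)
    hence "(real b' * u ^ k - N * (real b' - real b)) / (real b' * u ^ k) = real b * v ^ k / (real b' * u ^ k)" by simp
    thus ?thesis using that(3) b by (simp add: diff_divide_distrib power_divide)
  qed
  have root: "((real b / real b') * (v / u) ^ k) powr \<nu> = \<beta> * (v / u)" if "u > 0" "v > 0" for u v
  proof -
    have "((real b / real b') * (v / u) ^ k) powr \<nu> = \<beta> * ((v / u) ^ k) powr \<nu>"
      using that b powr_mult[of "real b / real b'" "(v / u) ^ k" \<nu>] by (simp add: \<beta>_def)
    also have "((v / u) ^ k) powr \<nu> = v / u"
      using that k by (simp add: powr_powr \<nu>_def flip: powr_realpow)
    finally show ?thesis .
  qed
  have pw: "(1 + w) powr \<nu> * real x0 = \<beta> * real y0" "(1 + w') powr \<nu> * real x = \<beta> * real y"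
    using one_plus[OF req(1,2)] one_plus[OF req(3,4)] root[of "real x0" "real y0"] root[of "real x" "real y"] pos
    by (simp_all add: w_def w'_def)
  \<comment> \<open>With A and B for the two Pade polynomials at \<open>w\<close>, both x0 A / (y0
    B) and x / y approximate \<beta>, and \<Delta> is their difference freed of denominators. As M w
    is k^2 times an integer, \<open>pade_coeff_Ints\<close> makes M^s \<Delta> s an integer.\<close>
  define \<Delta> where "\<Delta> s = real x0 * poly (pade \<nu> s) w * real y - real y0 * poly (pade (-\<nu>) s) w * real x" for s
  define M where "M = real k ^ 2 * real b' * real x0 ^ k"
  have M0: "M > 0" using k b pos by (simp add: M_def)
  have intg: "M ^ s * poly (pade c s) w \<in> \<int>" if c: "c = \<nu> \<or> c = - \<nu>" for c s
  proof -
    have "M ^ s * poly (pade c s) w = (\<Sum>m\<le>s. M ^ (s - m) * ((real k ^ (2 * m) * pade_coeff c s m) * (- (N * (real b' - real b))) ^ m))"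
      unfolding poly_pade sum_distrib_left
    proof (intro sum.cong refl)
      fix m assume "m \<in> {..s}"
      hence "M ^ s = M ^ (s - m) * M ^ m" by (simp flip: power_add)
      moreover have "M * w = real k ^ 2 * (- (N * (real b' - real b)))"
        using b pos by (simp add: M_def w_def)
      hence "M ^ m * w ^ m = real k ^ (2 * m) * (- (N * (real b' - real b))) ^ m"
        by (metis power_mult power_mult_distrib)
      ultimately show "M ^ s * (pade_coeff c s m * w ^ m) =
          M ^ (s - m) * ((real k ^ (2 * m) * pade_coeff c s m) * (- (N * (real b' - real b))) ^ m)"
        by (metis (no_types, opaque_lifting) mult.assoc mult.commute)
    qed
    also have "\<dots> \<in> \<int>"
    proof (rule Ints_sum)
      fix m
      have h1: "real k ^ (2 * m) * pade_coeff c s m \<in> \<int>"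
        using c pade_coeff_Ints[of k m s] k by (auto simp: \<nu>_def)
      have h2: "M ^ (s - m) \<in> \<int>" and h3: "(- (N * (real b' - real b))) ^ m \<in> \<int>"
        unfolding M_def N_def by (intro Ints_power Ints_mult Ints_minus Ints_diff Ints_of_nat Ints_of_int)+
      show "M ^ (s - m) * ((real k ^ (2 * m) * pade_coeff c s m) * (- (N * (real b' - real b))) ^ m) \<in> \<int>"
        by (rule Ints_mult[OF h2 Ints_mult[OF h1 h3]])
    qed
    finally show ?thesis .
  qed
  have intD: "M ^ s * \<Delta> s \<in> \<int>" for s
  proof -
    have "M ^ s * \<Delta> s = (M ^ s * poly (pade \<nu> s) w) * (real x0 * real y) - (M ^ s * poly (pade (-\<nu>) s) w) * (real y0 * real x)"
      by (simp add: \<Delta>_def algebra_simps)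
    also have "\<dots> \<in> \<int>" by (intro Ints_diff Ints_mult intg) auto
    finally show ?thesis .
  qed
  have "\<exists>s\<in>{r, Suc r}. \<Delta> s \<noteq> 0"
  proof (rule ccontr)
    assume "\<not> ?thesis"
    hence "real x0 * real y * poly (pade \<nu> r) w = real y0 * real x * poly (pade (-\<nu>) r) w"
          "real x0 * real y * poly (pade \<nu> (Suc r)) w = real y0 * real x * poly (pade (-\<nu>) (Suc r)) w"
      by (auto simp: \<Delta>_def algebra_simps)
    hence "(real x0 * real y * poly (pade \<nu> r) w) * (real y0 * real x * poly (pade (-\<nu>) (Suc r)) w)
       = (real y0 * real x * poly (pade (-\<nu>) r) w) * (real x0 * real y * poly (pade \<nu> (Suc r)) w)" by simp
    hence "poly (pade \<nu> r) w * poly (pade (-\<nu>) (Suc r)) w = poly (pade \<nu> (Suc r)) w * poly (pade (-\<nu>) r) w"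
      using pos by (simp add: mult_ac)
    thus False using pade_nonvanishing[OF nu w0] by blast
  qed
  then obtain s where s: "s \<in> {r, Suc r}" "\<Delta> s \<noteq> 0" by blast
  define A where "A = poly (pade \<nu> s) w"
  define B where "B = poly (pade (-\<nu>) s) w"
  have "real y0 * real y * \<beta> = real y0 * ((1 + w') powr \<nu> * real x)"
    "real y0 * real y * \<beta> = real y * ((1 + w) powr \<nu> * real x0)" unfolding pw by simp_all
  \<comment> \<open>Both errors are measured against \<beta>: the first summand is the Pade error at
    the solution \<open>a0\<close>, the second contains the distance from x / y to \<beta>.\<close>
  hence Deq: "\<Delta> s = real y * real x0 * (A - (1 + w) powr \<nu> * B) + B * (real y0 * real x * ((1 + w') powr \<nu> - 1))"
  proof -
    assume e: "real y0 * real y * \<beta> = real y0 * ((1 + w') powr \<nu> * real x)"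
      "real y0 * real y * \<beta> = real y * ((1 + w) powr \<nu> * real x0)"
    have E: "real y * real x0 * (1 + w) powr \<nu> = real y0 * real x * (1 + w') powr \<nu>"
      using trans[OF e(2)[symmetric] e(1)] by (simp only: mult_ac)
    have "real y * real x0 * (A - (1 + w) powr \<nu> * B) = real x0 * A * real y - (real y * real x0 * (1 + w) powr \<nu>) * B"
      by (simp add: algebra_simps)
    also have "\<dots> = real x0 * A * real y - (real y0 * real x * (1 + w') powr \<nu>) * B" unfolding E ..
    finally show ?thesis unfolding \<Delta>_def A_def[symmetric] B_def[symmetric] by (auto simp: algebra_simps)
  qed
  have "1 \<le> \<bar>M ^ s * \<Delta> s\<bar>"
    using intD s(2) M0 by (intro Ints_nonzero_abs_ge1) auto
  also have "\<dots> = M ^ s * \<bar>\<Delta> s\<bar>" using M0 by (simp add: abs_mult)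
  also have "\<bar>\<Delta> s\<bar> \<le> real y * real x0 * \<bar>A - (1 + w) powr \<nu> * B\<bar> + \<bar>B\<bar> * (real y0 * real x * \<bar>(1 + w') powr \<nu> - 1\<bar>)"
    unfolding Deq by (rule order.trans[OF abs_triangle_ineq]) (simp add: abs_mult)
  also have "\<bar>A - (1 + w) powr \<nu> * B\<bar> \<le> 2 * 16 ^ s * (\<bar>N\<bar> / real x0 ^ k) ^ (2 * s + 1)"
  proof -
    have "\<bar>A - (1 + w) powr \<nu> * B\<bar> \<le> 2 * 16 ^ s * \<bar>w\<bar> ^ (2 * s + 1)"
      unfolding A_def B_def by (intro pade_approximation nu w_half)
    also have "\<dots> \<le> 2 * 16 ^ s * (\<bar>N\<bar> / real x0 ^ k) ^ (2 * s + 1)"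
      using wb by (intro mult_left_mono power_mono) auto
    finally show ?thesis .
  qed
  also have "\<bar>B\<bar> \<le> 16 ^ s" unfolding B_def using w_half by (intro pade_bound nu) linarith
  also have "\<bar>(1 + w') powr \<nu> - 1\<bar> \<le> \<bar>N\<bar> / real x ^ k"
    using abs_powr_minus_one_le[OF nu, of w'] wb(2) w_half(2) by linarith
  finally have "1 \<le> M ^ s * (real y * real x0 * (2 * 16 ^ s * (\<bar>N\<bar> / real x0 ^ k) ^ (2 * s + 1)) + 16 ^ s * (real y0 * real x * (\<bar>N\<bar> / real x ^ k)))"
    using M0 by (simp add: mult_left_mono add_mono mult_right_mono)
  thus ?thesis using s(1) by (intro bexI[of _ s]) (auto simp: M_def N_def mult_ac)
qed

text \<open>Here \<open>1 / \<sigma>\<close> stands for \<open>log\<^sub>P a\<^sub>0\<close> and \<open>x\<close> for the logarithm of \<open>a\<close> to base \<open>a\<^sub>0\<close>. The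
  inequalities say that both alternatives of \<open>thue_pair_log_inequality\<close> below fail for two consecutive
  indices \<open>s\<close>.\<close>

lemma pade_index_exists:
  fixes k :: nat and \<sigma> x :: real
  assumes k: "k \<ge> 3" and \<sigma>: "0 \<le> \<sigma>"
    and c3: "k = 3 \<Longrightarrow> \<sigma> \<le> 1/27 \<and> 15/2 \<le> x"
    and c4: "k = 4 \<Longrightarrow> \<sigma> \<le> 1/22 \<and> 17/2 \<le> x"
    and c5: "k \<ge> 5 \<Longrightarrow> \<sigma> \<le> 1/17 \<and> 37/10 \<le> x"
  shows "\<exists>r. \<forall>s\<in>{r, Suc r}. x < real k * (real s + 1) - 1 - real k * \<sigma> * (4 * real s + 3)
       \<and> real k * real s + 1 + real k * \<sigma> * (3 * real s + 3) < (real k - 1) * x"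
proof -
  have above: "\<exists>r::nat. q < real r \<and> real r \<le> q + 1" if "q \<ge> 0" for q :: real
    by (rule exI[of _ "nat \<lfloor>q\<rfloor> + 1"]) (use that in linarith)
  consider "k = 3" | "k = 4" | "k \<ge> 5" using k by linarith
  thus ?thesis
  proof cases
    case 1
    hence s27: "\<sigma> \<le> 1/27" and x: "15/2 \<le> x" using c3 by auto
    \<comment> \<open>The extreme cases: \<sigma> = 1/27, the upper bound on \<open>x\<close> at s =
      r, the lower bound at s = r + 1. Such intervals for consecutive \<open>r\<close> overlap from
      r = 3 on.\<close>
    have "\<exists>r::nat. x < 69/27 * real r + 45/27 \<and> 45/27 * real r + 63/27 < x"
    \<comment> \<open>Rounding loses too much for small \<open>x\<close>, where r = 3 directly
      covers 22/3 < x < 28/3.\<close>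
    proof (cases "x < 9")
      case True thus ?thesis using x by (intro exI[of _ 3]) auto
    next
      case False
      hence "(x - 5/3) * 9/23 \<ge> 0" by simp
      from above[OF this] obtain r where "(x - 5/3) * 9/23 < real r" "real r \<le> (x - 5/3) * 9/23 + 1" by blast
      thus ?thesis using False by (intro exI[of _ r]) (simp add: field_simps)
    qed
    then obtain r :: nat where r: "x < 69/27 * real r + 45/27" "45/27 * real r + 63/27 < x" by blast
    have "\<sigma> * (4 * real s + 3) \<le> 1/27 * (4 * real s + 3)" "\<sigma> * (3 * real s + 3) \<le> 1/27 * (3 * real s + 3)" for s
      using s27 by (auto intro!: mult_right_mono)
    from this[of r] this[of "Suc r"] show ?thesis using r 1 by (intro exI[of _ r]) (auto simp: algebra_simps)
  next
    case 2
    hence s22: "\<sigma> \<le> 1/22" and x: "17/2 \<le> x" using c4 by auto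
    have "(x - 27/11) * 11/36 \<ge> 0" using x by simp
    from above[OF this] obtain r where "(x - 27/11) * 11/36 < real r" "real r \<le> (x - 27/11) * 11/36 + 1" by blast
    hence r: "x < 36/11 * real r + 27/11" "50/33 * real r + 67/33 < x" using x by (simp_all add: field_simps)
    have "\<sigma> * (4 * real s + 3) \<le> 1/22 * (4 * real s + 3)" "\<sigma> * (3 * real s + 3) \<le> 1/22 * (3 * real s + 3)" for s
      using s22 by (auto intro!: mult_right_mono)
    from this[of r] this[of "Suc r"] show ?thesis using r 2 by (intro exI[of _ r]) (auto simp: algebra_simps)
  next
    case 3
    hence s17: "\<sigma> \<le> 1/17" and x: "37/10 \<le> x" using c5 by auto
    have "(x - 53/17) * 17/65 \<ge> 0" using x by simp
    from above[OF this] obtain r where "(x - 53/17) * 17/65 < real r" "real r \<le> (x - 53/17) * 17/65 + 1" by blast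
    hence r: "x < 65/17 * real r + 53/17" "25/17 * real r + 33/17 < x" using x by (simp_all add: field_simps)
    have bnd: "\<sigma> * (4 * real s + 3) \<le> 1/17 * (4 * real s + 3)" "\<sigma> * (3 * real s + 3) \<le> 1/17 * (3 * real s + 3)" for s
      using s17 by (auto intro!: mult_right_mono)
    have up: "5 * (real s + 1 - 1/17 * (4 * real s + 3)) \<le> real k * (real s + 1 - \<sigma> * (4 * real s + 3))" for s
      using 3 bnd[of s] by (intro mult_mono) (auto simp: field_simps)
    \<comment> \<open>Reduction to k = 5: with u = s + \<sigma> (3 s + 3), the left side is (k - 1)
      u + (u + 1), and u + 1 is at most (k - 1) (u + 1) / 4.\<close>
    have lo: "real k * real s + 1 + real k * \<sigma> * (3 * real s + 3)
        \<le> (real k - 1) * (5/4 * (real s + \<sigma> * (3 * real s + 3)) + 1/4)" for s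
    proof -
      define u where "u = real s + \<sigma> * (3 * real s + 3)"
      have "4 * (u + 1) \<le> (real k - 1) * (u + 1)"
        using 3 \<sigma> by (intro mult_right_mono) (auto simp: u_def)
      moreover have "real k * real s + 1 + real k * \<sigma> * (3 * real s + 3) = (real k - 1) * u + (u + 1)"
        by (simp add: u_def algebra_simps)
      ultimately have "real k * real s + 1 + real k * \<sigma> * (3 * real s + 3)
          \<le> (real k - 1) * u + (real k - 1) * (u + 1) / 4" by simp
      also have "\<dots> = (real k - 1) * (5/4 * u + 1/4)" by (simp add: field_simps)
      finally show ?thesis unfolding u_def .
    qed
    have lo': "real k * real s + 1 + real k * \<sigma> * (3 * real s + 3) < (real k - 1) * x"
      if "5/4 * (real s + 1/17 * (3 * real s + 3)) + 1/4 < x" for s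
    proof -
      have "(real k - 1) * (5/4 * (real s + \<sigma> * (3 * real s + 3)) + 1/4) < (real k - 1) * x"
      proof (rule mult_strict_left_mono)
        show "5/4 * (real s + \<sigma> * (3 * real s + 3)) + 1/4 < x" using that bnd(2)[of s] by argo
      qed (use 3 in simp)
      thus ?thesis using lo[of s] by linarith
    qed
    show ?thesis
    proof (intro exI[of _ r] ballI conjI)
      fix s assume s: "s \<in> {r, Suc r}"
      show "x < real k * (real s + 1) - 1 - real k * \<sigma> * (4 * real s + 3)"
      proof -
        have "real k * (real s + 1 - \<sigma> * (4 * real s + 3)) = real k * (real s + 1) - real k * \<sigma> * (4 * real s + 3)"
          by (simp add: algebra_simps)
        moreover have "real r \<le> real s" using s by auto
        hence "x < 5 * (real s + 1 - 1/17 * (4 * real s + 3)) - 1" using r(1) by argo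
        ultimately show ?thesis using up[of s] by linarith
      qed
      show "real k * real s + 1 + real k * \<sigma> * (3 * real s + 3) < (real k - 1) * x"
      proof (rule lo')
        have "real s \<le> real r + 1" using s by auto
        thus "5/4 * (real s + 1/17 * (3 * real s + 3)) + 1/4 < x" using r(2) by argo
      qed
    qed
  qed
qed

text \<open>One of two summands adding up to at least 1 is at least 1/2, and taking logarithms gives
  the two alternatives. The k-th powers of the four roots agree with \<open>a0\<close> or
  \<open>a\<close> up to factors between 1/2 and 2 P, and all numerical constants are absorbed into
  ln P.\<close>

lemma thue_pair_log_inequality:
  fixes k b b' a0 a x0 y0 x y :: nat and n :: int and r :: nat and P :: real
  assumes k: "k \<ge> 3" and b: "0 < b" "b < b'" and n: "n \<noteq> 0"
    and pos: "0 < x0" "0 < y0" "0 < x" "0 < y"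
    and eq: "int b * int a0 + n = int x0 ^ k" "int b' * int a0 + n = int y0 ^ k"
            "int b * int a + n = int x ^ k" "int b' * int a + n = int y ^ k"
    and P: "real b' \<le> P" "real_of_int \<bar>n\<bar> \<le> P" "128 * real k ^ 2 \<le> P"
    and big: "4 * P \<le> real a0" "4 * P \<le> real a"
  shows "\<exists>s\<in>{r, Suc r}. (real s + 1 - 1 / real k) * ln a0 \<le> (4 * real s + 3) * ln P + ln a / real k
     \<or> (1 - 1 / real k) * ln a \<le> (real s + 1 / real k) * ln a0 + (3 * real s + 3) * ln P"
proof -
  define N where "N = \<bar>real_of_int n\<bar>"
  have N1: "N \<ge> 1" "N \<le> P" using n P(2) by (auto simp: N_def)
  have P1: "P \<ge> 1" using N1 by linarith
  have a0: "real a0 > 0" "real a > 0" using big P1 by auto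
  have val: "real u \<le> 2 * P * real t \<and> real t / 2 \<le> real u \<and> 2 * N \<le> real u"
    if "int c * int t + n = int u" "c \<in> {b, b'}" "4 * P \<le> real t" for c t u
  proof -
    have u: "real u = real c * real t + real_of_int n" using that(1)[THEN arg_cong[where f=real_of_int]] by simp
    have c: "1 \<le> real c" "real c \<le> P" using that(2) b P(1) by auto
    have "real c * real t \<le> P * real t" "1 * real t \<le> real c * real t"
      by (rule mult_right_mono; use c in simp)+
    moreover have "P \<le> P * real t" using P1 that(3) by (simp add: mult_le_cancel_left1)
    moreover have "\<bar>real_of_int n\<bar> \<le> P" using P(2) by simp
    ultimately have "real c * real t + real_of_int n \<le> 2 * (P * real t)"
      "real t / 2 \<le> real c * real t + real_of_int n" "2 * N \<le> real c * real t + real_of_int n"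
      using that(3) N1 unfolding N_def by linarith+
    thus ?thesis unfolding u by simp
  qed
  have v: "real u ^ k \<le> 2 * P * real t \<and> real t / 2 \<le> real u ^ k \<and> 2 * N \<le> real u ^ k"
    if "int c * int t + n = int u ^ k" "c \<in> {b, b'}" "4 * P \<le> real t" for c t u
    using val[of c t "u ^ k"] that by simp
  have v1: "real x0 ^ k \<le> 2 * P * real a0 \<and> real a0 / 2 \<le> real x0 ^ k \<and> 2 * N \<le> real x0 ^ k"
    by (rule v[OF eq(1) _ big(1)]) simp
  have v2: "real y0 ^ k \<le> 2 * P * real a0 \<and> real a0 / 2 \<le> real y0 ^ k \<and> 2 * N \<le> real y0 ^ k"
    by (rule v[OF eq(2) _ big(1)]) simp
  have v3: "real x ^ k \<le> 2 * P * real a \<and> real a / 2 \<le> real x ^ k \<and> 2 * N \<le> real x ^ k"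
    by (rule v[OF eq(3) _ big(2)]) simp
  have v4: "real y ^ k \<le> 2 * P * real a \<and> real a / 2 \<le> real y ^ k \<and> 2 * N \<le> real y ^ k"
    by (rule v[OF eq(4) _ big(2)]) simp
  define p where "p = ln P"
  define \<alpha> where "\<alpha> = ln (real a0)"
  define \<beta> where "\<beta> = ln (real a)"
  define l2 where "l2 = ln (2::real)"
  have l2: "l2 > 0" by (simp add: l2_def)
  have kr: "real k \<ge> 3" using k by simp
  have ln_up: "real k * ln (real u) \<le> l2 + p + ln t" if "real u ^ k \<le> 2 * P * t" "u > 0" "t > 0" for u t
  proof -
    have "ln (real u ^ k) \<le> ln (2 * P * t)" using that P1 by (subst ln_le_cancel_iff) auto
    also have "ln (2 * P * t) = l2 + p + ln t" using that P1 by (simp add: ln_mult l2_def p_def)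
    finally show ?thesis using that by (simp add: ln_realpow)
  qed
  have ln_lo: "ln t - l2 \<le> real k * ln (real u)" if "t / 2 \<le> real u ^ k" "u > 0" "t > 0" for u t
  proof -
    have "ln (t / 2) \<le> ln (real u ^ k)" using that by (subst ln_le_cancel_iff) auto
    thus ?thesis using that by (simp add: ln_realpow ln_div l2_def)
  qed
  have lx0: "real k * ln x0 \<le> l2 + p + \<alpha>" "\<alpha> - l2 \<le> real k * ln x0"
    and ly0: "real k * ln y0 \<le> l2 + p + \<alpha>"
    and lx: "\<beta> - l2 \<le> real k * ln x" and ly: "real k * ln y \<le> l2 + p + \<beta>"
    using ln_up[OF conjunct1[OF v1] pos(1) a0(1)] ln_lo[OF _ pos(1) a0(1)] v1
      ln_up[OF conjunct1[OF v2] pos(2) a0(1)] ln_lo[OF _ pos(3) a0(2)] v3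
      ln_up[OF conjunct1[OF v4] pos(4) a0(2)]
    unfolding \<alpha>_def \<beta>_def by blast+
  \<comment> \<open>The origin of 128 = 2^7: for each unit of \<open>s\<close>, the factor 16 k^2
    uses four ln 2 and 2 ln k, and the other three ln 2 pay for factors 2 in the bounds for the
    powers.\<close>
  have lk: "2 * ln k + 7 * l2 \<le> p"
  proof -
    have "ln (2 ^ 7 * real k ^ 2) \<le> ln P" using P(3) kr P1 by (subst ln_le_cancel_iff) auto
    moreover have "ln (128::real) = 7 * l2" using ln_realpow[of "2::real" 7] by (simp add: l2_def)
    hence "ln (2 ^ 7 * real k ^ 2) = 2 * ln k + 7 * l2" using kr by (subst ln_mult) (auto simp: ln_realpow)
    ultimately show ?thesis by (simp add: p_def)
  qed
  have lb: "ln b' \<le> p" "ln N \<le> p" using P b N1 by (auto simp: p_def)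
  have lk0: "ln (real k) \<ge> 0" using kr by simp
  have "2 * \<bar>real_of_int n\<bar> \<le> real x0 ^ k" "2 * \<bar>real_of_int n\<bar> \<le> real x ^ k" using v1 v3 by (auto simp: N_def)
  hence "\<exists>s\<in>{r, Suc r}. 1 \<le> (real k ^ 2 * real b' * real x0 ^ k) ^ s *
     (2 * 16 ^ s * real y * real x0 * (N / real x0 ^ k) ^ (2 * s + 1)
      + 16 ^ s * real y0 * real x * (N / real x ^ k))"
    unfolding N_def using k by (intro thue_pair_inequality[OF _ b n pos eq]) auto
  then obtain s where s: "s \<in> {r, Suc r}"
   and ineq: "1 \<le> (real k ^ 2 * real b' * real x0 ^ k) ^ s *
     (2 * 16 ^ s * real y * real x0 * (N / real x0 ^ k) ^ (2 * s + 1)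
      + 16 ^ s * real y0 * real x * (N / real x ^ k))" by blast
  define T1 where "T1 = (real k ^ 2 * real b' * real x0 ^ k) ^ s * (2 * 16 ^ s * real y * real x0 * (N / real x0 ^ k) ^ (2 * s + 1))"
  define T2 where "T2 = (real k ^ 2 * real b' * real x0 ^ k) ^ s * (16 ^ s * real y0 * real x * (N / real x ^ k))"
  have Tpos: "T1 > 0" "T2 > 0" using kr b pos N1 by (auto simp: T1_def T2_def)
  have "1 \<le> T1 + T2" using ineq by (simp add: T1_def T2_def distrib_left)
  hence "1/2 \<le> T1 \<or> 1/2 \<le> T2" by linarith
  have l16: "ln (16::real) = 4 * l2"
    using ln_realpow[of "2::real" 4] by (simp add: l2_def)
  have lT1: "ln T1 = real s * (2 * ln k + ln b' + real k * ln x0) + l2 + real s * (4 * l2) + ln y + ln x0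
      + (2 * real s + 1) * (ln N - real k * ln x0)"
    unfolding T1_def using kr b pos N1
    by (simp add: ln_mult ln_div ln_realpow l16 l2_def algebra_simps)
  have lT2: "ln T2 = real s * (2 * ln k + ln b' + real k * ln x0) + real s * (4 * l2) + ln y0 + ln x
      + (ln N - real k * ln x)"
    unfolding T2_def using kr b pos N1
    by (simp add: ln_mult ln_div ln_realpow l16 l2_def algebra_simps)
  have sk: "real s * (2 * ln k + 4 * l2) \<le> real s * (p - 3 * l2)" using lk by (intro mult_left_mono) auto
  have slb: "real s * ln b' \<le> real s * p" using lb by (intro mult_left_mono) auto
  have divk: "u \<le> w / real k" if "real k * u \<le> w" for u w using that kr by (simp add: field_simps)
  have third: "w / real k \<le> w / 3" if "w \<ge> 0" for w using that kr by (intro divide_left_mono) auto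
  have k1: "1 / real k \<le> 1" "0 \<le> 1 / real k" "1 / real k = inverse (real k)" using kr by (auto simp: field_simps)
  have p0: "p \<ge> 0" "p \<ge> 7 * l2" using lk lk0 l2 by linarith+
  have sl2: "0 \<le> real s * l2" using l2 by simp
  have es: "real s * (p - 3 * l2) = real s * p - 3 * (real s * l2)" "(2 * real s + 1) * p = 2 * (real s * p) + p"
      "(real s + 1) * l2 = real s * l2 + l2" "(4 * real s + 3) * p = 4 * (real s * p) + 3 * p"
      "real s * (l2 + p) = real s * l2 + real s * p" "(3 * real s + 3) * p = 3 * (real s * p) + 3 * p"
    by (simp_all add: algebra_simps)
  have lpk: "(l2 + p) / real k \<le> (l2 + p) / 3" using third[of "l2 + p"] p0 l2 by simp
  define q where "q = (l2 + p) / real k"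
  have q: "q \<le> p" using lpk p0 l2 unfolding q_def by argo
  from \<open>1/2 \<le> T1 \<or> 1/2 \<le> T2\<close> show ?thesis
  proof
    assume "1/2 \<le> T1"
    hence "ln (1/2) \<le> ln T1" using Tpos by (subst ln_le_cancel_iff) auto
    hence "- l2 \<le> ln T1" by (simp add: ln_div l2_def)
    also have "ln T1 = real s * (2 * ln k + 4 * l2) + real s * ln b' + l2 + ln y + (2 * real s + 1) * ln N - (real s + 1 - 1 / real k) * (real k * ln x0)"
      unfolding lT1 using kr by (simp add: field_simps)
    also have "\<dots> \<le> real s * (p - 3 * l2) + real s * p + l2 + (l2 + p + \<beta>) / real k + (2 * real s + 1) * p - (real s + 1 - 1 / real k) * (\<alpha> - l2)"
    proof -
      have "(2 * real s + 1) * ln N \<le> (2 * real s + 1) * p" using lb by (intro mult_left_mono) auto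
      moreover have "(real s + 1 - 1 / real k) * (\<alpha> - l2) \<le> (real s + 1 - 1 / real k) * (real k * ln x0)"
        using lx0(2) k1 by (intro mult_left_mono) linarith+
      ultimately show ?thesis using sk slb divk[OF ly] by linarith
    qed
    finally have "(real s + 1 - 1 / real k) * \<alpha> \<le> real s * (p - 3 * l2) + real s * p + 2 * l2 + (l2 + p) / real k + \<beta> / real k + (2 * real s + 1) * p + (real s + 1 - 1 / real k) * l2"
      by (simp add: algebra_simps add_divide_distrib diff_divide_distrib)
    also have "(real s + 1 - 1 / real k) * l2 \<le> (real s + 1) * l2" using l2 by (intro mult_right_mono) auto
    also have "real s * (p - 3 * l2) + real s * p + 2 * l2 + (l2 + p) / real k + \<beta> / real k + (2 * real s + 1) * p + (real s + 1) * l2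
        \<le> (4 * real s + 3) * p + \<beta> / real k"
      unfolding es q_def[symmetric] using q p0 l2 sl2 by linarith
    finally show ?thesis using s unfolding \<alpha>_def \<beta>_def p_def by auto
  next
    assume "1/2 \<le> T2"
    hence "ln (1/2) \<le> ln T2" using Tpos by (subst ln_le_cancel_iff) auto
    hence "- l2 \<le> ln T2" by (simp add: ln_div l2_def)
    also have "ln T2 = real s * (2 * ln k + 4 * l2) + real s * ln b' + real s * (real k * ln x0) + ln y0 + ln N - (1 - 1 / real k) * (real k * ln x)"
      unfolding lT2 using kr by (simp add: field_simps)
    also have "\<dots> \<le> real s * (p - 3 * l2) + real s * p + real s * (l2 + p + \<alpha>) + (l2 + p + \<alpha>) / real k + p - (1 - 1 / real k) * (\<beta> - l2)"
    proof -
      have "real s * (real k * ln x0) \<le> real s * (l2 + p + \<alpha>)" using lx0 by (intro mult_left_mono) auto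
      moreover have "(1 - 1 / real k) * (\<beta> - l2) \<le> (1 - 1 / real k) * (real k * ln x)"
        using lx k1 by (intro mult_left_mono) linarith+
      ultimately show ?thesis using sk slb divk[OF ly0] lb by linarith
    qed
    finally have "(1 - 1 / real k) * \<beta> \<le> real s * (p - 3 * l2) + real s * p + real s * (l2 + p) + (real s + 1 / real k) * \<alpha> + (l2 + p) / real k + p + l2 + (1 - 1 / real k) * l2"
      by (simp add: algebra_simps add_divide_distrib diff_divide_distrib)
    also have "(1 - 1 / real k) * l2 \<le> 1 * l2" using l2 by (intro mult_right_mono) auto
    also have "real s * (p - 3 * l2) + real s * p + real s * (l2 + p) + (real s + 1 / real k) * \<alpha> + (l2 + p) / real k + p + l2 + 1 * l2
       \<le> (real s + 1 / real k) * \<alpha> + (3 * real s + 3) * p"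
      unfolding es q_def[symmetric] using q p0 l2 sl2 by linarith
    finally show ?thesis using s unfolding \<alpha>_def \<beta>_def p_def by auto
  qed
qed

text \<open>Division by ln a0 turns the alternatives of \<open>thue_pair_log_inequality\<close> into
  negations of the inequalities of \<open>pade_index_exists\<close>, with \<sigma> = ln P / ln a0
  and x = ln a / ln a0.\<close>

lemma thue_pair_exclusion:
  fixes k b b' a0 a x0 y0 x y :: nat and n :: int and P :: real
  assumes k: "k \<ge> 3" and b: "0 < b" "b < b'" and n: "n \<noteq> 0"
    and pos: "0 < x0" "0 < y0" "0 < x" "0 < y"
    and eq: "int b * int a0 + n = int x0 ^ k" "int b' * int a0 + n = int y0 ^ k"
            "int b * int a + n = int x ^ k" "int b' * int a + n = int y ^ k"
    and P: "real b' \<le> P" "real_of_int \<bar>n\<bar> \<le> P" "128 * real k ^ 2 \<le> P"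
    and c3: "k = 3 \<Longrightarrow> 27 * ln P \<le> ln a0 \<and> 15/2 * ln a0 \<le> ln a"
    and c4: "k = 4 \<Longrightarrow> 22 * ln P \<le> ln a0 \<and> 17/2 * ln a0 \<le> ln a"
    and c5: "k \<ge> 5 \<Longrightarrow> 17 * ln P \<le> ln a0 \<and> 37/10 * ln a0 \<le> ln a"
  shows False
proof -
  have kr: "real k \<ge> 3" using k by simp
  have "128 * 3 ^ 2 \<le> 128 * real k ^ 2" using kr by (intro mult_left_mono power_mono) auto
  hence P1: "P \<ge> 1152" using P(3) by simp
  define p where "p = ln P"
  define \<alpha> where "\<alpha> = ln (real a0)"
  define \<beta> where "\<beta> = ln (real a)"
  have p: "p > 0" using P1 by (simp add: p_def)
  consider "k = 3" | "k = 4" | "k \<ge> 5" using k by linarith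
  hence "\<exists>c d. 17 \<le> c \<and> 1 \<le> d \<and> c * p \<le> \<alpha> \<and> d * \<alpha> \<le> \<beta>"
  proof cases
    case 1 show ?thesis by (rule exI[of _ 27], rule exI[of _ "15/2"]) (use c3[OF 1] in \<open>simp add: p_def \<alpha>_def \<beta>_def\<close>)
  next
    case 2 show ?thesis by (rule exI[of _ 22], rule exI[of _ "17/2"]) (use c4[OF 2] in \<open>simp add: p_def \<alpha>_def \<beta>_def\<close>)
  next
    case 3 show ?thesis by (rule exI[of _ 17], rule exI[of _ "37/10"]) (use c5[OF 3] in \<open>simp add: p_def \<alpha>_def \<beta>_def\<close>)
  qed
  then obtain c d where cd: "17 \<le> c" "1 \<le> d" "c * p \<le> \<alpha>" "d * \<alpha> \<le> \<beta>" by blast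
  have "17 * p \<le> c * p" using cd p by (intro mult_right_mono) auto
  hence ab1: "17 * p \<le> \<alpha>" using cd by linarith
  hence "1 * \<alpha> \<le> d * \<alpha>" using cd p by (intro mult_right_mono) auto
  hence ab: "17 * p \<le> \<alpha>" "\<alpha> \<le> \<beta>" using ab1 cd by linarith+
  have a0: "\<alpha> > 0" using ab p by linarith
  have ge: "4 * P \<le> real t" if "2 * p \<le> ln (real t)" for t
  proof -
    have t: "real t > 0" using that p by (cases "t = 0") auto
    have "4 * P \<le> P * P" using P1 by (intro mult_right_mono) auto
    also have "\<dots> = exp p * exp p" using P1 by (simp add: p_def)
    also have "\<dots> = exp (2 * p)" by (simp only: exp_add[symmetric] mult_2)
    also have "\<dots> \<le> exp (ln (real t))" using that by simp
    finally show ?thesis using t by simp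
  qed
  have big: "4 * P \<le> real a0" "4 * P \<le> real a"
    using ge[of a0] ge[of a] ab p by (auto simp: \<alpha>_def \<beta>_def)
  define \<sigma> where "\<sigma> = p / \<alpha>"
  define z where "z = \<beta> / \<alpha>"
  have zs: "p = \<sigma> * \<alpha>" "\<beta> = z * \<alpha>" using a0 by (auto simp: \<sigma>_def z_def)
  have "\<exists>r. \<forall>s\<in>{r, Suc r}. z < real k * (real s + 1) - 1 - real k * \<sigma> * (4 * real s + 3)
       \<and> real k * real s + 1 + real k * \<sigma> * (3 * real s + 3) < (real k - 1) * z"
  proof (rule pade_index_exists[OF k])
    show "0 \<le> \<sigma>" using p a0 by (simp add: \<sigma>_def)
    have *: "\<sigma> \<le> 1 / c' \<and> d' \<le> z" if "c' * p \<le> \<alpha> \<and> d' * \<alpha> \<le> \<beta>" "c' > 0" for c' d'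
      using that a0 by (auto simp: \<sigma>_def z_def field_simps)
    show "\<sigma> \<le> 1/27 \<and> 15/2 \<le> z" if "k = 3"
      by (rule *) (use c3[OF that] in \<open>simp_all add: p_def \<alpha>_def \<beta>_def\<close>)
    show "\<sigma> \<le> 1/22 \<and> 17/2 \<le> z" if "k = 4"
      by (rule *) (use c4[OF that] in \<open>simp_all add: p_def \<alpha>_def \<beta>_def\<close>)
    show "\<sigma> \<le> 1/17 \<and> 37/10 \<le> z" if "k \<ge> 5"
      by (rule *) (use c5[OF that] in \<open>simp_all add: p_def \<alpha>_def \<beta>_def\<close>)
  qed
  then obtain r where r: "\<And>s. s \<in> {r, Suc r} \<Longrightarrow> z < real k * (real s + 1) - 1 - real k * \<sigma> * (4 * real s + 3)"
     "\<And>s. s \<in> {r, Suc r} \<Longrightarrow> real k * real s + 1 + real k * \<sigma> * (3 * real s + 3) < (real k - 1) * z" by blast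
  from thue_pair_log_inequality[OF k b n pos eq P big, of r] obtain s where s: "s \<in> {r, Suc r}"
    "(real s + 1 - 1 / real k) * \<alpha> \<le> (4 * real s + 3) * p + \<beta> / real k
     \<or> (1 - 1 / real k) * \<beta> \<le> (real s + 1 / real k) * \<alpha> + (3 * real s + 3) * p"
    unfolding p_def \<alpha>_def \<beta>_def by blast
  from s(2) show False
  proof
    assume "(real s + 1 - 1 / real k) * \<alpha> \<le> (4 * real s + 3) * p + \<beta> / real k"
    hence "(real s + 1 - 1 / real k) * \<alpha> \<le> ((4 * real s + 3) * \<sigma> + z / real k) * \<alpha>"
      unfolding zs by (simp add: algebra_simps)
    hence "real s + 1 - 1 / real k \<le> (4 * real s + 3) * \<sigma> + z / real k" using a0 by simp
    hence "real k * (real s + 1 - 1 / real k) \<le> real k * ((4 * real s + 3) * \<sigma> + z / real k)" using kr by (intro mult_left_mono) auto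
    thus False using r(1)[OF s(1)] kr by (simp add: algebra_simps)
  next
    assume "(1 - 1 / real k) * \<beta> \<le> (real s + 1 / real k) * \<alpha> + (3 * real s + 3) * p"
    hence "((1 - 1 / real k) * z) * \<alpha> \<le> ((real s + 1 / real k) + (3 * real s + 3) * \<sigma>) * \<alpha>"
      unfolding zs by (simp add: algebra_simps)
    hence "(1 - 1 / real k) * z \<le> (real s + 1 / real k) + (3 * real s + 3) * \<sigma>" using a0 by simp
    hence "real k * ((1 - 1 / real k) * z) \<le> real k * ((real s + 1 / real k) + (3 * real s + 3) * \<sigma>)" using kr by (intro mult_left_mono) auto
    thus False using r(2)[OF s(1)] kr by (simp add: algebra_simps)
  qed
qed

section \<open>The gap principle and large elements\<close>

lemma has_at_least_enumeration:
  fixes S :: "'a::linorder set"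
  assumes "has_at_least m S"
  shows "\<exists>f. (\<forall>i<m. f i \<in> S) \<and> (\<forall>i j. i < j \<longrightarrow> j < m \<longrightarrow> f i < f j)"
proof -
  obtain T where T: "T \<subseteq> S" "finite T" "card T = m"
    using assms unfolding has_at_least_def
    by (metis infinite_arbitrarily_large obtain_subset_with_card_n)
  let ?l = "sorted_list_of_set T"
  have len: "length ?l = m" using T by simp
  have "sorted_wrt (<) ?l" by (rule strict_sorted_list_of_set)
  hence "?l ! i < ?l ! j" if "i < j" "j < m" for i j
    using that len sorted_wrt_nth_less by blast
  moreover have "?l ! i \<in> S" if "i < m" for i
    using that len T nth_mem[of i ?l] by auto
  ultimately show ?thesis by (intro exI[of _ "\<lambda>i. ?l ! i"]) auto
qed

lemma has_at_leastI:
  assumes "\<And>i. i < m \<Longrightarrow> f i \<in> S" "inj_on f {..<m}"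
  shows "has_at_least m S"
proof (cases "finite S")
  case True
  have "card (f ` {..<m}) = m" using assms by (simp add: card_image)
  moreover have "f ` {..<m} \<subseteq> S" using assms by auto
  ultimately show ?thesis using True card_mono by (metis has_at_least_def)
qed (simp add: has_at_least_def)

lemma four_power_le_self_power:
  assumes "k \<ge> (3::nat)"
  shows "(4::real) ^ (k - 1) \<le> real k ^ k"
proof (cases "k = 3")
  case False
  hence "real k \<ge> 4" using assms by simp
  hence "(4::real) ^ k \<le> real k ^ k" by (intro power_mono) auto
  moreover have "(4::real) ^ (k - 1) \<le> 4 ^ k" by (intro power_increasing) auto
  ultimately show ?thesis by linarith
qed simp

lemma power_diff_lower_bound:
  fixes m M :: real
  assumes "0 \<le> m" "m + 1 \<le> M" "k \<ge> 1"
  shows "real k * m ^ (k - 1) \<le> M ^ k - m ^ k"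
proof -
  have "M ^ k - m ^ k = (M - m) * (\<Sum>i<k. m ^ (k - Suc i) * M ^ i)"
    by (rule power_diff_sumr2)
  also have "\<dots> \<ge> 1 * (\<Sum>i<k. m ^ (k - 1))"
  proof (rule mult_mono)
    show "(\<Sum>i<k. m ^ (k - 1)) \<le> (\<Sum>i<k. m ^ (k - Suc i) * M ^ i)"
    proof (rule sum_mono)
      fix i assume "i \<in> {..<k}"
      hence "m ^ (k - 1) = m ^ (k - Suc i) * m ^ i" by (simp flip: power_add)
      also have "\<dots> \<le> m ^ (k - Suc i) * M ^ i" using assms by (intro mult_left_mono power_mono) auto
      finally show "m ^ (k - 1) \<le> m ^ (k - Suc i) * M ^ i" .
    qed
  qed (use assms in auto)
  finally show ?thesis by simp
qed

text \<open>If the four values are x^k, y^k, z^k, w^k, then (x y)^k and (z w)^k differ by n (a' - a)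
  (b' - b), which is nonzero and at most |n| a' b' in size. Powers of distinct integers m < M are at
  least k m^(k-1) apart, and here m^k is at least a b a' b' / 4; comparing gives the claim, with k^k
  absorbing the power of 4.\<close>

lemma gap_principle:
  fixes k a a' b b' :: nat and n :: int
  assumes k: "k \<ge> 3" and n: "2 ^ (k - 1) \<le> \<bar>n\<bar>"
    and a: "0 < a" "a < a'" and b: "0 < b" "b < b'"
    and pp: "perfect_power k (int a * int b + n)" "perfect_power k (int a' * int b' + n)"
            "perfect_power k (int a * int b' + n)" "perfect_power k (int a' * int b + n)"
  shows "(real a * real b) ^ (k - 1) \<le> real_of_int \<bar>n\<bar> ^ k * (real a' * real b')"
proof -
  define N where "N = real_of_int \<bar>n\<bar>"
  have "real_of_int (2 ^ (k - 1)) \<le> N" unfolding N_def using n by (simp only: of_int_le_iff)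
  hence N2: "2 ^ (k - 1) \<le> N" by simp
  have Npos: "N > 0" by (rule less_le_trans[OF _ N2]) simp
  define s where "s = real a * real b"
  define t where "t = real a' * real b'"
  have s0: "s > 0" "t \<ge> 1" using a b by (auto simp: s_def t_def intro!: mult_ge1_I)
  have st: "s \<le> t" using a b by (auto simp: s_def t_def intro!: mult_mono)
  show ?thesis
  \<comment> \<open>For small \<open>s\<close> the lower bound on |n| suffices. Otherwise |n| <= s /
    2, so adding \<open>n\<close> to any of the four products, all at least \<open>s\<close>, leaves
    at least half of it.\<close>
  proof (cases "s < 2 * N")
    case True
    have "s ^ (k - 1) \<le> (2 * N) ^ (k - 1)" using True s0 by (intro power_mono) auto
    also have "\<dots> = 2 ^ (k - 1) * N ^ (k - 1)" by (rule power_mult_distrib)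
    also have "\<dots> \<le> N * N ^ (k - 1)" using N2 Npos by (intro mult_right_mono) auto
    also have "\<dots> = N ^ k * 1" using k by (simp flip: power_Suc)
    also have "\<dots> \<le> N ^ k * t" using s0 Npos by (intro mult_left_mono) auto
    finally show ?thesis by (simp add: s_def t_def N_def)
  next
    case False
    obtain x y z w :: nat where xyzw: "int a * int b + n = int x ^ k" "int a' * int b' + n = int y ^ k"
      "int a * int b' + n = int z ^ k" "int a' * int b + n = int w ^ k"
      using pp unfolding perfect_power_def by auto
    note r = xyzw[THEN arg_cong[where f = real_of_int], simplified]
    define u where "u = x * y"
    define v where "v = z * w"
    have diff: "real u ^ k - real v ^ k = real_of_int n * (real a' - real a) * (real b' - real b)"
      unfolding u_def v_def of_nat_mult power_mult_distrib r[symmetric] by (simp add: algebra_simps)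
    have absd: "\<bar>real u ^ k - real v ^ k\<bar> \<le> N * t"
    proof -
      have "\<bar>real u ^ k - real v ^ k\<bar> = N * ((real a' - real a) * (real b' - real b))"
        unfolding diff using a b by (simp add: abs_mult N_def)
      also have "\<dots> \<le> N * (real a' * real b')"
        using a b Npos by (intro mult_left_mono mult_mono) auto
      finally show ?thesis by (simp add: t_def)
    qed
    have "u \<noteq> v" using diff a b Npos by (auto simp: N_def)
    define m where "m = min u v"
    define M where "M = max u v"
    have mM: "real m + 1 \<le> real M" using \<open>u \<noteq> v\<close> by (auto simp: m_def M_def)
    have "real M ^ k - real m ^ k = \<bar>real u ^ k - real v ^ k\<bar>"
      by (cases "u \<le> v") (auto simp: m_def M_def power_mono max_def min_def)
    with power_diff_lower_bound[of "real m" "real M" k] mM absd k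
    have km: "real k * real m ^ (k - 1) \<le> N * t" by simp
    have half: "c / 2 \<le> c + real_of_int n" if "c \<ge> s" for c using that False by (auto simp: N_def)
    have ord: "real a * real b' \<ge> s" "real a' * real b \<ge> s"
      using a b by (auto simp: s_def intro!: mult_left_mono mult_right_mono)
    have "(s / 2) * (t / 2) \<le> real u ^ k"
      unfolding u_def of_nat_mult power_mult_distrib r[symmetric]
      using half[of s] half[of t] st s0 by (intro mult_mono) (auto simp: s_def t_def)
    moreover have "(real a * real b' / 2) * (real a' * real b / 2) \<le> real v ^ k"
      unfolding v_def of_nat_mult power_mult_distrib r[symmetric]
      using half[OF ord(1)] half[OF ord(2)] ord s0 by (intro mult_mono) auto
    ultimately have "s * t / 4 \<le> real m ^ k"
      by (auto simp: m_def min_def s_def t_def mult_ac)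
    hence "(s * t / 4) ^ (k - 1) \<le> (real m ^ k) ^ (k - 1)" using s0 by (intro power_mono) auto
    hence "real k ^ k * (s * t / 4) ^ (k - 1) \<le> real k ^ k * (real m ^ (k - 1)) ^ k"
      by (intro mult_left_mono) (auto simp: mult.commute simp flip: power_mult)
    also have "\<dots> = (real k * real m ^ (k - 1)) ^ k" by (simp add: power_mult_distrib)
    also have "\<dots> \<le> (N * t) ^ k" using km by (intro power_mono) auto
    finally have "real k ^ k / 4 ^ (k - 1) * (s * t) ^ (k - 1) \<le> (N * t) ^ k" by (simp add: power_divide)
    moreover have "1 * (s * t) ^ (k - 1) \<le> real k ^ k / 4 ^ (k - 1) * (s * t) ^ (k - 1)"
      using four_power_le_self_power[OF k] s0 by (intro mult_right_mono) auto
    ultimately have "s ^ (k - 1) * t ^ (k - 1) \<le> N ^ k * t ^ k" by (simp add: power_mult_distrib)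
    also have "t ^ k = t * t ^ (k - 1)" using k by (simp flip: power_Suc)
    finally have "s ^ (k - 1) \<le> N ^ k * t" using s0 by (simp flip: mult.assoc)
    thus ?thesis by (simp add: s_def t_def N_def)
  qed
qed

text \<open>The bracket depends on \<open>b\<close>, \<open>b'\<close> and \<open>n\<close> only:
  for a fixed pair in \<open>B\<close> this is a linear recursion, with ratio k - 1, for the
  logarithms of successive elements of \<open>A\<close>.\<close>

lemma gap_principle_ln:
  fixes k a a' b b' :: nat and n :: int
  assumes k: "k \<ge> 3" and n: "2 ^ (k - 1) \<le> \<bar>n\<bar>"
    and a: "0 < a" "a < a'" and b: "0 < b" "b < b'"
    and pp: "perfect_power k (int a * int b + n)" "perfect_power k (int a' * int b' + n)"
            "perfect_power k (int a * int b' + n)" "perfect_power k (int a' * int b + n)"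
  shows "(real k - 1) * ln a + ((real k - 1) * ln b - ln b' - real k * ln (real_of_int \<bar>n\<bar>)) \<le> ln a'"
proof -
  have "0 < (2::int) ^ (k - 1)" by simp
  hence n0: "n \<noteq> 0" using n by auto
  have "ln ((real a * real b) ^ (k - 1)) \<le> ln (real_of_int \<bar>n\<bar> ^ k * (real a' * real b'))"
    using gap_principle[OF assms] a b n0 by (subst ln_le_cancel_iff) auto
  hence "real (k - 1) * (ln a + ln b) \<le> real k * ln (real_of_int \<bar>n\<bar>) + (ln a' + ln b')"
    using a b n0 by (simp add: ln_realpow ln_mult)
  moreover have "real (k - 1) = real k - 1" using k by simp
  ultimately show ?thesis by (simp add: algebra_simps)
qed

text \<open>Symmetric in \<open>A\<close> and \<open>B\<close>, so that statements about elements of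
  one set can be applied with the roles exchanged, as \<open>few_large_elements\<close>
  does.\<close>

definition compatible :: "nat \<Rightarrow> int \<Rightarrow> nat set \<Rightarrow> nat set \<Rightarrow> bool" where
  "compatible k n A B \<longleftrightarrow> (\<forall>a\<in>A. 0 < a) \<and> (\<forall>b\<in>B. 0 < b) \<and>
     (\<forall>a\<in>A. \<forall>b\<in>B. perfect_power k (int a * int b + n))"

lemma compatible_sym: "compatible k n A B \<Longrightarrow> compatible k n B A"
  unfolding compatible_def by (metis mult.commute)

lemma compatible_exclusion:
  fixes P :: real
  assumes k: "k \<ge> 3" and n: "n \<noteq> 0" and AB: "compatible k n A B"
    and b: "b \<in> B" "b' \<in> B" "b < b'" and a: "a0 \<in> A" "a \<in> A"
    and P: "real b' \<le> P" "real_of_int \<bar>n\<bar> \<le> P" "128 * real k ^ 2 \<le> P"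
    and c3: "k = 3 \<Longrightarrow> 27 * ln P \<le> ln a0 \<and> 15/2 * ln a0 \<le> ln a"
    and c4: "k = 4 \<Longrightarrow> 22 * ln P \<le> ln a0 \<and> 17/2 * ln a0 \<le> ln a"
    and c5: "k \<ge> 5 \<Longrightarrow> 17 * ln P \<le> ln a0 \<and> 37/10 * ln a0 \<le> ln a"
  shows False
proof -
  have pp: "\<And>a b. a \<in> A \<Longrightarrow> b \<in> B \<Longrightarrow> \<exists>x. 0 < x \<and> int b * int a + n = int x ^ k"
    using AB by (auto simp: compatible_def perfect_power_def mult.commute)
  obtain x0 y0 x y where "0 < x0" "int b * int a0 + n = int x0 ^ k" "0 < y0" "int b' * int a0 + n = int y0 ^ k"
     "0 < x" "int b * int a + n = int x ^ k" "0 < y" "int b' * int a + n = int y ^ k"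
    using pp[OF a(1) b(1)] pp[OF a(1) b(2)] pp[OF a(2) b(1)] pp[OF a(2) b(2)] by blast
  moreover have "0 < b" using AB b by (auto simp: compatible_def)
  ultimately show False using thue_pair_exclusion[OF k _ b(3) n _ _ _ _ _ _ _ _ P c3 c4 c5] by blast
qed

lemma compatible_gap:
  assumes k: "k \<ge> 3" and n: "2 ^ (k - 1) \<le> \<bar>n\<bar>" and AB: "compatible k n A B"
    and b: "b \<in> B" "b' \<in> B" "b < b'" and a: "a \<in> A" "a' \<in> A" "a < a'"
  shows "(real k - 1) * ln a + ((real k - 1) * ln b - ln b' - real k * ln (real_of_int \<bar>n\<bar>)) \<le> ln a'"
  using AB a b by (intro gap_principle_ln[OF k n]) (auto simp: compatible_def)

text \<open>\<open>exceptional k\<close> is the least \<open>c\<close> for which \<open>c\<close> applications of the gap principle make the ratio of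
  logarithms exceed the threshold of \<open>pade_index_exists\<close>. The values of \<open>height_const\<close> for \<open>k \<le> 5\<close> are
  \<open>16 \<cdot> 3\<^sup>3\<close>, \<open>11 \<cdot> 4\<^sup>2\<close> and \<open>4 \<cdot> 5\<^sup>2\<close>, where \<open>16 \<le> t\<^sub>3\<close>, \<open>11 \<le> t\<^sub>4\<close> and \<open>4 \<le> t\<^sub>5\<close>.\<close>

definition exceptional :: "nat \<Rightarrow> nat" where
  "exceptional k = (if k = 3 then 3 else if k = 4 then 2 else 1)"

definition height_const :: "nat \<Rightarrow> nat" where
  "height_const k = (if k = 3 then 432 else if k = 4 then 176 else if k = 5 then 100 else k)"

text \<open>Each gap step multiplies the logarithm by k - 1 and loses at most (k + 1) ln P. From 60
  k ln P on, this loss is so small that \<open>exceptional k\<close> steps reach the ratio forbidden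
  by \<open>compatible_exclusion\<close>. The indices run from 0 to \<open>exceptional k\<close>
  inclusive, so at most \<open>exceptional k\<close> elements can be this large.\<close>

lemma few_huge_elements:
  fixes P :: real
  assumes k: "k \<ge> 3" and n: "2 ^ (k - 1) \<le> \<bar>n\<bar>" and AB: "compatible k n A B"
    and b: "b \<in> B" "b' \<in> B" "b < b'"
    and P: "real b' \<le> P" "real_of_int \<bar>n\<bar> \<le> P" "128 * real k ^ 2 \<le> P"
    and f: "\<And>i. i \<le> exceptional k \<Longrightarrow> f i \<in> A" "\<And>i j. i < j \<Longrightarrow> j \<le> exceptional k \<Longrightarrow> f i < f j"
  shows "ln (f 0) < 60 * real k * ln P"
proof (rule ccontr)
  assume neg: "\<not> ?thesis"
  have "0 < (2::int) ^ (k - 1)" by simp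
  hence n0: "n \<noteq> 0" using n by auto
  define p where "p = ln P"
  define l where "l i = ln (real (f i))" for i
  have kr: "real k \<ge> 3" using k by simp
  have "128 * 3 ^ 2 \<le> 128 * real k ^ 2" using kr by (intro mult_left_mono power_mono) auto
  hence "P > 1" using P(3) by simp
  hence p: "p > 0" by (simp add: p_def)
  have bpos: "0 < b" using AB b by (auto simp: compatible_def)
  have "ln b' \<le> p" "ln (real_of_int \<bar>n\<bar>) \<le> p" "0 \<le> ln (real b)"
    using P b bpos n0 by (auto simp: p_def)
  hence "(real k - 1) * ln b - ln b' - real k * ln (real_of_int \<bar>n\<bar>) \<ge> 0 - p - real k * p"
    using kr by (intro diff_mono mult_left_mono mult_nonneg_nonneg) auto
  hence V: "(real k - 1) * ln b - ln b' - real k * ln (real_of_int \<bar>n\<bar>) \<ge> - ((real k + 1) * p)"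
    by (simp add: algebra_simps)
  have step: "(real k - 1) * l i - (real k + 1) * p \<le> l (Suc i)" if "Suc i \<le> exceptional k" for i
  proof -
    have "(real k - 1) * l i + ((real k - 1) * ln b - ln b' - real k * ln (real_of_int \<bar>n\<bar>)) \<le> l (Suc i)"
      unfolding l_def using that by (intro compatible_gap[OF k n AB b] f) auto
    thus ?thesis using V by linarith
  qed
  have l0: "60 * (real k * p) \<le> l 0" using neg by (simp add: l_def p_def mult.assoc)
  show False
  proof (rule compatible_exclusion[OF k n0 AB b f(1)[of 0] f(1)[of "exceptional k"] P])
    assume k3: "k = 3"
    show "27 * ln P \<le> ln (f 0) \<and> 15/2 * ln (f 0) \<le> ln (f (exceptional k))"
      using step[of 0] step[of 1] step[of 2] l0 p k3
      by (simp add: exceptional_def l_def[symmetric] p_def[symmetric] numeral_2_eq_2 numeral_3_eq_3)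
  next
    assume k4: "k = 4"
    show "22 * ln P \<le> ln (f 0) \<and> 17/2 * ln (f 0) \<le> ln (f (exceptional k))"
      using step[of 0] step[of 1] l0 p k4
      by (simp add: exceptional_def l_def[symmetric] p_def[symmetric] numeral_2_eq_2)
  next
    assume k5: "k \<ge> 5"
    hence ex: "exceptional k = 1" by (simp add: exceptional_def)
    have kp: "5 * p \<le> real k * p" using k5 p by (intro mult_right_mono) auto
    have lpos: "l 0 \<ge> 0" using l0 kp p by linarith
    have "(37/10 + 3/10) * l 0 \<le> (real k - 1) * l 0" using k5 lpos by (intro mult_right_mono) auto
    moreover have "(real k + 1) * p = real k * p + p" by (simp add: algebra_simps)
    hence "(real k + 1) * p \<le> 3/10 * l 0" using l0 kp p by linarith
    ultimately have "37/10 * l 0 \<le> l 1" using step[of 0] ex by (simp add: algebra_simps)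
    moreover have "17 * p \<le> l 0" using l0 kp p by linarith
    ultimately show "17 * ln P \<le> ln (f 0) \<and> 37/10 * ln (f 0) \<le> ln (f (exceptional k))"
      by (simp add: ex l_def p_def)
  qed auto
qed

text \<open>If \<open>b\<close> and \<open>b'\<close> were close, then the gap principle would force the elements of \<open>A\<close> to grow
  doubly exponentially from the start, so that already \<open>r_const k\<close> of them would contradict
  \<open>compatible_exclusion\<close>.\<close>

lemma no_close_pairs:
  assumes k: "k \<ge> 3" and n: "2 ^ (k - 1) \<le> \<bar>n\<bar>" "128 * real k ^ 2 \<le> real_of_int \<bar>n\<bar>"
    and AB: "compatible k n A B" and A: "has_at_least (r_const k) A"
    and b: "b \<in> B" "b' \<in> B" "b < b'"
    and big: "real (height_const k) * ln (real_of_int \<bar>n\<bar>) \<le> ln b"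
  shows "(1 + 1 / (10 * real k)) * ln b < ln b'"
proof (rule ccontr)
  assume neg: "\<not> ?thesis"
  obtain f where f: "\<And>i. i < r_const k \<Longrightarrow> f i \<in> A" "\<And>i j. i < j \<Longrightarrow> j < r_const k \<Longrightarrow> f i < f j"
    using has_at_least_enumeration[OF A] by blast
  have "0 < (2::int) ^ (k - 1)" by simp
  hence n0: "n \<noteq> 0" using n by auto
  have kr: "real k \<ge> 3" using k by simp
  define q where "q = ln (real b)"
  define p where "p = ln (real b')"
  define \<eta> where "\<eta> = ln (real_of_int \<bar>n\<bar>)"
  define l where "l i = ln (real (f i))" for i
  have bpos: "0 < b" using AB b by (auto simp: compatible_def)
  have "128 * 3 ^ 2 \<le> 128 * real k ^ 2" using kr by (intro mult_left_mono power_mono) auto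
  hence "128 * 3 ^ 2 \<le> real_of_int \<bar>n\<bar>" using n(2) by linarith
  hence "real_of_int \<bar>n\<bar> > 1" by simp
  hence \<eta>: "\<eta> > 0" by (simp add: \<eta>_def)
  have H: "height_const k \<ge> 1" using k by (simp add: height_const_def)
  have "1 * \<eta> \<le> real (height_const k) * \<eta>" using H \<eta> by (intro mult_right_mono) auto
  hence \<eta>q: "real (height_const k) * \<eta> \<le> q" "\<eta> \<le> q" using big by (auto simp: q_def \<eta>_def)
  have qp: "q < p" using b bpos by (simp add: q_def p_def)
  have pq: "p \<le> (1 + 1 / (10 * real k)) * q" using neg by (simp add: p_def q_def)
  have p0: "p > 0" using \<eta> \<eta>q qp by linarith
  have q_lower: "(real k - 1 - 1/10) * p \<le> (real k - 1) * q"
  proof -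
    have "p \<le> q + 1 / (10 * real k) * q" using pq by (simp add: distrib_right)
    also have "1 / (10 * real k) * q \<le> 1 / (10 * real k) * p" using qp kr by (intro mult_left_mono) auto
    finally have "(real k - 1) * p \<le> (real k - 1) * (q + 1 / (10 * real k) * p)" using kr by (intro mult_left_mono) auto
    also have "\<dots> = (real k - 1) * q + (real k - 1) / (10 * real k) * p" by (simp add: distrib_left)
    also have "(real k - 1) / (10 * real k) * p \<le> 1 / 10 * p" using kr p0 by (intro mult_right_mono) (auto simp: field_simps)
    finally show ?thesis by (simp add: algebra_simps)
  qed
  have ln_n: "real k * \<eta> \<le> real k / real (height_const k) * p"
  proof -
    have "\<eta> \<le> p / real (height_const k)" using \<eta>q qp H by (simp add: field_simps)
    hence "real k * \<eta> \<le> real k * (p / real (height_const k))" using kr by (intro mult_left_mono) auto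
    thus ?thesis by simp
  qed
  \<comment> \<open>A gap step multiplies the logarithm by k - 1 and adds at least v ln b'. The 1/10
    pays for \<open>b\<close> being smaller than \<open>b'\<close>, the last term for |n| through
    the height assumption.\<close>
  define v where "v = real k - 1 - 1/10 - 1 - real k / real (height_const k)"
  have V: "(real k - 1) * ln b - ln b' - real k * ln (real_of_int \<bar>n\<bar>) \<ge> v * p"
    using q_lower ln_n unfolding v_def q_def[symmetric] p_def[symmetric] \<eta>_def[symmetric] by (simp add: algebra_simps)
  have step: "(real k - 1) * l i + v * p \<le> l (Suc i)" if "Suc i < r_const k" for i
  proof -
    have "(real k - 1) * l i + ((real k - 1) * ln b - ln b' - real k * ln (real_of_int \<bar>n\<bar>)) \<le> l (Suc i)"
      unfolding l_def using that by (intro compatible_gap[OF k n(1) AB b] f) auto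
    thus ?thesis using V by linarith
  qed
  have l0: "0 \<le> l 0"
  proof -
    have "0 < r_const k" by (simp add: r_const_def)
    hence "0 < f 0" using f(1)[of 0] AB by (auto simp: compatible_def)
    thus ?thesis by (simp add: l_def)
  qed
  \<comment> \<open>The index by which the logarithms, starting from l 0 >= 0, have passed the
    threshold for \<open>a0\<close>. Then \<open>exceptional k\<close> further steps reach the
    required ratio, and \<open>r_const k\<close> equals \<open>base\<close> +
    \<open>exceptional k\<close> + 1.\<close>
  define base where "base = (if k = 3 then 5 else if k = 5 \<or> k = 4 then 3 else (2::nat))"
  have P: "real b' \<le> real b'" "real_of_int \<bar>n\<bar> \<le> real b'" "128 * real k ^ 2 \<le> real b'"
  proof -
    have "\<eta> \<le> p" using \<eta>q qp by linarith
    thus "real_of_int \<bar>n\<bar> \<le> real b'" using n0 b bpos by (simp add: \<eta>_def p_def)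
    thus "128 * real k ^ 2 \<le> real b'" using n(2) by linarith
  qed simp
  have ix: "base < r_const k" "r_const k - 1 < r_const k" by (auto simp: base_def r_const_def)
  show False
  proof (rule compatible_exclusion[OF k n0 AB b f(1)[OF ix(1)] f(1)[OF ix(2)] P])
    assume k3: "k = 3"
    hence v: "v = 19/10 - 1 - 3/432" "r_const k = 9" "base = 5"
      by (auto simp: v_def height_const_def r_const_def base_def)
    note st = step[of 0] step[of 1] step[of 2] step[of 3] step[of 4] step[of 5] step[of 6] step[of 7]
    have "27 * p \<le> l 5 \<and> 15/2 * l 5 \<le> l 8"
      using st l0 p0 unfolding v k3 by (simp add: eval_nat_numeral r_const_def)
    thus "27 * ln (real b') \<le> ln (f base) \<and> 15/2 * ln (f base) \<le> ln (f (r_const k - 1))"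
      by (simp add: v l_def p_def)
  next
    assume k4: "k = 4"
    hence v: "v = 29/10 - 1 - 4/176" "r_const k = 6" "base = 3"
      by (auto simp: v_def height_const_def r_const_def base_def)
    note st = step[of 0] step[of 1] step[of 2] step[of 3] step[of 4]
    have "22 * p \<le> l 3 \<and> 17/2 * l 3 \<le> l 5"
      using st l0 p0 unfolding v k4 by (simp add: eval_nat_numeral r_const_def)
    thus "22 * ln (real b') \<le> ln (f base) \<and> 17/2 * ln (f base) \<le> ln (f (r_const k - 1))"
      by (simp add: v l_def p_def)
  next
    assume k5: "k \<ge> 5"
    have "17 * p \<le> l base \<and> 37/10 * l base \<le> l (r_const k - 1)"
    proof (cases "k = 5")
      case True
      hence v: "v = 39/10 - 1 - 5/100" "r_const k = 5" "base = 3"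
        by (auto simp: v_def height_const_def r_const_def base_def)
      note st = step[of 0] step[of 1] step[of 2] step[of 3]
      show ?thesis using st l0 p0 unfolding v True by (simp add: eval_nat_numeral r_const_def)
    next
      case False
      hence k6: "real k \<ge> 6" using k5 by simp
      have v: "v = real k - 31/10" "r_const k = 4" "base = 2"
        using k5 False by (auto simp: v_def height_const_def r_const_def base_def)
      have vp: "29/10 * p \<le> v * p" using k6 p0 v by (intro mult_right_mono) auto
      have mono: "5 * t \<le> (real k - 1) * t" if "t \<ge> 0" for t using k6 that by (intro mult_right_mono) auto
      have st: "(real k - 1) * l 0 + v * p \<le> l 1" "(real k - 1) * l 1 + v * p \<le> l 2" "(real k - 1) * l 2 + v * p \<le> l 3"
        using step[of 0] step[of 1] step[of 2] v by (simp_all add: numeral_2_eq_2 numeral_3_eq_3)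
      have "l 1 \<ge> 29/10 * p" using st(1) mono[of "l 0"] l0 vp by linarith
      hence l2: "l 2 \<ge> 174/10 * p" using st(2) mono[of "l 1"] vp p0 by linarith
      hence "5 * l 2 \<le> l 3" using st(3) mono[of "l 2"] vp p0 by linarith
      thus ?thesis using l2 p0 v by simp
    qed
    thus "17 * ln (real b') \<le> ln (f base) \<and> 37/10 * ln (f base) \<le> ln (f (r_const k - 1))"
      by (simp add: l_def p_def)
  qed
qed

text \<open>Let \<open>b\<^sub>0 < b\<^sub>1 < \<dots>\<close> be the large elements of \<open>B\<close>. The pair \<open>b\<^sub>0, b\<^sub>1\<close> bounds two elements of \<open>A\<close> by a
  power of \<open>b\<^sub>1\<close>, and these in turn bound all but a few of the \<open>b\<^sub>j\<close> by a power of \<open>b\<^sub>1\<close>, whereas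
  \<open>no_close_pairs\<close> makes \<open>log b\<^sub>j\<close> grow geometrically.\<close>

lemma few_large_elements:
  assumes k: "k \<ge> 3"
  shows "\<exists>R. \<forall>n A B. 2 ^ (k - 1) \<le> \<bar>n\<bar> \<longrightarrow> 128 * real k ^ 2 \<le> real_of_int \<bar>n\<bar> \<longrightarrow> compatible k n A B \<longrightarrow>
     has_at_least (r_const k) A \<longrightarrow>
     \<not> has_at_least R {b \<in> B. real (height_const k) * ln (real_of_int \<bar>n\<bar>) \<le> ln (real b)}"
proof -
  define \<delta> where "\<delta> = 1 / (10 * real k)"
  define C where "C = 60 * real k"
  have \<delta>: "\<delta> > 0" using k by (simp add: \<delta>_def)
  have C1: "C \<ge> 1" using k by (simp add: C_def)
  \<comment> \<open>The exponent \<open>C\<close> enters twice: once in bounding \<open>f 1\<close>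
    by a power of g 1, once in bounding g (1 + j) by a power of that.\<close>
  obtain j where j: "C * C < (1 + \<delta>) ^ j" using \<delta> real_arch_pow[of "1 + \<delta>" "C * C"] by auto
  let ?c = "exceptional k"
  show ?thesis
  \<comment> \<open>Two elements for the pair g 0, g 1, then \<open>j\<close> growth steps up to g
    (1 + j), and \<open>?c\<close> elements above it, as \<open>few_huge_elements\<close>
    demands.\<close>
  proof (intro exI[of _ "j + ?c + 2"] allI impI notI)
    fix n :: int and A B :: "nat set"
    assume n: "2 ^ (k - 1) \<le> \<bar>n\<bar>" "128 * real k ^ 2 \<le> real_of_int \<bar>n\<bar>"
      and AB: "compatible k n A B" and A: "has_at_least (r_const k) A"
      and B: "has_at_least (j + ?c + 2) {b \<in> B. real (height_const k) * ln (real_of_int \<bar>n\<bar>) \<le> ln (real b)}"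
    obtain f where f: "\<And>i. i < r_const k \<Longrightarrow> f i \<in> A" "\<And>i j. i < j \<Longrightarrow> j < r_const k \<Longrightarrow> f i < f j"
      using has_at_least_enumeration[OF A] by blast
    obtain g where g: "\<And>i. i < j + ?c + 2 \<Longrightarrow> g i \<in> B"
        "\<And>i. i < j + ?c + 2 \<Longrightarrow> real (height_const k) * ln (real_of_int \<bar>n\<bar>) \<le> ln (real (g i))"
        "\<And>i i'. i < i' \<Longrightarrow> i' < j + ?c + 2 \<Longrightarrow> g i < g i'"
      using has_at_least_enumeration[OF B] by blast
    have kr: "real k \<ge> 3" using k by simp
    have "128 * 3 ^ 2 \<le> 128 * real k ^ 2" using kr by (intro mult_left_mono power_mono) auto
    hence "128 * 3 ^ 2 \<le> real_of_int \<bar>n\<bar>" using n(2) by linarith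
    hence N1: "real_of_int \<bar>n\<bar> > 1" by simp
    have g01: "g 0 \<in> B" "g 1 \<in> B" "g 0 < g 1" using g by auto
    have gpos: "g 0 > 0" "g 1 > 0" using g01 AB by (auto simp: compatible_def)
    define P where "P = real (g 1)"
    have H: "height_const k \<ge> 1" using k by (simp add: height_const_def)
    have "1 * ln (real_of_int \<bar>n\<bar>) \<le> real (height_const k) * ln (real_of_int \<bar>n\<bar>)"
      using H N1 by (intro mult_right_mono) auto
    also have "\<dots> \<le> ln P" unfolding P_def by (rule g(2)) simp
    finally have PN: "real_of_int \<bar>n\<bar> \<le> P" using gpos N1 by (simp add: P_def)
    have P: "P > 1" "128 * real k ^ 2 \<le> P" using PN N1 n(2) by linarith+
    have rc: "?c + 2 \<le> r_const k" by (simp add: exceptional_def r_const_def)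
    have f1: "ln (f 1) < C * ln P"
      unfolding C_def
      using few_huge_elements[OF k n(1) AB g01 _ PN P(2), of "\<lambda>i. f (Suc i)"] f rc by (simp add: P_def)
    have f01: "f 0 \<in> A" "f 1 \<in> A" "f 0 < f 1" using f rc by auto
    define P' where "P' = P powr C"
    have PP': "P \<le> P'" using P C1 powr_mono[of 1 C P] by (simp add: P'_def)
    have f1pos: "0 < f 1" using f01 by simp
    have f1P: "real (f 1) \<le> P'"
    proof -
      have "real (f 1) = exp (ln (real (f 1)))" using f1pos by simp
      also have "\<dots> \<le> exp (C * ln P)" using f1 by simp
      also have "\<dots> = P'" using P by (simp add: P'_def powr_def)
      finally show ?thesis .
    qed
    have "ln (g (1 + j + 0)) < C * ln P'"
      unfolding C_def
      by (rule few_huge_elements[OF k n(1) compatible_sym[OF AB] f01 f1P])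
         (use PN P PP' g in auto)
    hence up: "ln (g (1 + j)) < C * C * ln P" using P by (simp add: P'_def ln_powr)
    have grow: "(1 + \<delta>) ^ i * ln P \<le> ln (g (1 + i))" if "i \<le> j" for i
      using that
    proof (induction i)
      case 0 thus ?case by (simp add: P_def)
    next
      case (Suc i)
      have "(1 + \<delta>) * ln (g (1 + i)) < ln (g (1 + Suc i))"
        unfolding \<delta>_def using Suc.prems
        by (intro no_close_pairs[OF k n AB A] g) auto
      moreover have "(1 + \<delta>) * ((1 + \<delta>) ^ i * ln P) \<le> (1 + \<delta>) * ln (g (1 + i))"
        using Suc \<delta> by (intro mult_left_mono) auto
      ultimately show ?case by (simp add: mult.assoc)
    qed
    have "C * C * ln P < (1 + \<delta>) ^ j * ln P" using j P by (intro mult_strict_right_mono) auto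
    thus False using grow[of j] up by linarith
  qed
qed

section \<open>Small linear forms and Taylor expansions\<close>

lemma card_int_box_le:
  fixes u :: real
  assumes "u \<ge> 0"
  shows "real (card {\<lfloor>-u\<rfloor>..\<lfloor>u\<rfloor>}) \<le> 2 * u + 2"
proof -
  have "\<lfloor>-u\<rfloor> \<le> \<lfloor>u\<rfloor>" using assms by (intro floor_mono) auto
  hence "real (card {\<lfloor>-u\<rfloor>..\<lfloor>u\<rfloor>}) = of_int (\<lfloor>u\<rfloor> - \<lfloor>-u\<rfloor> + 1)" by simp
  thus ?thesis by linarith
qed

text \<open>Siegel's pigeonhole argument: two integer vectors from the box with sides
  \<open>H j\<close> give the same rounded values of all forms, and their difference is the
  solution. The box has at least \<Prod> H j points even if some H j < 1, since 0 always
  counts.\<close>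

lemma small_linear_forms:
  fixes \<gamma> :: "'j \<Rightarrow> 'h \<Rightarrow> real" and H :: "'j \<Rightarrow> real" and U :: "'h \<Rightarrow> real"
  assumes fin: "finite J" "finite R" and H: "\<And>j. j \<in> J \<Longrightarrow> H j > 0" and \<tau>: "\<tau> > 0"
    and U: "\<And>h. h \<in> R \<Longrightarrow> (\<Sum>j\<in>J. H j * \<bar>\<gamma> j h\<bar>) \<le> U h"
    and count: "(\<Prod>h\<in>R. 2 * (U h / \<tau>) + 2) < (\<Prod>j\<in>J. H j)"
  shows "\<exists>c :: 'j \<Rightarrow> int. (\<exists>j\<in>J. c j \<noteq> 0) \<and> (\<forall>j\<in>J. \<bar>real_of_int (c j)\<bar> \<le> H j) \<and>
           (\<forall>h\<in>R. \<bar>\<Sum>j\<in>J. real_of_int (c j) * \<gamma> j h\<bar> < \<tau>)"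
proof -
  define C where "C = (\<Pi>\<^sub>E j\<in>J. {0..\<lfloor>H j\<rfloor>})"
  define D where "D = (\<Pi>\<^sub>E h\<in>R. {\<lfloor>- (U h / \<tau>)\<rfloor>..\<lfloor>U h / \<tau>\<rfloor>})"
  define \<phi> where "\<phi> c = (\<lambda>h\<in>R. \<lfloor>(\<Sum>j\<in>J. real_of_int (c j) * \<gamma> j h) / \<tau>\<rfloor>)" for c :: "'j \<Rightarrow> int"
  have U0: "U h \<ge> 0" if "h \<in> R" for h
  proof -
    have "0 \<le> (\<Sum>j\<in>J. H j * \<bar>\<gamma> j h\<bar>)" using H by (intro sum_nonneg mult_nonneg_nonneg) (auto intro: less_imp_le)
    thus ?thesis using U[OF that] by linarith
  qed
  have finD: "finite D" unfolding D_def using fin by (intro finite_PiE) auto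
  have cb: "\<bar>\<Sum>j\<in>J. real_of_int (c j) * \<gamma> j h\<bar> \<le> U h" if "c \<in> C" "h \<in> R" for c h
  proof -
    have "\<bar>\<Sum>j\<in>J. real_of_int (c j) * \<gamma> j h\<bar> \<le> (\<Sum>j\<in>J. \<bar>real_of_int (c j)\<bar> * \<bar>\<gamma> j h\<bar>)"
      by (rule order.trans[OF sum_abs]) (simp add: abs_mult)
    also have "\<dots> \<le> (\<Sum>j\<in>J. H j * \<bar>\<gamma> j h\<bar>)"
    proof (intro sum_mono mult_right_mono)
      fix j assume "j \<in> J"
      hence "0 \<le> c j" "c j \<le> \<lfloor>H j\<rfloor>" using that by (auto simp: C_def PiE_iff)
      thus "\<bar>real_of_int (c j)\<bar> \<le> H j" by linarith
    qed auto
    also have "\<dots> \<le> U h" by (rule U) fact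
    finally show ?thesis .
  qed
  have sub: "\<phi> ` C \<subseteq> D"
  proof (rule image_subsetI)
    fix c assume c: "c \<in> C"
    have "\<lfloor>- (U h / \<tau>)\<rfloor> \<le> \<lfloor>(\<Sum>j\<in>J. real_of_int (c j) * \<gamma> j h) / \<tau>\<rfloor> \<and>
          \<lfloor>(\<Sum>j\<in>J. real_of_int (c j) * \<gamma> j h) / \<tau>\<rfloor> \<le> \<lfloor>U h / \<tau>\<rfloor>" if "h \<in> R" for h
    proof -
      have "- U h \<le> (\<Sum>j\<in>J. real_of_int (c j) * \<gamma> j h)" "(\<Sum>j\<in>J. real_of_int (c j) * \<gamma> j h) \<le> U h"
        using cb[OF c that] by linarith+
      from this[THEN divide_right_mono, of \<tau>] \<tau>
      have "- U h / \<tau> \<le> (\<Sum>j\<in>J. real_of_int (c j) * \<gamma> j h) / \<tau>" "(\<Sum>j\<in>J. real_of_int (c j) * \<gamma> j h) / \<tau> \<le> U h / \<tau>"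
        by linarith+
      thus ?thesis by (auto intro!: floor_mono)
    qed
    thus "\<phi> c \<in> D" by (auto simp: D_def \<phi>_def PiE_iff)
  qed
  have "real (card D) = (\<Prod>h\<in>R. real (card {\<lfloor>- (U h / \<tau>)\<rfloor>..\<lfloor>U h / \<tau>\<rfloor>}))"
    unfolding D_def using fin by (simp add: card_PiE)
  also have "\<dots> \<le> (\<Prod>h\<in>R. 2 * (U h / \<tau>) + 2)"
    using U0 \<tau> by (intro prod_mono conjI card_int_box_le) auto
  also note count
  also have "(\<Prod>j\<in>J. H j) \<le> (\<Prod>j\<in>J. real (card {0..\<lfloor>H j\<rfloor>}))"
  proof (rule prod_mono)
    fix j assume "j \<in> J"
    hence "H j > 0" by (rule H)
    thus "0 \<le> H j \<and> H j \<le> real (card {0..\<lfloor>H j\<rfloor>})" by simp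
  qed
  also have "\<dots> = real (card C)" unfolding C_def using fin by (simp add: card_PiE)
  finally have "card D < card C" by simp
  hence "\<not> inj_on \<phi> C" using sub finD card_inj_on_le by (metis not_le)
  then obtain c1 c2 where c12: "c1 \<in> C" "c2 \<in> C" "\<phi> c1 = \<phi> c2" "c1 \<noteq> c2" by (auto simp: inj_on_def)
  define c where "c j = c1 j - c2 j" for j
  show ?thesis
  proof (intro exI[of _ c] conjI ballI)
    show "\<exists>j\<in>J. c j \<noteq> 0"
    proof (rule ccontr)
      assume "\<not> ?thesis"
      hence "\<And>j. j \<in> J \<Longrightarrow> c1 j = c2 j" by (auto simp: c_def)
      hence "c1 = c2" using c12(1,2) unfolding C_def by (rule PiE_ext[rotated 2])
      thus False using c12 by simp
    qed
    fix j assume "j \<in> J"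
    hence "0 \<le> c1 j" "c1 j \<le> \<lfloor>H j\<rfloor>" "0 \<le> c2 j" "c2 j \<le> \<lfloor>H j\<rfloor>" using c12 by (auto simp: C_def PiE_iff)
    thus "\<bar>real_of_int (c j)\<bar> \<le> H j" unfolding c_def by linarith
  next
    fix h assume h: "h \<in> R"
    define A where "A = (\<Sum>j\<in>J. real_of_int (c1 j) * \<gamma> j h) / \<tau>"
    define B where "B = (\<Sum>j\<in>J. real_of_int (c2 j) * \<gamma> j h) / \<tau>"
    have "\<lfloor>A\<rfloor> = \<lfloor>B\<rfloor>" using fun_cong[OF c12(3), of h] h by (simp add: \<phi>_def A_def B_def)
    hence "\<bar>A - B\<bar> < 1" by linarith
    moreover have "(\<Sum>j\<in>J. real_of_int (c j) * \<gamma> j h) = (A - B) * \<tau>"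
      using \<tau> by (simp add: A_def B_def c_def left_diff_distrib sum_subtractf)
    ultimately show "\<bar>\<Sum>j\<in>J. real_of_int (c j) * \<gamma> j h\<bar> < \<tau>" using \<tau> by (simp add: abs_mult)
  qed
qed

text \<open>The coefficient of \<open>g j\<close> is allowed the size \<open>W / K j\<close>. With \<open>W\<close> as large as the
  Taylor remainders permit, pigeonhole makes the first \<open>s\<close> Taylor coefficients of the combination
  small, so that its values, being integers, vanish.\<close>

lemma vanishing_combination:
  fixes g :: "'j \<Rightarrow> 'b \<Rightarrow> real" and \<gamma> :: "'j \<Rightarrow> nat \<Rightarrow> real" and K :: "'j \<Rightarrow> real" and \<rho> C :: real
  assumes fin: "finite J" and s: "card J = s" "s \<ge> 1" and K: "\<And>j. j \<in> J \<Longrightarrow> K j > 0"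
    and \<rho>: "\<rho> \<ge> 1" and C: "C > 0"
    and int: "\<And>j b. j \<in> J \<Longrightarrow> b \<in> S \<Longrightarrow> g j b \<in> \<int>"
    and \<gamma>: "\<And>j h. j \<in> J \<Longrightarrow> h < s \<Longrightarrow> \<bar>\<gamma> j h\<bar> \<le> C * K j / \<rho> ^ h"
    and \<theta>: "\<And>b. b \<in> S \<Longrightarrow> \<bar>\<theta> b\<bar> \<le> 1"
    and taylor: "\<And>j b. j \<in> J \<Longrightarrow> b \<in> S \<Longrightarrow> \<bar>g j b - (\<Sum>h<s. \<gamma> j h * \<theta> b ^ h)\<bar> \<le> C * K j / \<rho> ^ s"
    and count: "(8 * real s ^ 2 * C) ^ s * (\<Prod>j\<in>J. K j) < \<rho> ^ (s * (s - 1) div 2)"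
  shows "\<exists>c :: 'j \<Rightarrow> int. (\<exists>j\<in>J. c j \<noteq> 0) \<and> (\<forall>b\<in>S. (\<Sum>j\<in>J. real_of_int (c j) * g j b) = 0)"
proof -
  \<comment> \<open>The choices of \<open>W\<close> and \<tau> balance the two errors: the Taylor
    remainders add up to at most 1/2, the Taylor polynomials to less than 1/2.\<close>
  define W where "W = \<rho> ^ s / (2 * real s * C)"
  define H where "H j = W / K j" for j
  define \<tau> where "\<tau> = 1 / (2 * real s)"
  define U where "U h = \<rho> ^ (s - h) / 2" for h
  have s0: "real s \<ge> 1" using s by simp
  have W: "W > 0" using \<rho> s0 C by (simp add: W_def)
  have H0: "H j > 0" if "j \<in> J" for j using W K[OF that] by (simp add: H_def)
  have \<rho>p: "\<rho> ^ m > 0" for m using \<rho> by simp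
  have "\<exists>c :: 'j \<Rightarrow> int. (\<exists>j\<in>J. c j \<noteq> 0) \<and> (\<forall>j\<in>J. \<bar>real_of_int (c j)\<bar> \<le> H j) \<and>
           (\<forall>h\<in>{..<s}. \<bar>\<Sum>j\<in>J. real_of_int (c j) * \<gamma> j h\<bar> < \<tau>)"
  proof (rule small_linear_forms[OF fin finite_lessThan H0])
    show "\<tau> > 0" using s0 by (simp add: \<tau>_def)
    fix h assume h: "h \<in> {..<s}"
    have "(\<Sum>j\<in>J. H j * \<bar>\<gamma> j h\<bar>) \<le> (\<Sum>j\<in>J. H j * (C * K j / \<rho> ^ h))"
      using h H0 by (intro sum_mono mult_left_mono \<gamma>) (auto intro: less_imp_le)
    also have "\<dots> = (\<Sum>j\<in>J. W * C / \<rho> ^ h)"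
      using K by (intro sum.cong) (auto simp: H_def dest!: K)
    also have "\<dots> = real s * (W * C / \<rho> ^ h)" by (simp add: s)
    also have "\<dots> = \<rho> ^ s / \<rho> ^ h / 2" using s0 C by (simp add: W_def field_simps)
    also have "\<rho> ^ s / \<rho> ^ h = \<rho> ^ (s - h)" using h \<rho> by (simp add: power_diff)
    finally show "(\<Sum>j\<in>J. H j * \<bar>\<gamma> j h\<bar>) \<le> U h" by (simp add: U_def)
  next
    \<comment> \<open>Up to constants there are \<rho>^(s(s+1)/2) rounded values against
      \<rho>^(s^2) / \<Prod> K j coefficient vectors. The difference of the exponents of \<rho> is
      s(s-1)/2, whence the form of \<open>count\<close>.\<close>
    have "(\<Prod>h<s. 2 * (U h / \<tau>) + 2) \<le> (\<Prod>h<s. 4 * real s * \<rho> ^ (s - h))"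
    proof (rule prod_mono)
      fix h assume "h \<in> {..<s}"
      have "1 * 1 \<le> real s * \<rho> ^ (s - h)" using s0 \<rho> by (intro mult_mono) (auto intro: one_le_power)
      thus "0 \<le> 2 * (U h / \<tau>) + 2 \<and> 2 * (U h / \<tau>) + 2 \<le> 4 * real s * \<rho> ^ (s - h)"
        using s0 by (simp add: U_def \<tau>_def mult_ac)
    qed
    also have "\<dots> = (4 * real s) ^ s * \<rho> ^ (\<Sum>h<s. s - h)"
      by (simp add: prod.distrib power_sum)
    also have "(\<Sum>h<s. s - h) = s * (s + 1) div 2"
    proof -
      have "(\<Sum>h<s. s - h) = (\<Sum>h<s. Suc (s - Suc h))" by (intro sum.cong) auto
      also have "\<dots> = (\<Sum>h<s. Suc h)" by (rule sum.nat_diff_reindex)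
      also have "\<dots> = s * (s + 1) div 2" by (induction s) auto
      finally show ?thesis .
    qed
    finally have 1: "(\<Prod>h<s. 2 * (U h / \<tau>) + 2) \<le> (4 * real s) ^ s * \<rho> ^ (s * (s + 1) div 2)" .
    have e: "s * (s + 1) div 2 + s * (s - 1) div 2 = s * s"
    proof -
      have "even (s * (s + 1))" "even (s * (s - 1))" by auto
      hence "s * (s + 1) div 2 + s * (s - 1) div 2 = (s * (s + 1) + s * (s - 1)) div 2" by (auto simp: div_plus_div_distrib_dvd_left)
      also have "s * (s + 1) + s * (s - 1) = 2 * (s * s)" using s by (cases s) (auto simp: algebra_simps)
      finally show ?thesis by simp
    qed
    have Kp: "(\<Prod>j\<in>J. K j) > 0" using K by (intro prod_pos) auto
    have "(\<Prod>j\<in>J. H j) = W ^ s / (\<Prod>j\<in>J. K j)" by (simp add: H_def prod_dividef s)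
    also have "\<dots> = \<rho> ^ (s * s) / ((2 * real s * C) ^ s * (\<Prod>j\<in>J. K j))"
      by (simp add: W_def power_divide power_mult)
    also have "\<rho> ^ (s * s) = \<rho> ^ (s * (s + 1) div 2) * \<rho> ^ (s * (s - 1) div 2)"
      unfolding e[symmetric] by (rule power_add)
    finally have HJ: "(\<Prod>j\<in>J. H j) = \<rho> ^ (s * (s + 1) div 2) * \<rho> ^ (s * (s - 1) div 2) / ((2 * real s * C) ^ s * (\<Prod>j\<in>J. K j))" .
    have E0: "(2 * real s * C) ^ s > 0" using s0 C by simp
    have "4 * real s * (2 * real s * C) = 8 * real s ^ 2 * C" by (simp add: power2_eq_square)
    hence e8: "(4 * real s) ^ s * (2 * real s * C) ^ s = (8 * real s ^ 2 * C) ^ s" by (simp only: power_mult_distrib[symmetric])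
    have "(4 * real s) ^ s * \<rho> ^ (s * (s + 1) div 2) * ((2 * real s * C) ^ s * (\<Prod>j\<in>J. K j))
        = \<rho> ^ (s * (s + 1) div 2) * ((8 * real s ^ 2 * C) ^ s * (\<Prod>j\<in>J. K j))"
      unfolding e8[symmetric] by (simp only: mult_ac)
    also have "\<dots> < \<rho> ^ (s * (s + 1) div 2) * \<rho> ^ (s * (s - 1) div 2)"
      by (rule mult_strict_left_mono[OF count \<rho>p])
    finally have "(4 * real s) ^ s * \<rho> ^ (s * (s + 1) div 2) < (\<Prod>j\<in>J. H j)"
      unfolding HJ using mult_pos_pos[OF E0 Kp] by (simp only: pos_less_divide_eq)
    thus "(\<Prod>h<s. 2 * (U h / \<tau>) + 2) < (\<Prod>j\<in>J. H j)" using 1 by linarith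
  qed
  then obtain c :: "'j \<Rightarrow> int" where c: "\<exists>j\<in>J. c j \<noteq> 0" "\<And>j. j \<in> J \<Longrightarrow> \<bar>real_of_int (c j)\<bar> \<le> H j"
     "\<And>h. h < s \<Longrightarrow> \<bar>\<Sum>j\<in>J. real_of_int (c j) * \<gamma> j h\<bar> < \<tau>" by auto
  have "(\<Sum>j\<in>J. real_of_int (c j) * g j b) = 0" if b: "b \<in> S" for b
  proof -
    define F where "F = (\<Sum>j\<in>J. real_of_int (c j) * g j b)"
    define T where "T = (\<Sum>j\<in>J. real_of_int (c j) * (\<Sum>h<s. \<gamma> j h * \<theta> b ^ h))"
    have "F \<in> \<int>" unfolding F_def using b int by (intro Ints_sum Ints_mult) auto
    have "T = (\<Sum>h<s. (\<Sum>j\<in>J. real_of_int (c j) * \<gamma> j h) * \<theta> b ^ h)"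
      unfolding T_def sum_distrib_left sum_distrib_right by (subst sum.swap) (simp add: mult.assoc)
    hence "\<bar>T\<bar> \<le> (\<Sum>h<s. \<bar>\<Sum>j\<in>J. real_of_int (c j) * \<gamma> j h\<bar> * \<bar>\<theta> b\<bar> ^ h)"
      by (simp only:) (rule order.trans[OF sum_abs], simp add: abs_mult power_abs)
    also have "\<dots> \<le> (\<Sum>h<s. \<bar>\<Sum>j\<in>J. real_of_int (c j) * \<gamma> j h\<bar> * 1)"
      using \<theta>[OF b] by (intro sum_mono mult_left_mono power_le_one) auto
    also have "\<dots> < (\<Sum>h<s. \<tau>)" using c(3) s by (intro sum_strict_mono) (auto simp: lessThan_empty_iff)
    also have "\<dots> = 1/2" using s0 by (simp add: \<tau>_def)
    finally have T: "\<bar>T\<bar> < 1/2" .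
    have "F - T = (\<Sum>j\<in>J. real_of_int (c j) * (g j b - (\<Sum>h<s. \<gamma> j h * \<theta> b ^ h)))"
      by (simp add: F_def T_def right_diff_distrib sum_subtractf)
    hence "\<bar>F - T\<bar> \<le> (\<Sum>j\<in>J. \<bar>real_of_int (c j)\<bar> * \<bar>g j b - (\<Sum>h<s. \<gamma> j h * \<theta> b ^ h)\<bar>)"
      by (simp only:) (rule order.trans[OF sum_abs], simp add: abs_mult)
    also have "\<dots> \<le> (\<Sum>j\<in>J. H j * (C * K j / \<rho> ^ s))"
      using b c(2) H0 by (intro sum_mono mult_mono taylor) (auto intro: less_imp_le)
    also have "\<dots> = (\<Sum>j\<in>J. W * C / \<rho> ^ s)"
      using K by (intro sum.cong) (auto simp: H_def dest!: K)
    also have "\<dots> = 1/2" using s0 C \<rho> by (simp add: s W_def)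
    finally have "\<bar>F\<bar> < 1" using T by linarith
    thus ?thesis using \<open>F \<in> \<int>\<close> by (auto simp: F_def[symmetric] elim!: Ints_cases)
  qed
  thus ?thesis using c(1) by blast
qed

text \<open>The product of the powers (\<alpha> i t + \<beta> i)^(q i) where all linear forms are
  positive. In exponential form it is positive everywhere and turns sums of exponent vectors into
  products.\<close>

definition radical :: "'i set \<Rightarrow> ('i \<Rightarrow> real) \<Rightarrow> ('i \<Rightarrow> real) \<Rightarrow> ('i \<Rightarrow> real) \<Rightarrow> real \<Rightarrow> real" where
  "radical I \<alpha> \<beta> q t = exp (\<Sum>i\<in>I. q i * ln (\<alpha> i * t + \<beta> i))"

lemma radical_pos: "radical I \<alpha> \<beta> q t > 0"
  by (simp add: radical_def)

lemma radical_diff: "radical I \<alpha> \<beta> (\<lambda>i. p i - q i) t = radical I \<alpha> \<beta> p t / radical I \<alpha> \<beta> q t"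
  by (simp add: radical_def exp_diff[symmetric] sum_subtractf left_diff_distrib)

lemma radical_lower:
  assumes "finite I" "i \<in> I" "\<alpha> i * t + \<beta> i > 0"
  shows "radical I \<alpha> \<beta> (q(i := q i - 1)) t = radical I \<alpha> \<beta> q t / (\<alpha> i * t + \<beta> i)"
proof -
  have "(\<Sum>j\<in>I. (q(i := q i - 1)) j * ln (\<alpha> j * t + \<beta> j)) = (\<Sum>j\<in>I. q j * ln (\<alpha> j * t + \<beta> j)) - ln (\<alpha> i * t + \<beta> i)"
    using assms by (simp add: sum.remove[of I i] left_diff_distrib)
  thus ?thesis using assms by (simp add: radical_def exp_diff)
qed

lemma radical_minus_one:
  assumes "finite I" "\<And>i. i \<in> I \<Longrightarrow> \<alpha> i * t + \<beta> i > 0"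
  shows "radical I \<alpha> \<beta> (\<lambda>i. q i - 1) t = radical I \<alpha> \<beta> q t / (\<Prod>i\<in>I. \<alpha> i * t + \<beta> i)"
proof -
  have "radical I \<alpha> \<beta> (\<lambda>i. 1) t = (\<Prod>i\<in>I. \<alpha> i * t + \<beta> i)"
    using assms by (simp add: radical_def exp_sum)
  thus ?thesis by (simp add: radical_diff)
qed

lemma radical_derivative:
  assumes "finite I" "\<And>i. i \<in> I \<Longrightarrow> \<alpha> i * t + \<beta> i > 0"
  shows "(radical I \<alpha> \<beta> q has_real_derivative
           (\<Sum>i\<in>I. q i * \<alpha> i / (\<alpha> i * t + \<beta> i)) * radical I \<alpha> \<beta> q t) (at t)"
proof -
  have "((\<lambda>t. \<Sum>i\<in>I. q i * ln (\<alpha> i * t + \<beta> i)) has_real_derivative (\<Sum>i\<in>I. q i * \<alpha> i / (\<alpha> i * t + \<beta> i))) (at t)"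
  proof (rule DERIV_sum)
    fix i assume "i \<in> I"
    thus "((\<lambda>t. q i * ln (\<alpha> i * t + \<beta> i)) has_real_derivative q i * \<alpha> i / (\<alpha> i * t + \<beta> i)) (at t)"
      using assms(2)[of i] by (auto intro!: derivative_eq_intros)
  qed
  from DERIV_fun_exp[OF this] show ?thesis by (simp add: radical_def[abs_def] mult.commute)
qed

text \<open>The h-th derivative: differentiating hits one linear form and lowers its exponent by
  one. The recursion over exponent vectors makes the size estimate a direct induction.\<close>

primrec radical_diffs :: "'i set \<Rightarrow> ('i \<Rightarrow> real) \<Rightarrow> ('i \<Rightarrow> real) \<Rightarrow> nat \<Rightarrow> ('i \<Rightarrow> real) \<Rightarrow> real \<Rightarrow> real" where
  "radical_diffs I \<alpha> \<beta> 0 q t = radical I \<alpha> \<beta> q t"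
| "radical_diffs I \<alpha> \<beta> (Suc h) q t = (\<Sum>i\<in>I. q i * \<alpha> i * radical_diffs I \<alpha> \<beta> h (q(i := q i - 1)) t)"

lemma radical_diffs_derivative:
  assumes "finite I" "\<And>i. i \<in> I \<Longrightarrow> \<alpha> i * t + \<beta> i > 0"
  shows "(radical_diffs I \<alpha> \<beta> h q has_real_derivative radical_diffs I \<alpha> \<beta> (Suc h) q t) (at t)"
proof (induction h arbitrary: q)
  case 0
  have "radical_diffs I \<alpha> \<beta> (Suc 0) q t = (\<Sum>i\<in>I. q i * \<alpha> i / (\<alpha> i * t + \<beta> i)) * radical I \<alpha> \<beta> q t"
    unfolding radical_diffs.simps sum_distrib_right
  proof (intro sum.cong refl)
    fix i assume i: "i \<in> I"
    show "q i * \<alpha> i * radical I \<alpha> \<beta> (q(i := q i - 1)) t = q i * \<alpha> i / (\<alpha> i * t + \<beta> i) * radical I \<alpha> \<beta> q t"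
      unfolding radical_lower[where \<alpha> = \<alpha> and \<beta> = \<beta>, OF assms(1) i assms(2)[OF i]] by simp
  qed
  moreover have "radical_diffs I \<alpha> \<beta> 0 q = radical I \<alpha> \<beta> q" by (simp add: fun_eq_iff)
  ultimately show ?case using radical_derivative[OF assms] by simp
next
  case (Suc h)
  have "((\<lambda>t. \<Sum>i\<in>I. q i * \<alpha> i * radical_diffs I \<alpha> \<beta> h (q(i := q i - 1)) t) has_real_derivative
      (\<Sum>i\<in>I. q i * \<alpha> i * radical_diffs I \<alpha> \<beta> (Suc h) (q(i := q i - 1)) t)) (at t)"
    by (intro DERIV_sum DERIV_cmult Suc.IH)
  thus ?case by (simp add: fun_eq_iff[symmetric] del: radical_diffs.simps(2) add: radical_diffs.simps(2)[abs_def])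
qed

text \<open>Each differentiation brings a factor \<alpha> i / (\<alpha> i t + \<beta> i) <= 1/y,
  where \<open>y\<close> is a lower bound for the distance from \<open>t\<close> to the
  singularities, and an exponent of size at most Q + h.\<close>

lemma radical_diffs_bound:
  assumes "finite I" "\<And>i. i \<in> I \<Longrightarrow> \<alpha> i > 0" "y > 0" "\<And>i. i \<in> I \<Longrightarrow> \<alpha> i * y \<le> \<alpha> i * t + \<beta> i"
    and "\<And>i. i \<in> I \<Longrightarrow> \<bar>q i\<bar> \<le> Q" "Q \<ge> 0"
  shows "\<bar>radical_diffs I \<alpha> \<beta> h q t\<bar> \<le> (real (card I) * (Q + real h)) ^ h * radical I \<alpha> \<beta> q t / y ^ h"
  using assms(5,6)
proof (induction h arbitrary: q Q)
  case 0
  thus ?case using radical_pos[of I \<alpha> \<beta> q t] by simp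
next
  case (Suc h)
  let ?r = "radical I \<alpha> \<beta> q t"
  let ?M = "(real (card I) * (Q + 1 + real h)) ^ h"
  have "\<bar>radical_diffs I \<alpha> \<beta> (Suc h) q t\<bar> \<le> (\<Sum>i\<in>I. \<bar>q i * \<alpha> i * radical_diffs I \<alpha> \<beta> h (q(i := q i - 1)) t\<bar>)"
    unfolding radical_diffs.simps by (rule sum_abs)
  also have "\<dots> \<le> (\<Sum>i\<in>I. Q * (?M * ?r / y ^ Suc h))"
  proof (rule sum_mono)
    fix i assume i: "i \<in> I"
    have L: "\<alpha> i * t + \<beta> i > 0" "\<alpha> i > 0"
      using assms(2)[OF i] assms(3) assms(4)[OF i] by (auto intro: less_le_trans[of 0 "\<alpha> i * y"])
    have "\<bar>radical_diffs I \<alpha> \<beta> h (q(i := q i - 1)) t\<bar> \<le> ?M * radical I \<alpha> \<beta> (q(i := q i - 1)) t / y ^ h"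
    proof (rule Suc.IH)
      fix j assume "j \<in> I"
      thus "\<bar>(q(i := q i - 1)) j\<bar> \<le> Q + 1" using Suc.prems(1)[of j] by (auto simp: abs_le_iff)
    next
      show "0 \<le> Q + 1" using Suc.prems by simp
    qed
    also have "radical I \<alpha> \<beta> (q(i := q i - 1)) t = ?r / (\<alpha> i * t + \<beta> i)"
      using assms(1) i L by (intro radical_lower)
    finally have "\<bar>radical_diffs I \<alpha> \<beta> h (q(i := q i - 1)) t\<bar> \<le> ?M * (?r / (\<alpha> i * t + \<beta> i)) / y ^ h" .
    hence "\<alpha> i * \<bar>radical_diffs I \<alpha> \<beta> h (q(i := q i - 1)) t\<bar> \<le> \<alpha> i * (?M * (?r / (\<alpha> i * t + \<beta> i)) / y ^ h)"
      by (rule mult_left_mono) (use L in simp)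
    also have "\<dots> = ?M * ?r / y ^ h * (\<alpha> i / (\<alpha> i * t + \<beta> i))" by (simp add: mult_ac)
    also have "\<dots> \<le> ?M * ?r / y ^ h * (1 / y)"
    proof (rule mult_left_mono)
      show "\<alpha> i / (\<alpha> i * t + \<beta> i) \<le> 1 / y" using assms(3) assms(4)[OF i] L by (simp add: field_simps)
      show "0 \<le> ?M * ?r / y ^ h" using Suc.prems assms(3) less_imp_le[OF radical_pos[of I \<alpha> \<beta> q t]]
        by (intro divide_nonneg_nonneg mult_nonneg_nonneg zero_le_power) auto
    qed
    finally have "\<alpha> i * \<bar>radical_diffs I \<alpha> \<beta> h (q(i := q i - 1)) t\<bar> \<le> ?M * ?r / y ^ Suc h" by (simp add: mult.commute[of y])
    hence "\<bar>q i\<bar> * (\<alpha> i * \<bar>radical_diffs I \<alpha> \<beta> h (q(i := q i - 1)) t\<bar>) \<le> Q * (?M * ?r / y ^ Suc h)"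
      using Suc.prems(1)[OF i] Suc.prems(2) L by (intro mult_mono) auto
    thus "\<bar>q i * \<alpha> i * radical_diffs I \<alpha> \<beta> h (q(i := q i - 1)) t\<bar> \<le> Q * (?M * ?r / y ^ Suc h)"
      using L by (simp add: abs_mult mult.assoc)
  qed
  also have "\<dots> = (real (card I) * Q) * (?M * ?r / y ^ Suc h)" by simp
  also have "\<dots> \<le> (real (card I) * (Q + 1 + real h)) * (?M * ?r / y ^ Suc h)"
    using Suc.prems assms(3) less_imp_le[OF radical_pos[of I \<alpha> \<beta> q t]]
    by (intro mult_right_mono mult_left_mono divide_nonneg_nonneg mult_nonneg_nonneg zero_le_power) auto
  also have "\<dots> = (real (card I) * (Q + real (Suc h))) ^ Suc h * ?r / y ^ Suc h" by (simp add: add_ac)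
  finally show ?case .
qed

lemma radical_mono:
  assumes "\<And>i. i \<in> I \<Longrightarrow> \<alpha> i > 0" "\<And>i. i \<in> I \<Longrightarrow> \<alpha> i * t + \<beta> i > 0" "\<And>i. i \<in> I \<Longrightarrow> q i \<ge> 0" "t \<le> t'"
  shows "radical I \<alpha> \<beta> q t \<le> radical I \<alpha> \<beta> q t'"
  unfolding radical_def exp_le_cancel_iff
proof (intro sum_mono mult_left_mono)
  fix i assume i: "i \<in> I"
  have "\<alpha> i * t \<le> \<alpha> i * t'" using assms(1)[OF i] assms(4) by simp
  thus "ln (\<alpha> i * t + \<beta> i) \<le> ln (\<alpha> i * t' + \<beta> i)" using assms(2)[OF i] by (subst ln_le_cancel_iff) auto
qed (use assms in auto)

text \<open>Lagrange's remainder at a point between \<open>b0\<close> and \<open>b\<close>. With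
  nonnegative exponents the radical increases, so its value there is at most the one at
  \<open>b\<close>.\<close>

lemma radical_taylor:
  fixes y :: real
  assumes I: "finite I" "I \<noteq> {}" "\<And>i. i \<in> I \<Longrightarrow> \<alpha> i > 0" and y: "y > 0" "\<And>i. i \<in> I \<Longrightarrow> \<alpha> i * y \<le> \<alpha> i * b0 + \<beta> i"
    and q: "\<And>i. i \<in> I \<Longrightarrow> 0 \<le> q i" "\<And>i. i \<in> I \<Longrightarrow> q i \<le> Q" "Q \<ge> 1"
    and b: "b0 \<le> b" "b - b0 \<le> y / \<rho>" "\<rho> \<ge> 1" and s: "s \<ge> 1"
  shows "\<bar>radical I \<alpha> \<beta> q b - (\<Sum>h<s. radical_diffs I \<alpha> \<beta> h q b0 / fact h * (b - b0) ^ h)\<bar>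
     \<le> (real (card I) * (Q + real s)) ^ s * radical I \<alpha> \<beta> q b / \<rho> ^ s"
proof (cases "b0 = b")
  case True
  have "radical I \<alpha> \<beta> q b = (\<Sum>h<s. radical_diffs I \<alpha> \<beta> h q b0 / fact h * (b - b0) ^ h)"
    using True s by (subst sum.remove[of _ 0]) (auto intro!: sum.neutral)
  thus ?thesis using b(3) q(3) less_imp_le[OF radical_pos[of I \<alpha> \<beta> q b]] by simp
next
  case False
  hence lt: "b0 < b" using b by simp
  have Lge: "\<alpha> i * y \<le> \<alpha> i * t + \<beta> i" if "i \<in> I" "t \<ge> b0" for i t
  proof -
    have "\<alpha> i * b0 \<le> \<alpha> i * t" using I(3)[OF that(1)] that(2) by simp
    thus ?thesis using y(2)[OF that(1)] by linarith
  qed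
  have Lpos: "\<alpha> i * t + \<beta> i > 0" if "i \<in> I" "t \<ge> b0" for i t
    using Lge[OF that] I(3)[OF that(1)] y(1) by (auto intro: less_le_trans[of 0 "\<alpha> i * y"])
  have "\<exists>t>b0. t < b \<and> radical I \<alpha> \<beta> q b = (\<Sum>m<s. radical_diffs I \<alpha> \<beta> m q b0 / fact m * (b - b0) ^ m)
      + radical_diffs I \<alpha> \<beta> s q t / fact s * (b - b0) ^ s"
    using s lt by (intro Taylor_up[where a = b0]) (auto simp: fun_eq_iff intro!: radical_diffs_derivative[OF I(1) Lpos] simp del: radical_diffs.simps(2))
  then obtain t where t: "b0 < t" "t < b" and eq: "radical I \<alpha> \<beta> q b = (\<Sum>m<s. radical_diffs I \<alpha> \<beta> m q b0 / fact m * (b - b0) ^ m)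
      + radical_diffs I \<alpha> \<beta> s q t / fact s * (b - b0) ^ s" by blast
  let ?M = "(real (card I) * (Q + real s)) ^ s"
  have M0: "?M \<ge> 0" using q(3) by simp
  have "\<bar>radical_diffs I \<alpha> \<beta> s q t\<bar> \<le> ?M * radical I \<alpha> \<beta> q t / y ^ s"
    using t q Lge[of _ t] by (intro radical_diffs_bound[OF I(1,3) y(1)]) (auto simp: abs_le_iff intro: order_trans[of _ 0])
  also have "\<dots> \<le> ?M * radical I \<alpha> \<beta> q b / y ^ s"
    using t q y M0 by (intro divide_right_mono mult_left_mono radical_mono I Lpos) auto
  finally have 1: "\<bar>radical_diffs I \<alpha> \<beta> s q t\<bar> \<le> ?M * radical I \<alpha> \<beta> q b / y ^ s" .
  have "\<bar>radical_diffs I \<alpha> \<beta> s q t / fact s * (b - b0) ^ s\<bar> = \<bar>radical_diffs I \<alpha> \<beta> s q t\<bar> / fact s * (b - b0) ^ s"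
    using lt by (simp add: abs_mult)
  also have "\<dots> \<le> \<bar>radical_diffs I \<alpha> \<beta> s q t\<bar> / 1 * (b - b0) ^ s"
    using lt by (intro mult_right_mono divide_left_mono) (auto simp: fact_ge_1)
  also have "\<dots> \<le> ?M * radical I \<alpha> \<beta> q b / y ^ s * (y / \<rho>) ^ s"
    using 1 b lt by (intro mult_mono power_mono) auto
  also have "\<dots> = ?M * radical I \<alpha> \<beta> q b / \<rho> ^ s" using y by (simp add: power_divide)
  finally show ?thesis using eq by simp
qed

section \<open>Zeros of sums of radicals\<close>

lemma zeros_le_zeros_derivative:
  fixes f f' :: "real \<Rightarrow> real"
  assumes up: "\<And>t u. t \<in> U \<Longrightarrow> t \<le> u \<Longrightarrow> u \<in> U"
    and der: "\<And>t. t \<in> U \<Longrightarrow> (f has_real_derivative f' t) (at t)"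
    and few: "\<not> has_at_least m {t \<in> U. f' t = 0}"
  shows "\<not> has_at_least (Suc m) {t \<in> U. f t = 0}"
proof
  assume "has_at_least (Suc m) {t \<in> U. f t = 0}"
  from has_at_least_enumeration[OF this] obtain g where
    g: "\<And>i. i < Suc m \<Longrightarrow> g i \<in> U \<and> f (g i) = 0" "\<And>i j. i < j \<Longrightarrow> j < Suc m \<Longrightarrow> g i < g j" by auto
  have "\<exists>z. g i < z \<and> z < g (Suc i) \<and> f' z = 0" if "i < m" for i
  proof -
    have lt: "g i < g (Suc i)" using g(2) that by simp
    have inU: "t \<in> U" if "g i \<le> t" for t using up[of "g i" t] g(1)[of i] that \<open>i < m\<close> by simp
    have "\<exists>z>g i. z < g (Suc i) \<and> (f has_real_derivative 0) (at z)"
    proof (rule Rolle[OF lt])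
      show "f (g i) = f (g (Suc i))" using g(1)[of i] g(1)[of "Suc i"] that by simp
      show "continuous_on {g i..g (Suc i)} f"
        using der inU by (intro continuous_at_imp_continuous_on ballI) (auto intro: DERIV_isCont)
      show "f differentiable at x" if "g i < x" for x
        using der[of x] inU[of x] that by (auto simp: real_differentiable_def)
    qed
    then obtain z where z: "g i < z" "z < g (Suc i)" "(f has_real_derivative 0) (at z)" by blast
    thus ?thesis using DERIV_unique[OF z(3) der[of z]] inU[of z] by auto
  qed
  then obtain z where z: "\<And>i. i < m \<Longrightarrow> g i < z i \<and> z i < g (Suc i) \<and> f' (z i) = 0" by metis
  have zlt: "z i < z j" if "i < j" "j < m" for i j
  proof -
    have "g (Suc i) \<le> g j" using g(2)[of "Suc i" j] that by (cases "Suc i = j") auto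
    thus ?thesis using z[of i] z[of j] that by auto
  qed
  have "has_at_least m {t \<in> U. f' t = 0}"
  proof (rule has_at_leastI[of _ z])
    show "z i \<in> {t \<in> U. f' t = 0}" if "i < m" for i
      using z[OF that] g(1)[of i] up[of "g i" "z i"] that by auto
    show "inj_on z {..<m}"
      by (rule linorder_inj_onI) (use zlt in \<open>auto simp: neq_iff dest: less_imp_neq\<close>)
  qed
  thus False using few by blast
qed

text \<open>The polynomial factor of the derivative of \<open>p\<close> times a radical, after
  taking out the radical with all exponents lowered by one.\<close>

definition radical_pderiv :: "'i set \<Rightarrow> ('i \<Rightarrow> real) \<Rightarrow> ('i \<Rightarrow> real) \<Rightarrow> ('i \<Rightarrow> real) \<Rightarrow> real poly \<Rightarrow> real poly" where
  "radical_pderiv I \<alpha> \<beta> q p = pderiv p * (\<Prod>i\<in>I. [:\<beta> i, \<alpha> i:])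
     + p * (\<Sum>i\<in>I. smult (q i * \<alpha> i) (\<Prod>j\<in>I - {i}. [:\<beta> j, \<alpha> j:]))"

lemma poly_radical_derivative:
  assumes "finite I" "\<And>i. i \<in> I \<Longrightarrow> \<alpha> i * t + \<beta> i > 0"
  shows "((\<lambda>t. poly p t * radical I \<alpha> \<beta> q t) has_real_derivative
     poly (radical_pderiv I \<alpha> \<beta> q p) t * radical I \<alpha> \<beta> (\<lambda>i. q i - 1) t) (at t)"
proof -
  let ?L = "\<Prod>i\<in>I. \<alpha> i * t + \<beta> i"
  have L: "?L > 0" using assms by (intro prod_pos) auto
  have rest: "(\<Prod>j\<in>I - {i}. \<alpha> j * t + \<beta> j) = ?L / (\<alpha> i * t + \<beta> i)" if "i \<in> I" for i
    using assms(1) assms(2)[OF that] that by (simp add: prod.remove[of I i])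
  have "poly (radical_pderiv I \<alpha> \<beta> q p) t
      = poly (pderiv p) t * ?L + poly p t * (\<Sum>i\<in>I. q i * \<alpha> i * (\<Prod>j\<in>I - {i}. \<alpha> j * t + \<beta> j))"
    by (simp add: radical_pderiv_def poly_prod poly_sum algebra_simps)
  also have "(\<Sum>i\<in>I. q i * \<alpha> i * (\<Prod>j\<in>I - {i}. \<alpha> j * t + \<beta> j)) = ?L * (\<Sum>i\<in>I. q i * \<alpha> i / (\<alpha> i * t + \<beta> i))"
    unfolding sum_distrib_left by (intro sum.cong refl) (simp add: rest)
  finally have R: "poly (radical_pderiv I \<alpha> \<beta> q p) t = (poly (pderiv p) t + poly p t * (\<Sum>i\<in>I. q i * \<alpha> i / (\<alpha> i * t + \<beta> i))) * ?L"
    by (simp only: distrib_left distrib_right mult_ac)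
  have rm: "radical I \<alpha> \<beta> (\<lambda>i. q i - 1) t = radical I \<alpha> \<beta> q t / ?L"
    by (rule radical_minus_one[where \<alpha> = \<alpha> and \<beta> = \<beta>, OF assms])
  have "poly (radical_pderiv I \<alpha> \<beta> q p) t * radical I \<alpha> \<beta> (\<lambda>i. q i - 1) t
     = (poly (pderiv p) t + poly p t * (\<Sum>i\<in>I. q i * \<alpha> i / (\<alpha> i * t + \<beta> i))) * radical I \<alpha> \<beta> q t"
    unfolding R rm using L by simp
  thus ?thesis using DERIV_mult[OF poly_DERIV[of p t] radical_derivative[where \<alpha> = \<alpha> and \<beta> = \<beta> and q = q, OF assms]]
    by (simp add: algebra_simps)
qed

lemma degree_radical_pderiv:
  assumes "finite I" "degree p \<le> d"
  shows "degree (radical_pderiv I \<alpha> \<beta> q p) \<le> d + card I"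
proof -
  have dp: "degree (\<Prod>i\<in>A. [:\<beta> i, \<alpha> i:]) \<le> card A" if "finite A" for A
  proof -
    have "degree (\<Prod>i\<in>A. [:\<beta> i, \<alpha> i:]) \<le> sum (degree \<circ> (\<lambda>i. [:\<beta> i, \<alpha> i:])) A"
      using that by (rule degree_prod_sum_le)
    also have "\<dots> \<le> (\<Sum>i\<in>A. 1)" by (intro sum_mono) auto
    finally show ?thesis by simp
  qed
  have "degree (pderiv p * (\<Prod>i\<in>I. [:\<beta> i, \<alpha> i:])) \<le> d + card I"
    using degree_mult_le[of "pderiv p" "\<Prod>i\<in>I. [:\<beta> i, \<alpha> i:]"] dp[OF assms(1)] assms(2) degree_pderiv[of p] by linarith
  moreover have "degree (p * (\<Sum>i\<in>I. smult (q i * \<alpha> i) (\<Prod>j\<in>I - {i}. [:\<beta> j, \<alpha> j:]))) \<le> d + card I"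
  proof -
    have "degree (\<Sum>i\<in>I. smult (q i * \<alpha> i) (\<Prod>j\<in>I - {i}. [:\<beta> j, \<alpha> j:])) \<le> card I"
    proof (intro degree_sum_le assms(1))
      fix i assume "i \<in> I"
      have "degree (smult (q i * \<alpha> i) (\<Prod>j\<in>I - {i}. [:\<beta> j, \<alpha> j:])) \<le> card (I - {i})"
        using dp[of "I - {i}"] assms(1) degree_smult_le order.trans by blast
      also have "\<dots> \<le> card I" using assms(1) by (intro card_mono) auto
      finally show "degree (smult (q i * \<alpha> i) (\<Prod>j\<in>I - {i}. [:\<beta> j, \<alpha> j:])) \<le> card I" .
    qed
    thus ?thesis using degree_mult_le[of p "\<Sum>i\<in>I. smult (q i * \<alpha> i) (\<Prod>j\<in>I - {i}. [:\<beta> j, \<alpha> j:])"] assms(2) by linarith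
  qed
  ultimately show ?thesis unfolding radical_pderiv_def by (rule degree_add_le)
qed

text \<open>If the derivative of \<open>p \<cdot> \<Prod> L\<^sub>i\<^bsup>q i\<^esup>\<close> vanished, then comparing the orders at the root of \<open>L\<^sub>i\<close>
  would show that \<open>-q i\<close> is the multiplicity of that root in \<open>p\<close>.\<close>

lemma radical_pderiv_nonzero:
  assumes I: "finite I" "\<And>i. i \<in> I \<Longrightarrow> \<alpha> i \<noteq> 0"
    and dist: "\<And>i j. i \<in> I \<Longrightarrow> j \<in> I \<Longrightarrow> i \<noteq> j \<Longrightarrow> \<beta> i * \<alpha> j \<noteq> \<beta> j * \<alpha> i"
    and p: "p \<noteq> 0" and i: "i \<in> I" "q i \<notin> \<int>"
  shows "radical_pderiv I \<alpha> \<beta> q p \<noteq> 0"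
proof
  assume zero: "radical_pderiv I \<alpha> \<beta> q p = 0"
  define \<rho> where "\<rho> = - \<beta> i / \<alpha> i"
  define X where "X = [:-\<rho>, 1:]"
  define v where "v = order \<rho> p"
  obtain p1 where p1: "p = X ^ v * p1" "\<not> X dvd p1"
    using order_decomp[OF p, of \<rho>] by (auto simp: X_def v_def)
  have p1\<rho>: "poly p1 \<rho> \<noteq> 0" using p1(2) by (simp add: X_def poly_eq_0_iff_dvd)
  have X0: "X \<noteq> 0" by (simp add: X_def)
  define M where "M = (\<Prod>j\<in>I - {i}. [:\<beta> j, \<alpha> j:])"
  define T where "T = (\<Sum>l\<in>I - {i}. smult (q l * \<alpha> l) (\<Prod>j\<in>I - {i} - {l}. [:\<beta> j, \<alpha> j:]))"
  have Li: "[:\<beta> i, \<alpha> i:] = smult (\<alpha> i) X" using I(2)[OF i(1)] by (simp add: X_def \<rho>_def)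
  have prodI: "(\<Prod>j\<in>I. [:\<beta> j, \<alpha> j:]) = smult (\<alpha> i) X * M"
    using i I(1) by (simp add: prod.remove[of I i] M_def Li)
  have sumI: "(\<Sum>l\<in>I. smult (q l * \<alpha> l) (\<Prod>j\<in>I - {l}. [:\<beta> j, \<alpha> j:])) = smult (q i * \<alpha> i) M + smult (\<alpha> i) X * T"
  proof -
    have "(\<Prod>j\<in>I - {l}. [:\<beta> j, \<alpha> j:]) = smult (\<alpha> i) X * (\<Prod>j\<in>I - {i} - {l}. [:\<beta> j, \<alpha> j:])" if "l \<in> I - {i}" for l
    proof -
      have "I - {l} - {i} = I - {i} - {l}" by auto
      thus ?thesis using that i I(1) prod.remove[of "I - {l}" i "\<lambda>j. [:\<beta> j, \<alpha> j:]"] by (auto simp: Li)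
    qed
    hence "(\<Sum>l\<in>I - {i}. smult (q l * \<alpha> l) (\<Prod>j\<in>I - {l}. [:\<beta> j, \<alpha> j:])) = smult (\<alpha> i) X * T"
      unfolding T_def sum_distrib_left by (intro sum.cong) auto
    thus ?thesis using i I(1) by (simp add: sum.remove[of I i] M_def)
  qed
  have dX: "X * pderiv (X ^ v) = smult (real v) (X ^ v)"
  proof (cases v)
    case (Suc v')
    have "pderiv X = 1" by (simp add: X_def pderiv_pCons)
    hence d: "pderiv (X ^ Suc v') = smult (real (Suc v')) (X ^ v')"
      unfolding pderiv_power_Suc by simp
    show ?thesis unfolding Suc d by (simp del: of_nat_Suc)
  qed simp
  \<comment> \<open>The whole polynomial is \<alpha> i X^v B, and at the root \<rho> the value of
    \<open>B\<close> is (v + q i) p1(\<rho>) M(\<rho>).\<close>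
  define B where "B = smult (real v) (p1 * M) + X * (pderiv p1 * M) + smult (q i) (p1 * M) + X * (p1 * T)"
  have "radical_pderiv I \<alpha> \<beta> q p = smult (\<alpha> i) ((X * pderiv (X ^ v)) * p1 * M + X ^ v * (X * (pderiv p1 * M)) + X ^ v * smult (q i) (p1 * M) + X ^ v * (X * (p1 * T)))"
    unfolding radical_pderiv_def prodI sumI p1(1) pderiv_mult
    by (simp add: algebra_simps smult_add_right)
  also have "\<dots> = smult (\<alpha> i) (X ^ v * B)"
    unfolding dX B_def by (simp add: algebra_simps)
  finally have "B = 0" using zero X0 I(2)[OF i(1)] by simp
  hence "poly B \<rho> = 0" by simp
  moreover have "poly X \<rho> = 0" by (simp add: X_def)
  ultimately have "(real v + q i) * (poly p1 \<rho> * poly M \<rho>) = 0" by (simp add: B_def algebra_simps)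
  moreover have "poly M \<rho> \<noteq> 0"
  proof -
    have "\<beta> j + \<rho> * \<alpha> j \<noteq> 0" if "j \<in> I - {i}" for j
      using dist[of i j] that i I(2)[OF i(1)] by (auto simp: \<rho>_def field_simps)
    thus ?thesis using I(1) by (auto simp: M_def poly_prod)
  qed
  ultimately have "q i = - real v" using p1\<rho> by simp
  thus False using i(2) by auto
qed

text \<open>Here \<open>l\<close> is the number of linear forms, \<open>d\<close> bounds the
  degrees, and the second argument is one less than the number of summands.\<close>

primrec zero_bound :: "nat \<Rightarrow> nat \<Rightarrow> nat \<Rightarrow> nat" where
  "zero_bound l 0 d = d"
| "zero_bound l (Suc r) d = zero_bound l r (d + (d + 1) * l) + (d + 1)"

text \<open>Dividing by one of the radicals and differentiating \<open>d + 1\<close> times removes one summand; each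
  differentiation costs one zero by Rolle and raises the degrees by at most \<open>card I\<close>.\<close>

lemma radical_sum_zeros:
  fixes I :: "'i set" and E :: "'e set"
  assumes I: "finite I" "\<And>i. i \<in> I \<Longrightarrow> \<alpha> i > 0"
    and dist: "\<And>i j. i \<in> I \<Longrightarrow> j \<in> I \<Longrightarrow> i \<noteq> j \<Longrightarrow> \<beta> i * \<alpha> j \<noteq> \<beta> j * \<alpha> i"
    and E: "finite E" "card E = Suc r"
    and p: "\<And>e. e \<in> E \<Longrightarrow> p e \<noteq> 0" "\<And>e. e \<in> E \<Longrightarrow> degree (p e) \<le> d"
    and q: "\<And>e e'. e \<in> E \<Longrightarrow> e' \<in> E \<Longrightarrow> e \<noteq> e' \<Longrightarrow> \<exists>i\<in>I. q e i - q e' i \<notin> \<int>"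
  shows "\<not> has_at_least (Suc (zero_bound (card I) r d))
     {t \<in> {t. \<forall>i\<in>I. \<alpha> i * t + \<beta> i > 0}. (\<Sum>e\<in>E. poly (p e) t * radical I \<alpha> \<beta> (q e) t) = 0}"
proof -
  define U where "U = {t. \<forall>i\<in>I. \<alpha> i * t + \<beta> i > 0}"
  have up: "u \<in> U" if "t \<in> U" "t \<le> u" for t u
  proof -
    have "\<alpha> i * u + \<beta> i > 0" if "i \<in> I" for i
    proof -
      have "\<alpha> i * t \<le> \<alpha> i * u" using I(2)[OF that] \<open>t \<le> u\<close> by simp
      moreover have "\<alpha> i * t + \<beta> i > 0" using \<open>t \<in> U\<close> that by (simp add: U_def)
      ultimately show ?thesis by linarith
    qed
    thus ?thesis by (simp add: U_def)
  qed
  have "\<not> has_at_least (Suc (zero_bound (card I) r d)) {t \<in> U. (\<Sum>e\<in>E. poly (p e) t * radical I \<alpha> \<beta> (q e) t) = 0}"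
    using E p q
  proof (induction r arbitrary: E p q d)
    case 0
    then obtain e where e: "E = {e}" by (auto simp: card_1_singleton_iff)
    let ?Z = "{t. poly (p e) t = 0}"
    have fin: "finite ?Z" and c: "card ?Z \<le> d"
      using 0 e poly_roots_finite[of "p e"] card_poly_roots_bound[of "p e"] by (auto intro: order.trans)
    have sub: "{t \<in> U. (\<Sum>e\<in>E. poly (p e) t * radical I \<alpha> \<beta> (q e) t) = 0} \<subseteq> ?Z"
      using e less_imp_neq[OF radical_pos] by fastforce
    show ?case using card_mono[OF fin sub] finite_subset[OF sub fin] c by (simp add: has_at_least_def)
  next
    case (Suc r)
    \<comment> \<open>The summand whose radical was divided out is the polynomial \<open>p0\<close>;
      \<open>c\<close> counts the differentiations still to come, and c = 0 forces p0 = 0. The other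
      exponent vectors keep a non-integral entry, so by \<open>radical_pderiv_nonzero\<close> none
      of those summands disappears.\<close>
    have inner: "\<not> has_at_least (Suc (zero_bound (card I) r (d + c * card I) + c))
        {t \<in> U. poly p0 t + (\<Sum>e\<in>F. poly (p e) t * radical I \<alpha> \<beta> (q e) t) = 0}"
      if "finite F" "card F = Suc r" "p0 = 0 \<or> degree p0 < c" "\<And>e. e \<in> F \<Longrightarrow> p e \<noteq> 0" "\<And>e. e \<in> F \<Longrightarrow> degree (p e) \<le> d"
        "\<And>e e'. e \<in> F \<Longrightarrow> e' \<in> F \<Longrightarrow> e \<noteq> e' \<Longrightarrow> \<exists>i\<in>I. q e i - q e' i \<notin> \<int>" "\<And>e. e \<in> F \<Longrightarrow> \<exists>i\<in>I. q e i \<notin> \<int>"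
      for F :: "'e set" and c d p0 p q
      using that
    proof (induction c arbitrary: d p0 p q)
      case 0
      hence "p0 = 0" by simp
      thus ?case using Suc.IH[of F p d q] "0.prems" by simp
    next
      case (Suc c)
      let ?p = "\<lambda>e. radical_pderiv I \<alpha> \<beta> (q e) (p e)" and ?q = "\<lambda>e i. q e i - 1"
      have nz: "\<not> has_at_least (Suc (zero_bound (card I) r (d + card I + c * card I) + c))
        {t \<in> U. poly (pderiv p0) t + (\<Sum>e\<in>F. poly (?p e) t * radical I \<alpha> \<beta> (?q e) t) = 0}"
      proof (rule Suc.IH)
        show "pderiv p0 = 0 \<or> degree (pderiv p0) < c"
          using Suc.prems(3) by (auto simp: degree_pderiv pderiv_eq_0_iff)
        show "?p e \<noteq> 0" if e: "e \<in> F" for e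
        proof -
          obtain i where "i \<in> I" "q e i \<notin> \<int>" using Suc.prems(7)[OF e] by blast
          thus ?thesis using I(2) by (intro radical_pderiv_nonzero I(1) dist Suc.prems(4)[OF e]) (auto dest: I(2))
        qed
        show "degree (?p e) \<le> d + card I" if "e \<in> F" for e
          using Suc.prems(5)[OF that] by (rule degree_radical_pderiv[OF I(1)])
        show "\<exists>i\<in>I. q e i - 1 - (q e' i - 1) \<notin> \<int>" if "e \<in> F" "e' \<in> F" "e \<noteq> e'" for e e'
          using Suc.prems(6)[OF that] by simp
        show "\<exists>i\<in>I. q e i - 1 \<notin> \<int>" if e: "e \<in> F" for e
        proof -
          obtain i where "i \<in> I" "q e i \<notin> \<int>" using Suc.prems(7)[OF e] by blast
          moreover have "q e i \<in> \<int>" if "q e i - 1 \<in> \<int>" using Ints_add[OF that Ints_1] by simp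
          ultimately show ?thesis by blast
        qed
      qed (use Suc.prems in auto)
      have dv: "((\<lambda>t. poly p0 t + (\<Sum>e\<in>F. poly (p e) t * radical I \<alpha> \<beta> (q e) t)) has_real_derivative
          poly (pderiv p0) t + (\<Sum>e\<in>F. poly (?p e) t * radical I \<alpha> \<beta> (?q e) t)) (at t)" if "t \<in> U" for t
        using that by (intro DERIV_add poly_DERIV DERIV_sum poly_radical_derivative I(1)) (auto simp: U_def)
      have "\<not> has_at_least (Suc (Suc (zero_bound (card I) r (d + card I + c * card I) + c)))
        {t \<in> U. poly p0 t + (\<Sum>e\<in>F. poly (p e) t * radical I \<alpha> \<beta> (q e) t) = 0}"
      proof (rule zeros_le_zeros_derivative)
        show "u \<in> U" if "t \<in> U" "t \<le> u" for t u using that by (rule up)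
      qed (fact dv nz)+
      thus ?case by (simp add: add_ac)
    qed
    obtain e0 where e0: "e0 \<in> E" using Suc.prems(2) by fastforce
    define F where "F = E - {e0}"
    have F: "finite F" "card F = Suc r" using Suc.prems(1,2) e0 by (auto simp: F_def)
    have "\<not> has_at_least (Suc (zero_bound (card I) r (d + (d + 1) * card I) + (d + 1)))
        {t \<in> U. poly (p e0) t + (\<Sum>e\<in>F. poly (p e) t * radical I \<alpha> \<beta> (\<lambda>i. q e i - q e0 i) t) = 0}"
      by (rule inner[OF F]) (use Suc.prems(3-5) e0 in \<open>auto simp: F_def less_Suc_eq_le\<close>)
    moreover have "(\<Sum>e\<in>E. poly (p e) t * radical I \<alpha> \<beta> (q e) t) = 0 \<longleftrightarrow>
        poly (p e0) t + (\<Sum>e\<in>F. poly (p e) t * radical I \<alpha> \<beta> (\<lambda>i. q e i - q e0 i) t) = 0" for t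
    proof -
      have "(\<Sum>e\<in>E. poly (p e) t * radical I \<alpha> \<beta> (q e) t)
          = radical I \<alpha> \<beta> (q e0) t * (poly (p e0) t + (\<Sum>e\<in>F. poly (p e) t * radical I \<alpha> \<beta> (\<lambda>i. q e i - q e0 i) t))"
        using Suc.prems(1) e0 less_imp_neq[OF radical_pos[of I \<alpha> \<beta> "q e0" t]]
        by (simp add: sum.remove[of E e0] F_def radical_diff distrib_left sum_distrib_left mult.commute)
      thus ?thesis using less_imp_neq[OF radical_pos[of I \<alpha> \<beta> "q e0" t]] by simp
    qed
    ultimately show ?case by simp
  qed
  thus ?thesis by (simp add: U_def)
qed

section \<open>Counting small elements\<close>

lemma ln_one_plus_lower:
  fixes x :: real
  assumes "0 \<le> x" "x \<le> 1"
  shows "x / 2 \<le> ln (1 + x)"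
proof -
  have "ln (1 / (1 + x)) \<le> 1 / (1 + x) - 1" using assms by (intro ln_le_minus_one) auto
  hence "1 - 1 / (1 + x) \<le> ln (1 + x)" using assms by (simp add: ln_div)
  moreover have "x / 2 \<le> 1 - 1 / (1 + x)" using assms by (simp add: divide_simps) (auto intro: mult_left_le simp: algebra_simps)
  ultimately show ?thesis by linarith
qed

text \<open>Intervals of ratio 1 + 1/\<rho> cover the range from 1 to \<open>V\<close>. As ln (1 +
  1/\<rho>) >= 1/(2\<rho>), at most 2 \<rho> ln V + 1 of them are needed.\<close>

lemma card_le_logarithmic_cover:
  fixes S :: "nat set" and v :: "nat \<Rightarrow> real" and \<rho> V :: real and F :: nat
  assumes fin: "finite S" and v: "\<And>b. b \<in> S \<Longrightarrow> 1 \<le> v b" "\<And>b. b \<in> S \<Longrightarrow> v b \<le> V" and \<rho>: "\<rho> \<ge> 1" and V: "V \<ge> 1"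
    and cls: "\<And>S'. S' \<subseteq> S \<Longrightarrow> (\<And>b c. b \<in> S' \<Longrightarrow> c \<in> S' \<Longrightarrow> v c \<le> (1 + 1 / \<rho>) * v b) \<Longrightarrow> card S' \<le> F"
  shows "real (card S) \<le> (2 * \<rho> * ln V + 1) * real F"
proof -
  define \<delta> where "\<delta> = ln (1 + 1 / \<rho>)"
  have "1 / (2 * \<rho>) \<le> \<delta>" using \<rho> ln_one_plus_lower[of "1 / \<rho>"] by (simp add: \<delta>_def mult.commute)
  moreover have "0 < 1 / (2 * \<rho>)" using \<rho> by simp
  ultimately have \<delta>: "\<delta> > 0" "1 / (2 * \<rho>) \<le> \<delta>" by linarith+
  have r0: "1 + 1 / \<rho> > 0" using \<rho> by (simp add: add_pos_nonneg)
  define M where "M = nat \<lfloor>ln V / \<delta>\<rfloor>"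
  define \<kappa> where "\<kappa> b = nat \<lfloor>ln (v b) / \<delta>\<rfloor>" for b
  have "\<kappa> b \<le> M" if "b \<in> S" for b
    unfolding \<kappa>_def M_def using v[OF that] \<delta> by (intro nat_mono floor_mono divide_right_mono) auto
  hence "S \<subseteq> (\<Union>m\<in>{..M}. {b \<in> S. \<kappa> b = m})" by auto
  hence "card S \<le> card (\<Union>m\<in>{..M}. {b \<in> S. \<kappa> b = m})" using fin by (intro card_mono) auto
  also have "\<dots> \<le> (\<Sum>m\<in>{..M}. card {b \<in> S. \<kappa> b = m})" by (rule card_UN_le) simp
  also have "\<dots> \<le> (\<Sum>m\<in>{..M}. F)"
  proof (intro sum_mono cls)
    fix m b c assume bc: "b \<in> {b \<in> S. \<kappa> b = m}" "c \<in> {b \<in> S. \<kappa> b = m}"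
    have nn: "ln (v b) / \<delta> \<ge> 0" "ln (v c) / \<delta> \<ge> 0" using v(1)[of b] v(1)[of c] bc \<delta> by auto
    have "nat \<lfloor>ln (v c) / \<delta>\<rfloor> = nat \<lfloor>ln (v b) / \<delta>\<rfloor>" using bc by (simp add: \<kappa>_def)
    hence "ln (v c) / \<delta> \<le> ln (v b) / \<delta> + 1" using nn by linarith
    hence "ln (v c) \<le> ln (v b) + \<delta>" using \<delta> by (simp add: field_simps)
    also have "\<dots> = ln (v b * (1 + 1 / \<rho>))"
      unfolding \<delta>_def using v(1)[of b] bc r0 by (simp add: ln_mult_pos)
    finally have "ln (v c) \<le> ln (v b * (1 + 1 / \<rho>))" .
    moreover have "v c > 0" "v b * (1 + 1 / \<rho>) > 0" using v(1)[of b] v(1)[of c] bc r0 by auto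
    ultimately have "v c \<le> v b * (1 + 1 / \<rho>)" by (simp only: ln_le_cancel_iff)
    thus "v c \<le> (1 + 1 / \<rho>) * v b" by (simp only: mult.commute)
  qed auto
  finally have "card S \<le> (M + 1) * F" by simp
  hence "real (card S) \<le> (real M + 1) * real F" by (metis of_nat_1 of_nat_add of_nat_le_iff of_nat_mult)
  also have "real M \<le> 2 * \<rho> * ln V"
  proof -
    have "real M \<le> ln V / \<delta>" unfolding M_def using V \<delta> by simp
    also have "\<dots> \<le> ln V / (1 / (2 * \<rho>))" using V \<delta> \<rho> by (intro divide_left_mono) auto
    finally show ?thesis by (simp add: mult.commute)
  qed
  finally show ?thesis by (simp add: mult_right_mono)
qed

text \<open>The functions are the monomials \<open>b\<^sup>j \<Prod> x\<^sub>i\<^bsup>e i\<^esup>\<close> with \<open>j < D\<close> and \<open>e i < k\<close>, where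
  \<open>x\<^sub>i\<^sup>k = a i \<cdot> b + n\<close>. The factor \<open>b\<^sup>j\<close> is treated as a radical as well, of the linear form with
  index \<open>0\<close>.\<close>

lemma close_solutions_bound:
  fixes k l D :: nat and n :: int and a :: "nat \<Rightarrow> nat" and S :: "nat set" and b0 :: nat and y \<rho> X Z :: real
  assumes k: "k \<ge> 1" and l: "l \<ge> 1" and D: "D \<ge> 1" and n: "n \<noteq> 0"
    and a: "\<And>i. i \<in> {1..l} \<Longrightarrow> 0 < a i" "inj_on a {1..l}"
    and S: "\<And>b. b \<in> S \<Longrightarrow> 0 < b" "\<And>b i. b \<in> S \<Longrightarrow> i \<in> {1..l} \<Longrightarrow> perfect_power k (int (a i) * int b + n)"
    and b0: "b0 \<in> S" "\<And>b. b \<in> S \<Longrightarrow> b0 \<le> b" and \<rho>: "\<rho> \<ge> 1"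
    and y: "y > 0" "y \<le> real b0" "\<And>i. i \<in> {1..l} \<Longrightarrow> real (a i) * y \<le> real (a i) * real b0 + real_of_int n"
    and close: "\<And>b. b \<in> S \<Longrightarrow> real b - real b0 \<le> y / \<rho>"
    and X: "\<And>b. b \<in> S \<Longrightarrow> real b \<le> X"
    and Z: "Z \<ge> 1" "\<And>b i. b \<in> S \<Longrightarrow> i \<in> {1..l} \<Longrightarrow> real (a i) * real b + real_of_int n \<le> Z"
    and s: "s = D * k ^ l"
    and count: "(8 * real s ^ 2 * (real (Suc l) * (real D + real s)) ^ s) ^ s * ((\<Prod>j<D. X ^ j * Z ^ l) ^ (k ^ l)) < \<rho> ^ (s * (s - 1) div 2)"
  shows "card S \<le> (\<Sum>r<k ^ l. zero_bound l r D)"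
proof -
  define I where "I = {1..l}"
  define I0 where "I0 = insert 0 I"
  define \<alpha> where "\<alpha> i = (if i = 0 then 1 else real (a i))" for i
  define \<beta> where "\<beta> i = (if i = 0 then 0 else real_of_int n)" for i :: nat
  define E where "E = (I \<rightarrow>\<^sub>E {..<k})"
  define J where "J = {..<D} \<times> E"
  define q where "q = (\<lambda>(j, e) i. if i = (0::nat) then real j else real (e i) / real k)" 
  define g where "g j b = radical I0 \<alpha> \<beta> (q j) (real b)" for j :: "nat \<times> (nat \<Rightarrow> nat)" and b :: nat
  define C where "C = (real (Suc l) * (real D + real s)) ^ s"
  define K where "K = (\<lambda>(j, e :: nat \<Rightarrow> nat). X ^ j * Z ^ l)"
  \<comment> \<open>Taylor coefficients in the variable \<theta> = (b - b0) / (y / \<rho>), which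
    stays between 0 and 1 on \<open>S\<close>. The h-th derivative has size y^(-h) relative to
    \<open>K\<close>, so the h-th coefficient gains \<rho>^(-h).\<close>
  define \<gamma> where "\<gamma> j h = radical_diffs I0 \<alpha> \<beta> h (q j) (real b0) / fact h * (y / \<rho>) ^ h" for j h
  define \<theta> where "\<theta> b = (real b - real b0) / (y / \<rho>)" for b :: nat
  have finI: "finite I" "card I = l" "0 \<notin> I" by (auto simp: I_def)
  have finI0: "finite I0" "card I0 = Suc l" "I0 \<noteq> {}" using finI by (auto simp: I0_def)
  have finE: "finite E" "card E = k ^ l" using finI by (auto simp: E_def finite_PiE card_PiE)
  have finJ: "finite J" "card J = s" using finE by (auto simp: J_def s)
  have s1: "s \<ge> 1" using s D k by simp
  have kr: "real k > 0" using k by simp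
  have X1: "X \<ge> 1" using S(1)[OF b0(1)] X[OF b0(1)] by linarith
  have \<alpha>0: "\<alpha> i > 0" if "i \<in> I0" for i using that a(1)[of i] by (auto simp: \<alpha>_def I0_def I_def)
  have yL: "\<alpha> i * y \<le> \<alpha> i * real b0 + \<beta> i" if "i \<in> I0" for i
    using that y(2) y(3)[of i] by (auto simp: \<alpha>_def \<beta>_def I0_def I_def)
  have root: "\<exists>x::nat. 0 < x \<and> \<alpha> i * real b + \<beta> i = real x ^ k" if b: "b \<in> S" and i: "i \<in> I" for b i
  proof -
    obtain x :: nat where x: "0 < x" "int (a i) * int b + n = int x ^ k"
      using S(2)[of b i] b i by (auto simp: perfect_power_def I_def)
    have "real (a i) * real b + real_of_int n = real x ^ k" using x(2)[THEN arg_cong[where f = real_of_int]] by simp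
    thus ?thesis using x(1) i by (auto simp: \<alpha>_def \<beta>_def I_def)
  qed
  have Lpos: "\<alpha> i * real b + \<beta> i > 0" if "b \<in> S" "i \<in> I0" for b i
    using root[OF that(1), of i] that S(1)[OF that(1)] by (auto simp: I0_def \<alpha>_def \<beta>_def)
  have split: "radical I0 \<alpha> \<beta> (q (j, e)) (real b) = real b ^ j * radical I \<alpha> \<beta> (\<lambda>i. real (e i) / real k) (real b)"
    if "b \<in> S" for j e b
  proof -
    have "(\<Sum>i\<in>I. q (j, e) i * ln (\<alpha> i * real b + \<beta> i)) = (\<Sum>i\<in>I. real (e i) / real k * ln (\<alpha> i * real b + \<beta> i))"
      using finI(3) by (intro sum.cong) (auto simp: q_def)
    moreover have "exp (real j * ln (real b)) = real b ^ j" using S(1)[OF that] by (simp add: exp_of_nat_mult)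
    ultimately show ?thesis using finI by (simp add: radical_def I0_def exp_add q_def \<alpha>_def \<beta>_def)
  qed
  have radI: "\<exists>m::nat. radical I \<alpha> \<beta> (\<lambda>i. real (e i) / real k) (real b) = real m \<and> real m \<le> Z ^ l"
    if b: "b \<in> S" and e: "e \<in> E" for e b
  proof -
    obtain x where x: "\<And>i. i \<in> I \<Longrightarrow> 0 < x i \<and> \<alpha> i * real b + \<beta> i = real (x i) ^ k" using root[OF b] by metis
    have "radical I \<alpha> \<beta> (\<lambda>i. real (e i) / real k) (real b) = (\<Prod>i\<in>I. exp (real (e i) / real k * ln (\<alpha> i * real b + \<beta> i)))"
      using finI by (simp add: radical_def exp_sum)
    also have "\<dots> = (\<Prod>i\<in>I. real (x i) ^ e i)"
    proof (intro prod.cong refl)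
      fix i assume i: "i \<in> I"
      have "real (e i) / real k * ln (\<alpha> i * real b + \<beta> i) = real (e i) * ln (real (x i))"
        using x[OF i] kr by (simp add: ln_realpow)
      thus "exp (real (e i) / real k * ln (\<alpha> i * real b + \<beta> i)) = real (x i) ^ e i"
        using x[OF i] by (simp add: exp_of_nat_mult)
    qed
    finally have eq: "radical I \<alpha> \<beta> (\<lambda>i. real (e i) / real k) (real b) = real (\<Prod>i\<in>I. x i ^ e i)" by simp
    have "(\<Prod>i\<in>I. real (x i) ^ e i) \<le> (\<Prod>i\<in>I. Z)"
    proof (intro prod_mono conjI)
      fix i assume i: "i \<in> I"
      have "e i < k" using e i by (auto simp: E_def PiE_iff)
      hence "real (x i) ^ e i \<le> real (x i) ^ k" using x[OF i] by (intro power_increasing) auto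
      also have "\<dots> = real (a i) * real b + real_of_int n" using x[OF i] i by (auto simp: \<alpha>_def \<beta>_def I_def)
      also have "\<dots> \<le> Z" using Z(2)[OF b] i by (simp add: I_def)
      finally show "real (x i) ^ e i \<le> Z" .
    qed auto
    also have "\<dots> = Z ^ l" by (simp add: finI)
    finally have "real (\<Prod>i\<in>I. x i ^ e i) \<le> Z ^ l" by simp
    thus ?thesis using eq by blast
  qed
  have gK: "g j b \<in> \<int>" "g j b \<le> K j" if jJ: "j \<in> J" and bS: "b \<in> S" for j b
  proof -
    obtain i e where j: "j = (i, e)" "e \<in> E" using jJ by (auto simp: J_def)
    obtain m :: nat where m: "radical I \<alpha> \<beta> (\<lambda>i. real (e i) / real k) (real b) = real m" "real m \<le> Z ^ l"
      using radI[OF bS j(2)] by blast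
    have g: "g j b = real b ^ i * real m" by (simp add: g_def j(1) split[OF bS] m(1))
    show "g j b \<in> \<int>" by (simp add: g)
    have "real b ^ i * real m \<le> X ^ i * Z ^ l" using m(2) X[OF bS] X1 by (intro mult_mono power_mono) auto
    moreover have "K j = X ^ i * Z ^ l" by (simp add: K_def j(1))
    ultimately show "g j b \<le> K j" by (simp only: g)
  qed
  have K0: "K j > 0" for j using X1 Z by (auto simp: K_def split: prod.split)
  have q0: "0 \<le> q j i" "q j i \<le> real D" if jJ: "j \<in> J" and iI: "i \<in> I0" for j i
  proof -
    obtain m e where j: "j = (m, e)" "m < D" "e \<in> E" using jJ by (auto simp: J_def)
    have "real (e i) / real k \<le> 1" if "i \<in> I"
      using j(3) that kr by (auto simp: E_def PiE_iff intro: less_imp_le)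
    thus "0 \<le> q j i" "q j i \<le> real D" using iI j D by (auto simp: q_def I0_def)
  qed
  have C1: "real (Suc l) * (real D + real s) \<ge> 1" using D by (intro mult_ge1_I) auto
  have "\<exists>c :: nat \<times> (nat \<Rightarrow> nat) \<Rightarrow> int. (\<exists>j\<in>J. c j \<noteq> 0) \<and> (\<forall>b\<in>S. (\<Sum>j\<in>J. real_of_int (c j) * g j b) = 0)"
  proof (rule vanishing_combination[OF finJ s1 K0 \<rho>])
    show "C > 0" using C1 by (simp add: C_def)
    show "g j b \<in> \<int>" if "j \<in> J" "b \<in> S" for j b by (rule gK[OF that])
    show "\<bar>\<theta> b\<bar> \<le> 1" if "b \<in> S" for b
    proof -
      have "y / \<rho> > 0" using y \<rho> by simp
      moreover have "0 \<le> real b - real b0" using b0(2)[OF that] by simp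
      ultimately show ?thesis using close[OF that] unfolding \<theta>_def by (simp only: abs_of_nonneg divide_nonneg_pos divide_le_eq_1_pos)
    qed
    have g0: "radical I0 \<alpha> \<beta> (q j) (real b0) \<le> K j" if "j \<in> J" for j using gK(2)[OF that b0(1)] by (simp add: g_def)
    show "\<bar>\<gamma> j h\<bar> \<le> C * K j / \<rho> ^ h" if "j \<in> J" "h < s" for j h
    proof -
      have "\<bar>radical_diffs I0 \<alpha> \<beta> h (q j) (real b0)\<bar> \<le> (real (card I0) * (real D + real h)) ^ h * radical I0 \<alpha> \<beta> (q j) (real b0) / y ^ h"
        using q0[OF that(1)] by (intro radical_diffs_bound finI0(1) \<alpha>0 y(1) yL) auto
      also have "\<dots> \<le> C * K j / y ^ h"
      proof (intro divide_right_mono mult_mono g0 that)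
        have "(real (card I0) * (real D + real h)) ^ h \<le> (real (Suc l) * (real D + real s)) ^ h"
          unfolding finI0(2) using that by (intro power_mono mult_left_mono) auto
        also have "\<dots> \<le> C" unfolding C_def using C1 that by (intro power_increasing) auto
        finally show "(real (card I0) * (real D + real h)) ^ h \<le> C" .
        show "0 \<le> C" using C1 by (simp add: C_def)
      qed (use y less_imp_le[OF radical_pos] in auto)
      finally have d: "\<bar>radical_diffs I0 \<alpha> \<beta> h (q j) (real b0)\<bar> \<le> C * K j / y ^ h" .
      have yr: "y / \<rho> > 0" using y \<rho> by simp
      have "\<bar>\<gamma> j h\<bar> = \<bar>radical_diffs I0 \<alpha> \<beta> h (q j) (real b0)\<bar> / fact h * (y / \<rho>) ^ h"
        using y \<rho> by (simp add: \<gamma>_def abs_mult power_abs)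
      also have "\<dots> \<le> \<bar>radical_diffs I0 \<alpha> \<beta> h (q j) (real b0)\<bar> / 1 * (y / \<rho>) ^ h"
        using yr by (intro mult_right_mono divide_left_mono) (auto simp: fact_ge_1)
      also have "\<dots> \<le> C * K j / y ^ h * (y / \<rho>) ^ h" using d yr by (intro mult_right_mono) auto
      also have "\<dots> = C * K j / \<rho> ^ h" using y by (simp add: power_divide)
      finally show ?thesis .
    qed
    show "\<bar>g j b - (\<Sum>h<s. \<gamma> j h * \<theta> b ^ h)\<bar> \<le> C * K j / \<rho> ^ s" if "j \<in> J" "b \<in> S" for j b
    proof -
      have "\<gamma> j h * \<theta> b ^ h = radical_diffs I0 \<alpha> \<beta> h (q j) (real b0) / fact h * (real b - real b0) ^ h" for h
        using y \<rho> by (simp add: \<gamma>_def \<theta>_def mult.assoc flip: power_mult_distrib)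
      hence "\<bar>g j b - (\<Sum>h<s. \<gamma> j h * \<theta> b ^ h)\<bar> \<le> (real (card I0) * (real D + real s)) ^ s * radical I0 \<alpha> \<beta> (q j) (real b) / \<rho> ^ s"
        unfolding g_def using q0[OF that(1)] b0(2)[OF that(2)] close[OF that(2)] D s1 \<rho>
        by (simp only:) (intro radical_taylor[OF finI0(1,3) \<alpha>0 y(1) yL], auto)
      also have "\<dots> = C * g j b / \<rho> ^ s" by (simp add: C_def g_def finI0)
      also have "\<dots> \<le> C * K j / \<rho> ^ s"
        using gK(2)[OF that] C1 \<rho> by (intro divide_right_mono mult_left_mono) (auto simp: C_def)
      finally show ?thesis .
    qed
    have "(\<Prod>j\<in>J. K j) = (\<Prod>j<D. \<Prod>e\<in>E. X ^ j * Z ^ l)"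
      unfolding J_def K_def by (rule prod.cartesian_product[symmetric])
    also have "\<dots> = (\<Prod>j<D. X ^ j * Z ^ l) ^ (k ^ l)" by (simp add: finE prod_power_distrib)
    finally show "(8 * real s ^ 2 * C) ^ s * (\<Prod>j\<in>J. K j) < \<rho> ^ (s * (s - 1) div 2)"
      using count by (simp add: C_def)
  qed
  then obtain c :: "nat \<times> (nat \<Rightarrow> nat) \<Rightarrow> int" where c: "\<exists>j\<in>J. c j \<noteq> 0" "\<And>b. b \<in> S \<Longrightarrow> (\<Sum>j\<in>J. real_of_int (c j) * g j b) = 0" by blast
  \<comment> \<open>Collecting the monomials with the same exponents \<open>e\<close> of the roots
    turns the vanishing combination into a sum of polynomials times radicals over \<open>I\<close>
    alone.\<close>
  define p where "p e = (\<Sum>j<D. monom (real_of_int (c (j, e))) j)" for e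
  have cp: "coeff (p e) j = (if j < D then real_of_int (c (j, e)) else 0)" for e j
  proof -
    have "coeff (p e) j = (\<Sum>m<D. if m = j then real_of_int (c (j, e)) else 0)"
      unfolding p_def coeff_sum by (intro sum.cong) auto
    thus ?thesis by simp
  qed
  define E' where "E' = {e \<in> E. p e \<noteq> 0}"
  have finE': "finite E'" "card E' \<le> k ^ l" using finE card_mono[of E E'] by (auto simp: E'_def)
  have "E' \<noteq> {}"
  proof -
    obtain j e where "(j, e) \<in> J" "c (j, e) \<noteq> 0" using c(1) by auto
    hence "coeff (p e) j \<noteq> 0" "e \<in> E" by (auto simp: cp J_def)
    thus ?thesis by (auto simp: E'_def)
  qed
  then obtain r where r: "card E' = Suc r" using finE' by (metis card_eq_0_iff not0_implies_Suc)
  define qq where "qq e i = real (e i) / real k" for e :: "nat \<Rightarrow> nat" and i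
  define U where "U = {t \<in> {t. \<forall>i\<in>I. \<alpha> i * t + \<beta> i > 0}. (\<Sum>e\<in>E'. poly (p e) t * radical I \<alpha> \<beta> (qq e) t) = 0}"
  have few: "\<not> has_at_least (Suc (zero_bound (card I) r D)) U"
    unfolding U_def
  proof (rule radical_sum_zeros[OF finI(1) _ _ finE'(1) r])
    show "\<alpha> i > 0" if "i \<in> I" for i using \<alpha>0[of i] that by (simp add: I0_def)
    show "\<beta> i * \<alpha> j \<noteq> \<beta> j * \<alpha> i" if "i \<in> I" "j \<in> I" "i \<noteq> j" for i j
      using that n inj_onD[OF a(2), of i j] by (auto simp: \<alpha>_def \<beta>_def I_def)
    show "p e \<noteq> 0" if "e \<in> E'" for e using that by (simp add: E'_def)
    show "degree (p e) \<le> D" for e by (rule degree_le) (auto simp: cp)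
    show "\<exists>i\<in>I. qq e i - qq e' i \<notin> \<int>" if ee: "e \<in> E'" "e' \<in> E'" "e \<noteq> e'" for e e'
    proof -
      have eE: "e \<in> E" "e' \<in> E" using ee by (auto simp: E'_def)
      obtain i where i: "i \<in> I" "e i \<noteq> e' i"
      proof (rule ccontr)
        assume "\<not> thesis"
        hence "\<And>i. i \<in> I \<Longrightarrow> e i = e' i" using that by blast
        hence "e = e'" using eE unfolding E_def by (intro PiE_ext[of e I _ e']) auto
        thus False using ee by simp
      qed
      have lt: "e i < k" "e' i < k" using eE i by (auto simp: E_def PiE_iff)
      have "qq e i - qq e' i \<notin> \<int>"
      proof
        assume "qq e i - qq e' i \<in> \<int>"
        then obtain z where z: "qq e i - qq e' i = of_int z" by (auto elim: Ints_cases)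
        hence "(real (e i) - real (e' i)) = real_of_int z * real k" using kr by (simp add: qq_def field_simps)
        hence "real_of_int (int (e i) - int (e' i)) = real_of_int (z * int k)" by simp
        hence "int (e i) - int (e' i) = z * int k" by (simp only: of_int_eq_iff)
        moreover have "\<bar>int (e i) - int (e' i)\<bar> < int k" using lt by linarith
        ultimately have "z = 0" by (cases "z = 0") (auto simp: abs_mult mult_less_cancel_right2)
        thus False using \<open>int (e i) - int (e' i) = z * int k\<close> i by simp
      qed
      thus ?thesis using i by blast
    qed
  qed
  have sub: "real ` S \<subseteq> U"
  proof (rule image_subsetI)
    fix b assume b: "b \<in> S"
    have "(\<Sum>e\<in>E'. poly (p e) (real b) * radical I \<alpha> \<beta> (qq e) (real b)) = (\<Sum>e\<in>E. poly (p e) (real b) * radical I \<alpha> \<beta> (qq e) (real b))"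
      using finE by (intro sum.mono_neutral_left) (auto simp: E'_def)
    also have "\<dots> = (\<Sum>e\<in>E. \<Sum>j<D. real_of_int (c (j, e)) * g (j, e) b)"
      by (intro sum.cong refl) (simp add: p_def poly_sum poly_monom sum_distrib_right g_def split[OF b] qq_def[abs_def] mult.assoc)
    also have "\<dots> = (\<Sum>j\<in>J. real_of_int (c j) * g j b)"
      unfolding J_def by (subst sum.swap) (simp add: sum.cartesian_product)
    also have "\<dots> = 0" by (rule c(2)[OF b])
    finally show "real b \<in> U" using Lpos[OF b] by (simp add: U_def I0_def)
  qed
  have finU: "finite U" "card U \<le> zero_bound (card I) r D" using few by (auto simp: has_at_least_def not_less_eq_eq)
  have "card S = card (real ` S)" by (simp add: card_image)
  also have "\<dots> \<le> card U" by (rule card_mono[OF finU(1) sub])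
  also have "\<dots> \<le> zero_bound l r D" using finU finI by simp
  \<comment> \<open>The number r + 1 of nonzero polynomials depends on \<open>S\<close>; summing
    over all possibilities gives a uniform bound.\<close>
  also have "\<dots> \<le> (\<Sum>r<k ^ l. zero_bound l r D)"
    using r finE'(2) by (intro member_le_sum) auto
  finally show ?thesis .
qed

text \<open>With K = k^l and s = D K functions, \<open>close_solutions_bound\<close> asks, up to
  lower order in \<open>D\<close>, that X^(K D^2 / 2) be less than \<rho>^(K^2 D^2 / 2), so \<rho>
  slightly above X^(1/K) is enough. About \<rho> log |n| intervals with at most \<open>F\<close>
  elements each give the exponent T / K.\<close>

lemma small_elements_count:
  fixes k l :: nat and T C \<epsilon> :: real
  assumes k: "k \<ge> 1" and l: "l \<ge> 1" and T: "T \<ge> 1" and C: "C \<ge> 1" and \<epsilon>: "\<epsilon> > 0"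
  shows "\<exists>N0. \<forall>(n::int) (a::nat \<Rightarrow> nat). N0 \<le> real_of_int \<bar>n\<bar> \<longrightarrow>
     (\<forall>i\<in>{1..l}. 0 < a i \<and> real (a i) \<le> real_of_int \<bar>n\<bar> powr C) \<longrightarrow> inj_on a {1..l} \<longrightarrow>
     real (card {b. 0 < b \<and> real b \<le> real_of_int \<bar>n\<bar> powr T \<and> (\<forall>i\<in>{1..l}. perfect_power k (int (a i) * int b + n))})
       \<le> real_of_int \<bar>n\<bar> powr (T / real k ^ l + \<epsilon>)"
proof -
  define K where "K = real k ^ l"
  have K1: "K \<ge> 1" using k by (simp add: K_def one_le_power)
  define W where "W = real l * (C + T + 1)"
  have W0: "W \<ge> 0" using T C by (simp add: W_def)
  \<comment> \<open>The factors Z^l contribute \<open>W\<close>, which enters linearly in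
    \<open>D\<close> against D^2 in the main term; this \<open>D\<close> moves it below the
    \<epsilon>/2 in the exponent of \<rho>, with 1 to spare for the constant
    \<open>w\<close>.\<close>
  define D where "D = nat \<lceil>2 * (2 * W + 1) / \<epsilon>\<rceil> + 1"
  define s where "s = D * k ^ l"
  define C0 where "C0 = (real (Suc l) * (real D + real s)) ^ s"
  define w where "w = ln (8 * real s ^ 2 * C0)"
  define F where "F = (\<Sum>r<k ^ l. zero_bound l r D)"
  define G where "G = real F * (2 * (T + C) * (4 / \<epsilon>) + 1)"
  have D1: "D \<ge> 1" by (simp add: D_def)
  have Deps: "2 * W + 1 \<le> (real D - 1) * (\<epsilon> / 2)"
  proof -
    have "2 * (2 * W + 1) / \<epsilon> \<le> real D - 1" unfolding D_def using W0 \<epsilon> by linarith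
    thus ?thesis using \<epsilon> by (simp add: field_simps)
  qed
  have sK: "real s = real D * K" by (simp add: s_def K_def)
  have s1: "s \<ge> 1" using D1 k by (simp add: s_def)
  have C0: "C0 > 0" using D1 by (auto simp: C0_def intro!: zero_less_power mult_pos_pos)
  have G0: "G \<ge> 0" using T C \<epsilon> by (simp add: G_def)
  show ?thesis
  proof (intro exI[of _ "max 3 (max (exp (2 * w + 1)) ((G + 1) powr (4 / \<epsilon>)))"] allI impI)
    fix n :: int and a :: "nat \<Rightarrow> nat"
    define N where "N = real_of_int \<bar>n\<bar>"
    assume N0: "max 3 (max (exp (2 * w + 1)) ((G + 1) powr (4 / \<epsilon>))) \<le> real_of_int \<bar>n\<bar>"
      and aa: "\<forall>i\<in>{1..l}. 0 < a i \<and> real (a i) \<le> real_of_int \<bar>n\<bar> powr C" and inj: "inj_on a {1..l}"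
    have N3: "N \<ge> 3" "exp (2 * w + 1) \<le> N" "(G + 1) powr (4 / \<epsilon>) \<le> N" using N0 by (auto simp: N_def)
    have n0: "n \<noteq> 0" using N3 by (auto simp: N_def)
    define L where "L = ln N"
    have L0: "L > 0" using N3 by (simp add: L_def)
    have Lw: "2 * w < L"
    proof -
      have "2 * w + 1 \<le> L" unfolding L_def using N3 by (simp add: ln_ge_iff)
      thus ?thesis by simp
    qed
    define S where "S = {b. 0 < b \<and> real b \<le> N powr T \<and> (\<forall>i\<in>{1..l}. perfect_power k (int (a i) * int b + n))}"
    define X where "X = N powr T"
    define A where "A = N powr C"
    define Z where "Z = N powr (C + T + 1)"
    define \<rho> where "\<rho> = N powr (T / K + \<epsilon> / 2)"
    \<comment> \<open>the largest singularity; Taylor expansion at \<open>b\<close> has radius of convergence \<open>b - \<sigma>\<close>\<close>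
    define \<sigma> where "\<sigma> = Max (insert 0 ((\<lambda>i. - real_of_int n / real (a i)) ` {1..l}))"
    have ai: "0 < a i" "real (a i) \<le> A" if "i \<in> {1..l}" for i using aa that by (auto simp: A_def N_def)
    have big: "1 \<le> N powr x" if "x \<ge> 0" for x using that N3 by (intro ge_one_powr_ge_zero) auto
    have XAZ: "X \<ge> 1" "A \<ge> 1" "Z \<ge> 1" "\<rho> \<ge> 1"
      using T C \<epsilon> K1 by (auto simp: X_def A_def Z_def \<rho>_def intro!: big)
    have finS: "finite S"
    proof (rule finite_subset)
      show "S \<subseteq> {..nat \<lceil>N powr T\<rceil>}" by (auto simp: S_def) linarith
    qed simp
    have \<sigma>0: "\<sigma> \<ge> 0" by (simp add: \<sigma>_def)
    have \<sigma>i: "- real_of_int n \<le> real (a i) * \<sigma>" if "i \<in> {1..l}" for i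
    proof -
      have "- real_of_int n / real (a i) \<le> \<sigma>" unfolding \<sigma>_def using that by (intro Max_ge) auto
      thus ?thesis using ai(1)[OF that] by (simp add: field_simps)
    qed
    have SL: "real (a i) * real b + real_of_int n \<ge> 1" if "b \<in> S" "i \<in> {1..l}" for b i
    proof -
      have "perfect_power k (int (a i) * int b + n)" using that by (auto simp: S_def)
      hence "int (a i) * int b + n \<ge> 1" by (auto simp: perfect_power_def Suc_leI)
      hence "real_of_int (int (a i) * int b + n) \<ge> 1" by (simp only: of_int_1_le_iff)
      thus ?thesis by simp
    qed
    \<comment> \<open>If \<sigma> is the zero of a_i t + n, then (b - \<sigma>) a_i is a positive
      integer and a_i <= A; the factor \<open>A\<close> thus ensures v b >= 1.\<close>
    define v where "v b = (real b - \<sigma>) * A" for b :: nat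
    have v1: "1 \<le> v b" if b: "b \<in> S" for b
    proof -
      have "\<sigma> \<in> insert 0 ((\<lambda>i. - real_of_int n / real (a i)) ` {1..l})" unfolding \<sigma>_def by (rule Max_in) auto
      then consider "\<sigma> = 0" | i where "i \<in> {1..l}" "\<sigma> = - real_of_int n / real (a i)" by auto
      thus ?thesis
      proof cases
        case 1
        have "1 * 1 \<le> real b * A" using b XAZ by (intro mult_mono) (auto simp: S_def)
        thus ?thesis by (simp add: v_def 1)
      next
        case 2
        have "real b - \<sigma> = (real (a i) * real b + real_of_int n) / real (a i)"
          using ai(1)[OF 2(1)] by (simp add: 2(2) field_simps)
        hence e: "(real b - \<sigma>) * real (a i) = real (a i) * real b + real_of_int n" using ai(1)[OF 2(1)] by simp
        hence "(real b - \<sigma>) * real (a i) > 0" using SL[OF b 2(1)] by linarith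
        hence "real b - \<sigma> > 0" by (simp add: zero_less_mult_iff)
        hence "(real b - \<sigma>) * real (a i) \<le> v b" unfolding v_def using ai(2)[OF 2(1)] by (intro mult_left_mono) auto
        thus ?thesis using e SL[OF b 2(1)] by linarith
      qed
    qed
    have vV: "v b \<le> X * A" if "b \<in> S" for b
      unfolding v_def using that \<sigma>0 XAZ by (intro mult_right_mono) (auto simp: S_def X_def)
    have ZS: "real (a i) * real b + real_of_int n \<le> Z" if "b \<in> S" "i \<in> {1..l}" for b i
    proof -
      have "real (a i) * real b \<le> A * X" using ai(2)[OF that(2)] that(1) XAZ by (intro mult_mono) (auto simp: S_def X_def)
      also have "A * X = N powr (C + T)" using N3 by (simp add: A_def X_def powr_add)
      finally have "real (a i) * real b \<le> N powr (C + T)" .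
      moreover have "real_of_int n \<le> N powr 1" using N3 by (simp add: N_def)
      moreover have "N powr 1 \<le> N powr (C + T)" using N3 T C by (intro powr_mono) auto
      moreover have "2 * N powr (C + T) \<le> N * N powr (C + T)" using N3 by (intro mult_right_mono) auto
      moreover have "N * N powr (C + T) = Z" using N3 by (simp add: Z_def powr_add)
      ultimately show ?thesis by linarith
    qed
    have count: "(8 * real s ^ 2 * C0) ^ s * ((\<Prod>j<D. X ^ j * Z ^ l) ^ (k ^ l)) < \<rho> ^ (s * (s - 1) div 2)"
    proof -
      have Np: "N > 0" using N3 by simp
      have pos: "8 * real s ^ 2 * C0 > 0" "(\<Prod>j<D. X ^ j * Z ^ l) > 0" using s1 C0 XAZ by (auto intro!: prod_pos mult_pos_pos)
      have lnX: "ln X = T * L" "ln Z = (C + T + 1) * L" "ln \<rho> = (T / K + \<epsilon> / 2) * L"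
        using Np by (auto simp: X_def Z_def \<rho>_def L_def ln_powr)
      have "ln (\<Prod>j<D. X ^ j * Z ^ l) = (\<Sum>j<D. ln (X ^ j * Z ^ l))"
        using XAZ by (intro ln_prod) auto
      also have "\<dots> = (\<Sum>j<D. real j * (T * L) + W * L)"
        using XAZ by (intro sum.cong refl) (simp add: ln_mult_pos ln_realpow lnX W_def)
      also have "\<dots> = (\<Sum>j<D. real j) * (T * L) + real D * (W * L)"
        by (simp add: sum.distrib sum_distrib_right)
      also have "(\<Sum>j<D. real j) = real D * (real D - 1) / 2" by (induction D) (auto simp: field_simps)
      finally have lp: "ln (\<Prod>j<D. X ^ j * Z ^ l) = real D * ((real D - 1) / 2 * (T * L) + W * L)"
        by (simp add: algebra_simps)
      have "ln ((8 * real s ^ 2 * C0) ^ s * ((\<Prod>j<D. X ^ j * Z ^ l) ^ (k ^ l))) = real s * w + K * (real D * ((real D - 1) / 2 * (T * L) + W * L))"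
      proof -
        have "ln ((8 * real s ^ 2 * C0) ^ s * ((\<Prod>j<D. X ^ j * Z ^ l) ^ (k ^ l)))
            = ln ((8 * real s ^ 2 * C0) ^ s) + ln ((\<Prod>j<D. X ^ j * Z ^ l) ^ (k ^ l))"
          by (rule ln_mult_pos) (use pos in \<open>simp_all only: zero_less_power\<close>)
        also have "\<dots> = real s * w + real (k ^ l) * ln (\<Prod>j<D. X ^ j * Z ^ l)"
          unfolding w_def by (simp only: ln_realpow)
        finally show ?thesis unfolding lp K_def by simp
      qed
      also have "\<dots> = real s / 2 * (2 * w + (real D - 1) * (T * L) + 2 * W * L)"
        unfolding sK by (simp add: field_simps)
      also have "\<dots> < real s / 2 * ((real s - 1) * ((T / K + \<epsilon> / 2) * L))"
      proof (rule mult_strict_left_mono)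
        have "(real D - 1) * K \<le> real s - 1" unfolding sK using K1 by (simp add: algebra_simps)
        hence "(real D - 1) * K * (T / K) \<le> (real s - 1) * (T / K)" using K1 T by (intro mult_right_mono) auto
        hence 1: "(real D - 1) * T \<le> (real s - 1) * (T / K)" using K1 by simp
        have "real D * 1 \<le> real s" unfolding sK using K1 by (intro mult_left_mono) auto
        hence "(real D - 1) * (\<epsilon> / 2) \<le> (real s - 1) * (\<epsilon> / 2)" using \<epsilon> by (intro mult_right_mono) auto
        hence "(real D - 1) * T + (2 * W + 1) \<le> (real s - 1) * (T / K + \<epsilon> / 2)"
          using 1 Deps by (simp add: distrib_left)
        hence "((real D - 1) * T + (2 * W + 1)) * L \<le> (real s - 1) * (T / K + \<epsilon> / 2) * L"
          using L0 by (intro mult_right_mono) auto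
        thus "2 * w + (real D - 1) * (T * L) + 2 * W * L < (real s - 1) * ((T / K + \<epsilon> / 2) * L)"
        proof -
          assume "((real D - 1) * T + (2 * W + 1)) * L \<le> (real s - 1) * (T / K + \<epsilon> / 2) * L"
          moreover have "((real D - 1) * T + (2 * W + 1)) * L = (real D - 1) * (T * L) + 2 * W * L + L"
            by (simp add: algebra_simps)
          moreover have "(real s - 1) * (T / K + \<epsilon> / 2) * L = (real s - 1) * ((T / K + \<epsilon> / 2) * L)"
            by (rule mult.assoc)
          ultimately show ?thesis using Lw by linarith
        qed
      qed (use s1 in simp)
      also have "\<dots> = real (s * (s - 1) div 2) * ln \<rho>"
      proof -
        have "even (s * (s - 1))" by auto
        hence "real (s * (s - 1) div 2) = real (s * (s - 1)) / 2" by (simp add: real_of_nat_div)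
        also have "\<dots> = real s / 2 * (real s - 1)" using s1 by (simp add: of_nat_diff)
        finally show ?thesis by (simp add: lnX)
      qed
      also have "\<dots> = ln (\<rho> ^ (s * (s - 1) div 2))" using XAZ by (simp add: ln_realpow)
      finally show ?thesis
        using pos XAZ by (subst (asm) ln_less_cancel_iff) (auto intro!: mult_pos_pos zero_less_power)
    qed
    have "real (card S) \<le> (2 * \<rho> * ln (X * A) + 1) * real F"
    proof (rule card_le_logarithmic_cover[where v = v, OF finS v1 vV])
      show "\<rho> \<ge> 1" by (rule XAZ)
      have "1 * 1 \<le> X * A" using XAZ by (intro mult_mono) auto
      thus "1 \<le> X * A" by simp
      fix S' assume S': "S' \<subseteq> S" and cl: "\<And>b c. b \<in> S' \<Longrightarrow> c \<in> S' \<Longrightarrow> v c \<le> (1 + 1 / \<rho>) * v b"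
      show "card S' \<le> F"
      proof (cases "S' = {}")
        case False
        have finS': "finite S'" using S' finS finite_subset by blast
        define b0 where "b0 = Min S'"
        have b0: "b0 \<in> S'" "\<And>b. b \<in> S' \<Longrightarrow> b0 \<le> b" using finS' False by (auto simp: b0_def)
        have b0S: "b0 \<in> S" using b0 S' by auto
        have "0 < (real b0 - \<sigma>) * A" using v1[OF b0S] by (simp add: v_def)
        hence y0: "0 < real b0 - \<sigma>" using XAZ by (simp add: zero_less_mult_iff)
        show ?thesis unfolding F_def
        proof (rule close_solutions_bound[OF k l D1 n0 ai(1) inj _ _ b0 XAZ(4) y0 _ _ _ _ XAZ(3) _ s_def])
          show "0 < b" if "b \<in> S'" for b using that S' by (auto simp: S_def)
          show "perfect_power k (int (a i) * int b + n)" if "b \<in> S'" "i \<in> {1..l}" for b i using that S' by (auto simp: S_def)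
          show "real b0 - \<sigma> \<le> real b0" using \<sigma>0 by simp
          show "real (a i) * (real b0 - \<sigma>) \<le> real (a i) * real b0 + real_of_int n" if "i \<in> {1..l}" for i
            using \<sigma>i[OF that] by (simp add: algebra_simps)
          show "real b - real b0 \<le> (real b0 - \<sigma>) / \<rho>" if "b \<in> S'" for b
          proof -
            have "(real b - \<sigma>) * A \<le> ((1 + 1 / \<rho>) * (real b0 - \<sigma>)) * A" using cl[OF b0(1) that] by (simp add: v_def mult.assoc)
            hence "real b - \<sigma> \<le> (1 + 1 / \<rho>) * (real b0 - \<sigma>)" using XAZ by simp
            thus ?thesis by (simp add: distrib_right)
          qed
          show "real b \<le> X" if "b \<in> S'" for b using that S' by (auto simp: S_def X_def)
          show "real (a i) * real b + real_of_int n \<le> Z" if "b \<in> S'" "i \<in> {1..l}" for b i using ZS that S' by blast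
          show "(8 * (real s)\<^sup>2 * (real (Suc l) * (real D + real s)) ^ s) ^ s * (\<Prod>j<D. X ^ j * Z ^ l) ^ k ^ l < \<rho> ^ (s * (s - 1) div 2)"
            using count by (simp only: C0_def)
        qed
      qed simp
    qed
    also have "ln (X * A) = (T + C) * L" using N3 by (simp add: X_def A_def L_def ln_powr flip: powr_add)
    also have "(2 * \<rho> * ((T + C) * L) + 1) * real F \<le> \<rho> * (real F * (2 * (T + C) * L + 1))"
      using XAZ(4) mult_right_mono[OF XAZ(4), of "real F"] by (simp add: algebra_simps)
    also have "\<dots> \<le> \<rho> * N powr (\<epsilon> / 2)"
    proof (rule mult_left_mono)
      have L4: "L \<le> 4 / \<epsilon> * N powr (\<epsilon> / 4)" unfolding L_def using ln_powr_bound[of N "\<epsilon> / 4"] N3 \<epsilon> by (simp add: mult.commute)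
      have N4: "N powr (\<epsilon> / 4) \<ge> 1" using \<epsilon> by (intro big) auto
      have "2 * (T + C) * L + 1 \<le> 2 * (T + C) * (4 / \<epsilon> * N powr (\<epsilon> / 4)) + N powr (\<epsilon> / 4)"
        using L4 N4 T C by (intro add_mono mult_left_mono) auto
      also have "\<dots> = (2 * (T + C) * (4 / \<epsilon>) + 1) * N powr (\<epsilon> / 4)" by (simp add: algebra_simps add_divide_distrib)
      finally have "real F * (2 * (T + C) * L + 1) \<le> G * N powr (\<epsilon> / 4)"
        unfolding G_def mult.assoc[of "real F"] by (intro mult_left_mono) auto
      also have "G \<le> N powr (\<epsilon> / 4)"
      proof -
        have "G + 1 = ((G + 1) powr (4 / \<epsilon>)) powr (\<epsilon> / 4)" using G0 \<epsilon> by (simp add: powr_powr)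
        also have "\<dots> \<le> N powr (\<epsilon> / 4)" using N3 \<epsilon> by (intro powr_mono2) auto
        finally show ?thesis by simp
      qed
      also have "N powr (\<epsilon> / 4) * N powr (\<epsilon> / 4) = N powr (\<epsilon> / 2)" by (simp flip: powr_add)
      finally show "real F * (2 * (T + C) * L + 1) \<le> N powr (\<epsilon> / 2)" by (simp add: mult_right_mono)
    qed (use XAZ in simp)
    also have "\<dots> = N powr (T / K + \<epsilon>)" by (simp add: \<rho>_def add.commute flip: powr_add)
    finally show "real (card {b. 0 < b \<and> real b \<le> real_of_int \<bar>n\<bar> powr T \<and> (\<forall>i\<in>{1..l}. perfect_power k (int (a i) * int b + n))})
       \<le> real_of_int \<bar>n\<bar> powr (T / real k ^ l + \<epsilon>)" by (simp add: S_def N_def K_def)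
  qed
qed

section \<open>The bound for \<open>B\<close>\<close>

lemma theta_bounds:
  assumes "k \<ge> 1"
  shows "theta k m \<le> totient k * k ^ m" "theta k m > 0"
proof -
  have tot: "{i. 1 \<le> i \<and> i \<le> k \<and> coprime i k} = totatives k" by (auto simp: totatives_def)
  have "theta k m \<le> (\<Sum>i | 1 \<le> i \<and> i \<le> k \<and> coprime i k. k ^ m)"
    unfolding theta_def using assms by (intro sum_mono power_mono) (auto intro: dvd_imp_le)
  also have "\<dots> = totient k * k ^ m" unfolding tot totient_def by simp
  finally show "theta k m \<le> totient k * k ^ m" .
  have fin: "finite {i. 1 \<le> i \<and> i \<le> k \<and> coprime i k}" by (simp add: tot)
  \<comment> \<open>The index i = 1 contributes gcd(0, k)^m = k^m.\<close>
  have "gcd (1 - 1) k ^ m \<le> theta k m"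
    unfolding theta_def by (rule member_le_sum[OF _ _ fin]) (use assms in auto)
  thus "theta k m > 0" using assms by (auto intro: less_le_trans[of 0 "k ^ m"])
qed

text \<open>Giving up \<open>exceptional k\<close> elements still leaves a surplus of
  \<open>s_const k\<close> - \<open>exceptional k\<close> powers of \<open>k\<close> to compensate
  the height. For k >= 6 the surplus is one power and the height is \<open>k\<close>, so t_const k
  >= 1 suffices.\<close>

lemma height_const_le:
  assumes k: "k \<ge> 3"
  shows "real (height_const k) \<le> t_const k * real k ^ (s_const k - exceptional k)" "t_const k > 0"
proof -
  have "t_const k \<ge> 1" if "k \<ge> 7"
  proof -
    have k7: "real k \<ge> 7" using that by simp
    have "7 * real k \<le> real k * real k" using k7 by (intro mult_right_mono) auto
    hence d: "real k ^ 2 - 6 * real k + 6 > 0" unfolding power2_eq_square using k7 by linarith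
    thus ?thesis using that k7 by (simp add: t_const_def)
  qed
  note large = this
  consider "k = 3" | "k = 4" | "k = 5" | "k = 6" | "k \<ge> 7" using k by linarith
  hence "real (height_const k) \<le> t_const k * real k ^ (s_const k - exceptional k) \<and> t_const k > 0"
  proof cases
    case 5
    have "1 * real k \<le> t_const k * real k" using large[OF 5] by (intro mult_right_mono) auto
    thus ?thesis using large[OF 5] 5 by (simp add: height_const_def s_const_def exceptional_def)
  qed (simp_all add: height_const_def t_const_def s_const_def exceptional_def)
  thus "real (height_const k) \<le> t_const k * real k ^ (s_const k - exceptional k)" "t_const k > 0" by blast+
qed

lemma height_quotient_le:
  assumes k: "k \<ge> 3"
  shows "real (height_const k) / real k ^ (m + s_const k - exceptional k) \<le> t_const k / real k ^ m"
proof -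
  have "exceptional k \<le> s_const k" by (simp add: exceptional_def s_const_def)
  hence "m + s_const k - exceptional k = m + (s_const k - exceptional k)" by simp
  hence "real k ^ (m + s_const k - exceptional k) = real k ^ m * real k ^ (s_const k - exceptional k)"
    by (simp add: power_add)
  moreover have "real (height_const k) / real k ^ (s_const k - exceptional k) \<le> t_const k"
    using height_const_le(1)[OF k] k by (simp add: divide_le_eq)
  ultimately show ?thesis using k by (simp add: field_simps)
qed

lemma bipartite_bound_fixed_m:
  fixes k m :: nat and \<epsilon> :: real
  assumes k: "k \<ge> 3" and m: "r_const k - s_const k \<le> m" and \<epsilon>: "\<epsilon> > 0"
  shows "\<exists>N0. \<forall>(n::int) A B. N0 \<le> real_of_int \<bar>n\<bar> \<longrightarrow> compatible k n A B \<longrightarrow> has_at_least (m + s_const k) A \<longrightarrow>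
     finite B \<and> real (card B) \<le> real_of_int \<bar>n\<bar> powr (t_const k / real k ^ m + \<epsilon>)"
proof -
  define T where "T = real (height_const k)"
  \<comment> \<open>\<open>few_huge_elements\<close> bounds an element only if
    \<open>exceptional k\<close> larger ones follow, so the last \<open>exceptional k\<close> of the
    chosen elements of \<open>A\<close> are given up.\<close>
  define l where "l = m + s_const k - exceptional k"
  define C where "C = 60 * real k * T"
  have T1: "T \<ge> 1" using k by (simp add: T_def height_const_def)
  have ls: "l + exceptional k = m + s_const k" "exceptional k < s_const k"
    by (auto simp: l_def exceptional_def s_const_def)
  have l1: "l \<ge> 1" using ls by simp
  have "1 * 1 \<le> 60 * real k * T" using T1 k by (intro mult_mono) auto
  hence C1: "C \<ge> 1" by (simp add: C_def)
  have ms: "r_const k \<le> m + s_const k" using m by linarith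
  obtain R where R: "\<And>n A B. 2 ^ (k - 1) \<le> \<bar>n\<bar> \<Longrightarrow> 128 * real k ^ 2 \<le> real_of_int \<bar>n\<bar> \<Longrightarrow> compatible k n A B \<Longrightarrow>
     has_at_least (r_const k) A \<Longrightarrow>
     \<not> has_at_least R {b \<in> B. real (height_const k) * ln (real_of_int \<bar>n\<bar>) \<le> ln (real b)}"
    using few_large_elements[OF k] by blast
  have k1: "k \<ge> 1" and e2: "\<epsilon> / 2 > 0" using k \<epsilon> by auto
  obtain N1 where N1: "\<And>n a. N1 \<le> real_of_int \<bar>n\<bar> \<Longrightarrow>
     (\<forall>i\<in>{1..l}. 0 < a i \<and> real (a i) \<le> real_of_int \<bar>n\<bar> powr C) \<Longrightarrow> inj_on a {1..l} \<Longrightarrow>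
     real (card {b. 0 < b \<and> real b \<le> real_of_int \<bar>n\<bar> powr T \<and> (\<forall>i\<in>{1..l}. perfect_power k (int (a i) * int b + n))})
       \<le> real_of_int \<bar>n\<bar> powr (T / real k ^ l + \<epsilon> / 2)"
    using small_elements_count[OF k1 l1 T1 C1 e2] by blast
  show ?thesis
  proof (intro exI[of _ "max N1 (max (2 ^ (k - 1)) (max (128 * real k ^ 2) ((real R + 1) powr (2 / \<epsilon>))))"] allI impI)
    fix n :: int and A B :: "nat set"
    define N where "N = real_of_int \<bar>n\<bar>"
    assume N0: "max N1 (max (2 ^ (k - 1)) (max (128 * real k ^ 2) ((real R + 1) powr (2 / \<epsilon>)))) \<le> real_of_int \<bar>n\<bar>"
      and AB: "compatible k n A B" and A: "has_at_least (m + s_const k) A"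
    have N: "N1 \<le> N" "2 ^ (k - 1) \<le> N" "128 * real k ^ 2 \<le> N" "(real R + 1) powr (2 / \<epsilon>) \<le> N"
      using N0 by (auto simp: N_def)
    have "real_of_int (2 ^ (k - 1)) \<le> real_of_int \<bar>n\<bar>" using N(2) by (simp add: N_def)
    hence n2: "2 ^ (k - 1) \<le> \<bar>n\<bar>" by (simp only: of_int_le_iff)
    have "(2::real) ^ 1 \<le> 2 ^ (k - 1)" using k by (intro power_increasing) auto
    hence N2: "N \<ge> 2" using N(2) by simp
    obtain f where f: "\<And>i. i < m + s_const k \<Longrightarrow> f i \<in> A" "\<And>i j. i < j \<Longrightarrow> j < m + s_const k \<Longrightarrow> f i < f j"
      using has_at_least_enumeration[OF A] by blast
    have Ar: "has_at_least (r_const k) A"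
    proof (rule has_at_leastI[of _ f])
      show "f i \<in> A" if "i < r_const k" for i using f(1)[of i] that ms by simp
      show "inj_on f {..<r_const k}"
        by (rule linorder_inj_onI) (use f(2) ms in \<open>auto simp: neq_iff dest: less_imp_neq\<close>)
    qed
    define Bl where "Bl = {b \<in> B. T * ln N \<le> ln (real b)}"
    define Bs where "Bs = {b \<in> B. ln (real b) < T * ln N}"
    have "\<not> has_at_least R Bl" using R[OF n2 _ AB Ar] N(3) by (simp add: Bl_def T_def N_def)
    hence Bl: "finite Bl" "card Bl \<le> R" by (auto simp: has_at_least_def)
    have Bpos: "0 < b" if "b \<in> B" for b using AB that by (auto simp: compatible_def)
    have Bs_le: "real b \<le> N powr T" if "b \<in> Bs" for b
    proof -
      have "real b = exp (ln (real b))" using that Bpos by (simp add: Bs_def)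
      also have "\<dots> \<le> exp (T * ln N)" using that by (simp add: Bs_def)
      also have "\<dots> = N powr T" using N2 by (simp add: powr_def)
      finally show ?thesis .
    qed
    have finBs: "finite Bs"
    proof (rule finite_subset)
      show "Bs \<subseteq> {..nat \<lceil>N powr T\<rceil>}"
      proof
        fix b assume "b \<in> Bs"
        from Bs_le[OF this] show "b \<in> {..nat \<lceil>N powr T\<rceil>}" by simp linarith
      qed
    qed simp
    have B: "B = Bl \<union> Bs" by (auto simp: Bl_def Bs_def)
    have big: "1 \<le> N powr x" if "x \<ge> 0" for x using that N2 by (intro ge_one_powr_ge_zero) auto
    have x0: "0 \<le> T / real k ^ l + \<epsilon> / 2" using T1 \<epsilon> by (intro add_nonneg_nonneg) auto
    have Bs_card: "real (card Bs) \<le> N powr (T / real k ^ l + \<epsilon> / 2)"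
    \<comment> \<open>Without two small elements there is no pair for the Thue argument, but then
      the bound is trivial, as the exponent is nonnegative.\<close>
    proof (cases "card Bs \<le> 1")
      case True
      thus ?thesis using big[OF x0] by linarith
    next
      case False
      hence h2: "has_at_least 2 Bs" unfolding has_at_least_def by linarith
      obtain g :: "nat \<Rightarrow> nat" where g: "(\<forall>i<2. g i \<in> Bs) \<and> (\<forall>i j. i < j \<longrightarrow> j < 2 \<longrightarrow> g i < g j)"
        using has_at_least_enumeration[OF h2] by blast
      have "g 0 \<in> Bs" using g by simp
      moreover have "g 1 \<in> Bs" using g by simp
      moreover have "g 0 < g 1" using conjunct2[OF g, rule_format, of 0 1] by simp
      ultimately have g01: "g 0 \<in> B" "g 1 \<in> B" "g 0 < g 1" "g 1 \<in> Bs" by (simp_all add: Bs_def)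
      have NT: "N \<le> N powr T" using N2 T1 powr_mono[of 1 T N] by simp
      have fC: "real (f i) \<le> N powr C" "0 < f i" if "i < l" for i
      proof -
        have "ln (real (f (i + 0))) < 60 * real k * ln (N powr T)"
        proof (rule few_huge_elements[OF k n2 AB g01(1-3) Bs_le[OF g01(4)], of "\<lambda>j. f (i + j)"])
          show "real_of_int \<bar>n\<bar> \<le> N powr T" using NT by (simp add: N_def)
          show "128 * (real k)\<^sup>2 \<le> N powr T" using NT N(3) by linarith
        qed (use f that ls in auto)
        hence lf: "ln (real (f i)) \<le> C * ln N" using N2 by (simp add: ln_powr C_def mult.assoc)
        have "f i \<in> A" using f(1)[of i] that ls by simp
        thus "0 < f i" using AB by (auto simp: compatible_def)
        hence "real (f i) = exp (ln (real (f i)))" by simp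
        also have "\<dots> \<le> exp (C * ln N)" using lf by simp
        also have "\<dots> = N powr C" using N2 by (simp add: powr_def)
        finally show "real (f i) \<le> N powr C" .
      qed
      define a where "a i = f (i - 1)" for i
      define S where "S = {b. 0 < b \<and> real b \<le> N powr T \<and> (\<forall>i\<in>{1..l}. perfect_power k (int (a i) * int b + n))}"
      have "inj_on a {1..l}"
      proof (rule linorder_inj_onI)
        fix i j assume "i < j" "i \<in> {1..l}" "j \<in> {1..l}"
        hence "f (i - 1) < f (j - 1)" using ls by (intro f(2)) auto
        thus "a i \<noteq> a j" by (simp add: a_def)
      qed auto
      moreover have "\<forall>i\<in>{1..l}. 0 < a i \<and> real (a i) \<le> real_of_int \<bar>n\<bar> powr C"
        using fC by (auto simp: a_def N_def)
      ultimately have "real (card S) \<le> N powr (T / real k ^ l + \<epsilon> / 2)"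
        using N1[of n a] N(1) by (simp add: S_def N_def)
      moreover have "card Bs \<le> card S"
      proof (rule card_mono)
        have "S \<subseteq> {..nat \<lceil>N powr T\<rceil>}" by (auto simp: S_def) linarith
        thus "finite S" by (rule finite_subset) simp
        show "Bs \<subseteq> S"
        proof
          fix b assume b: "b \<in> Bs"
          have "perfect_power k (int (a i) * int b + n)" if "i \<in> {1..l}" for i
          proof -
            have "a i \<in> A" unfolding a_def using that ls by (intro f(1)) auto
            thus ?thesis using AB b by (auto simp: compatible_def Bs_def)
          qed
          thus "b \<in> S" using Bs_le[OF b] b Bpos by (auto simp: S_def Bs_def)
        qed
      qed
      ultimately show ?thesis by linarith
    qed
    have "finite B" using Bl finBs by (simp add: B)
    moreover have "real (card B) \<le> N powr (t_const k / real k ^ m + \<epsilon>)"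
    proof -
      have "real (card B) \<le> real (card Bl) + real (card Bs)" unfolding B using card_Un_le[of Bl Bs] by linarith
      also have "\<dots> \<le> real R * N powr (T / real k ^ l + \<epsilon> / 2) + N powr (T / real k ^ l + \<epsilon> / 2)"
      proof (rule add_mono[OF _ Bs_card])
        have "real (card Bl) \<le> real R * 1" using Bl by simp
        also have "\<dots> \<le> real R * N powr (T / real k ^ l + \<epsilon> / 2)" using big[OF x0] by (intro mult_left_mono) auto
        finally show "real (card Bl) \<le> real R * N powr (T / real k ^ l + \<epsilon> / 2)" .
      qed
      also have "\<dots> = (real R + 1) * N powr (T / real k ^ l + \<epsilon> / 2)" by (simp add: distrib_right)
      also have "real R + 1 \<le> N powr (\<epsilon> / 2)"
      proof -
        have "real R + 1 = ((real R + 1) powr (2 / \<epsilon>)) powr (\<epsilon> / 2)" using \<epsilon> by (simp add: powr_powr)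
        also have "\<dots> \<le> N powr (\<epsilon> / 2)" using N(4) \<epsilon> by (intro powr_mono2) auto
        finally show ?thesis .
      qed
      also have "N powr (\<epsilon> / 2) * N powr (T / real k ^ l + \<epsilon> / 2) = N powr (T / real k ^ l + \<epsilon>)"
        by (simp add: add.commute flip: powr_add)
      also have "\<dots> \<le> N powr (t_const k / real k ^ m + \<epsilon>)"
        using height_quotient_le[OF k, of m] N2 by (intro powr_mono) (auto simp: T_def l_def)
      finally show ?thesis by (simp add: mult_right_mono)
    qed
    ultimately show "finite B \<and> real (card B) \<le> real_of_int \<bar>n\<bar> powr (t_const k / real k ^ m + \<epsilon>)"
      by (simp add: N_def)
  qed
qed

theorem theorem2p5:
  fixes k :: nat and h :: "real \<Rightarrow> real" and \<epsilon> :: real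
  assumes "k \<ge> 3"
    and "h \<in> o[at_top](\<lambda>y. ln (ln y))"
    and "\<epsilon> > 0"
  shows "\<exists>n0::nat. \<forall>(n::int) (m::nat) (A::nat set) (B::nat set).
           n \<noteq> 0 \<longrightarrow> \<bar>n\<bar> \<ge> int n0 \<longrightarrow>
           r_const k - s_const k \<le> m \<longrightarrow> real m \<le> h (real_of_int \<bar>n\<bar>) \<longrightarrow>
           bipartite_diophantine k n A B \<longrightarrow> has_at_least (m + s_const k) A \<longrightarrow>
           finite B \<and>
           real (card B) \<le>
             real_of_int \<bar>n\<bar> powr (t_const k * real (totient k) / real (theta k m) + \<epsilon>)"
proof -
  note k = \<open>k \<ge> 3\<close> and \<epsilon> = \<open>\<epsilon> > 0\<close>
  have t: "t_const k > 0" by (rule height_const_le(2)[OF k])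
  have kr: "real k > 1" using k by simp
  define r where "r = r_const k - s_const k"
  obtain j where j: "2 * t_const k / \<epsilon> < real k ^ j" using real_arch_pow[OF kr] by blast
  define M where "M = max r j"
  have M: "t_const k / real k ^ M \<le> \<epsilon> / 2"
  proof -
    have "real k ^ j \<le> real k ^ M" using kr by (intro power_increasing) (auto simp: M_def)
    hence "2 * t_const k / \<epsilon> < real k ^ M" using j by linarith
    thus ?thesis using \<epsilon> kr by (simp add: field_simps)
  qed
  have "\<exists>N0. \<forall>m\<in>{r..M}. \<forall>(n::int) A B. N0 \<le> real_of_int \<bar>n\<bar> \<longrightarrow> compatible k n A B \<longrightarrow> has_at_least (m + s_const k) A \<longrightarrow>
     finite B \<and> real (card B) \<le> real_of_int \<bar>n\<bar> powr (t_const k / real k ^ m + \<epsilon> / 2)"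
  proof -
    have "\<forall>m\<in>{r..M}. \<exists>N0. \<forall>(n::int) A B. N0 \<le> real_of_int \<bar>n\<bar> \<longrightarrow> compatible k n A B \<longrightarrow> has_at_least (m + s_const k) A \<longrightarrow>
       finite B \<and> real (card B) \<le> real_of_int \<bar>n\<bar> powr (t_const k / real k ^ m + \<epsilon> / 2)"
      using bipartite_bound_fixed_m[OF k] \<epsilon> by (auto simp: r_def)
    from bchoice[OF this] obtain N0 where N0: "\<forall>m\<in>{r..M}. \<forall>(n::int) A B. N0 m \<le> real_of_int \<bar>n\<bar> \<longrightarrow> compatible k n A B \<longrightarrow>
       has_at_least (m + s_const k) A \<longrightarrow>
       finite B \<and> real (card B) \<le> real_of_int \<bar>n\<bar> powr (t_const k / real k ^ m + \<epsilon> / 2)" by blast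
    have "N0 m \<le> Max (N0 ` {r..M})" if "m \<in> {r..M}" for m using that by (intro Max_ge) auto
    thus ?thesis using N0 by (intro exI[of _ "Max (N0 ` {r..M})"]) (meson order_trans)
  qed
  then obtain N0 where N0: "\<And>m n A B. m \<in> {r..M} \<Longrightarrow> N0 \<le> real_of_int \<bar>n\<bar> \<Longrightarrow> compatible k n A B \<Longrightarrow> has_at_least (m + s_const k) A \<Longrightarrow>
     finite B \<and> real (card B) \<le> real_of_int \<bar>n\<bar> powr (t_const k / real k ^ m + \<epsilon> / 2)" by blast
  show ?thesis
  proof (intro exI[of _ "max 1 (nat \<lceil>N0\<rceil>)"] allI impI)
    fix n :: int and m :: nat and A B :: "nat set"
    assume n: "\<bar>n\<bar> \<ge> int (max 1 (nat \<lceil>N0\<rceil>))" and m: "r_const k - s_const k \<le> m"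
      and AB: "bipartite_diophantine k n A B" and A: "has_at_least (m + s_const k) A"
    have n1: "real_of_int \<bar>n\<bar> \<ge> 1" "N0 \<le> real_of_int \<bar>n\<bar>" using n by linarith+
    have comp: "compatible k n A B" using AB by (auto simp: bipartite_diophantine_def compatible_def)
    \<comment> \<open>A set \<open>A\<close> large enough for \<open>m\<close> is large enough for
      every smaller value, so capping at \<open>M\<close> leaves a finite range of values and one
      common \<open>N0\<close>. Beyond \<open>M\<close> the exponent t / k^M is at most \<epsilon>/2
      anyway.\<close>
    define m' where "m' = min m M"
    have m': "m' \<in> {r..M}" using m by (auto simp: m'_def M_def r_def)
    have "has_at_least (m' + s_const k) A"
      using A by (auto simp: has_at_least_def m'_def)
    from N0[OF m' n1(2) comp this] have B: "finite B"
      "real (card B) \<le> real_of_int \<bar>n\<bar> powr (t_const k / real k ^ m' + \<epsilon> / 2)" by auto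
    have "t_const k / real k ^ m' + \<epsilon> / 2 \<le> t_const k * real (totient k) / real (theta k m) + \<epsilon>"
    proof (cases "m \<le> M")
      case True
      have th: "real (theta k m) \<le> real (totient k) * real k ^ m" "real (theta k m) > 0"
        using theta_bounds[of k m] k by (simp_all flip: of_nat_power of_nat_mult)
      have "t_const k / real k ^ m = t_const k * (1 / real k ^ m)" by simp
      also have "1 / real k ^ m \<le> real (totient k) / real (theta k m)"
        using th kr by (simp add: field_simps)
      finally show ?thesis using True t \<epsilon> by (simp add: m'_def)
    next
      case False
      have "0 \<le> t_const k * real (totient k) / real (theta k m)" using t by simp
      moreover have "m' = M" using False by (simp add: m'_def)
      ultimately show ?thesis using M \<epsilon> unfolding \<open>m' = M\<close> by linarith
    qed
    hence "real_of_int \<bar>n\<bar> powr (t_const k / real k ^ m' + \<epsilon> / 2)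
        \<le> real_of_int \<bar>n\<bar> powr (t_const k * real (totient k) / real (theta k m) + \<epsilon>)"
      using n1 by (intro powr_mono)
    thus "finite B \<and> real (card B) \<le> real_of_int \<bar>n\<bar> powr (t_const k * real (totient k) / real (theta k m) + \<epsilon>)"
      using B by simp
  qed
qed

end
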